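(* Let $k\ge 1$ be an integer and $G$ a graph. Every $k$-strategy $\Sigma$ defines a canonical tree-decomposition $(T,\mathcal{V})$ of $G$, of adhesion $<k$, that distinguishes all the $k$-blocks and tangles of order $k$ of $G$. That is: with $\mathcal{P}$ the set of all $k$-profiles in $G$, the tree-decomposition $(T,\mathcal{V})$ defined by $\Sigma$ on $G$ (the one inducing the set $N_\Sigma(G,\mathcal{P})$) has adhesion $<k$; whenever $P\neq P'$ are distinct $k$-profiles in $G$ each of which is either the $k$-profile $P_k(b)$ of a $k$-block $b$ of $G$ or a tangle of order $k$ in $G$, some separation induced by $(T,\mathcal{V})$ distinguishes $P$ from $P'$ (in particular, any two distinct $k$-blocks are distinguished); and for each fixed $\Sigma$ the map $G\mapsto (T,\mathcal{V})$ commutes with all graph isomorphisms $G\to G'$. In particular, such a decomposition exists for every $k$ and $G$.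
   Context: **Separations.** All graphs are finite, undirected and simple; $G$ has vertex set $V$. A separation of $G$ is a pair $(A,B)$ with $A,B\subseteq V$, $A\cup B=V$, such that $G$ has no edge between $A\setminus B$ and $B\setminus A$. Its order is $|A\cap B|$, its inverse is $(B,A)$; it is proper if neither $A\subseteq B$ nor $B\subseteq A$. A $(<k)$-separation is one of order $<k$; a $k$-separation is one of order exactly $k$. Write $(A,B)\le(C,D)$ if $A\subseteq C$ and $B\supseteq D$. Two separations $(A,B),(C,D)$ are nested if $(A,B)$ is $\le$-comparable with $(C,D)$ or with $(D,C)$; otherwise they cross. A separation is nested with a set $S$ of separations if it is nested with every element of $S$. A set of separations is nested if every two of its elements are nested. A separation system is a set of separations closed under taking inverses; it is proper if all its elements are proper. A set of separations is antisymmetric if it contains no separation together with its inverse. **Profiles.** A set $P$ of separations is consistent if whenever $(A,B)\in P$ and $(C,D)\le(A,B)$ is a separation, then $(D,C)\notin P$. A profile is a consistent set $P$ of separations such that for all $(A,B),(C,D)\in P$ we have $(B\cap D,A\cup C)\notin P$. A $k$-profile is a profile $P$ all of whose elements have order $<k$ and which contains, for every separation $(A,B)$ of order $<k$, exactly one of $(A,B),(B,A)$. An antisymmetric set $P$ of separations orients a set $S$ of separations if for every $(A,B)\in S$ either $(A,B)\in P$ or $(B,A)\in P\cap S$; then $P\cap S$ is an orientation of $S$. A separation $(A,B)$ distinguishes two sets $P,P'$ of separations if $(A,B)\in P\setminus P'$ and $(B,A)\in P'\setminus P$, or vice versa. A set $S$ of separations distinguishes a set $\mathcal{P}$ of sets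 of separations if every two distinct elements of $\mathcal{P}$ are distinguished by some element of $S$. A separation $(A,B)$ splits a consistent set $O$ if both $O\cup\{(A,B)\}$ and $O\cup\{(B,A)\}$ are consistent. **Blocks and tangles.** A $k$-block of $G$ is a maximal set $b\subseteq V$ with $|b|\ge k$ such that for every separation $(A,B)$ of order $<k$ we have $b\subseteq A$ or $b\subseteq B$. Its $k$-profile is $P_k(b)=\{(A,B): |A\cap B|<k,\ b\subseteq B\}$. A tangle of order $k$ in $G$ is a set $\theta$ of separations of order $<k$ containing exactly one of $(A,B),(B,A)$ for every separation $(A,B)$ of order $<k$, such that $G[A_1]\cup G[A_2]\cup G[A_3]\neq G$ for all (not necessarily distinct) $(A_1,B_1),(A_2,B_2),(A_3,B_3)\in\theta$. Tangles of order $k$, like the sets $P_k(b)$, are $k$-profiles. **Tasks.** A task is a pair $(S,\mathcal{P})$ of a proper separation system $S$ and a set $\mathcal{P}$ of profiles in $G$ such that every $P\in\mathcal{P}$ orients $S$ and $S$ distinguishes $\mathcal{P}$. It is feasible if, whenever $(A,B),(C,D)\in S$ cross and there are $P,P'\in\mathcal{P}$ with $(A,B),(C,D)\in P$ and $(B,A),(D,C)\in P'$, there is $(E,F)\in P\cap S$ with $(A\cup C,B\cap D)\le(E,F)$. The reduction of $(S,\mathcal{P})$ is $(R,\mathcal{P})$, where $R$ is the set of those separations in $S$ that distinguish some two profiles in $\mathcal{P}$. **Operations.** A separation $(A,B)\in S$ is extremal in $S$ if every $(C,D)\in S$ satisfies $(C,D)\le(A,B)$ or $(D,C)\le(A,B)$.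 A profile $P$ orienting $S$ is well separated in $S$ if the set of $\le$-maximal elements of $P\cap S$ is nested. A separation is locally maximal in $(S,\mathcal{P})$ if it is $\le$-maximal in $P\cap S$ for some $P\in\mathcal{P}$ that is well separated in $S$. Let $\mathsf{ext}(S,\mathcal{P})$ be the set of extremal separations in $S$ and their inverses; $\mathsf{loc}(S,\mathcal{P})$ the set of locally maximal separations in $(S,\mathcal{P})$ and their inverses; $\mathsf{all}(S,\mathcal{P})$ the set of all separations in $S$ that are nested with every separation in $S$. With $(R,\mathcal{P})$ the reduction of $(S,\mathcal{P})$, let $\mathsf{ext_r}(S,\mathcal{P})=\mathsf{ext}(R,\mathcal{P})$, $\mathsf{loc_r}(S,\mathcal{P})=\mathsf{loc}(R,\mathcal{P})$, $\mathsf{all_r}(S,\mathcal{P})=\mathsf{all}(R,\mathcal{P})$. **Strategies.** A strategy is a map $\sigma:\mathbb{N}\to\{\mathsf{ext},\mathsf{loc},\mathsf{all},\mathsf{ext_r},\mathsf{loc_r},\mathsf{all_r}\}$ (with $0\in\mathbb{N}$) such that $\sigma(i)\in\{\mathsf{ext_r},\mathsf{loc_r},\mathsf{all_r}\}$ for infinitely many $i$. Let $\sigma^+(i)=\sigma(i+1)$, and let $r_\sigma$ be the least $r$ with $\sigma(r)\in\{\mathsf{ext_r},\mathsf{loc_r},\mathsf{all_r}\}$. For a nested separation system $N$, let $\mathcal{O}_N$ be the set of all consistent orientations of $N$; given $S$ and $\mathcal{P}$, for $O\in\mathcal{O}_N$ let $S_O$ be the set of separations in $S$ that split $O$ and $\mathcal{P}_O=\{P\in\mathcal{P}: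 P\cap N=O\}$. For a feasible task $(S,\mathcal{P})$ the set $N_\sigma(S,\mathcal{P})$ is defined by recursion on $|S|$ and, for fixed $|S|$, on $r_\sigma$: if $S=\emptyset$, then $N_\sigma(S,\mathcal{P})=\emptyset$. If $S\ne\emptyset$, $r_\sigma=0$ and the reduction $(R,\mathcal{P})$ of $(S,\mathcal{P})$ has $R\subsetneq S$, then $N_\sigma(S,\mathcal{P})=N_\sigma(R,\mathcal{P})$. In all other cases, with $N:=\sigma(0)(S,\mathcal{P})$, let $N_\sigma(S,\mathcal{P})=N\cup\bigcup_{O\in\mathcal{O}_N}N_{\sigma^+}(S_O,\mathcal{P}_O)$. **$k$-strategies.** A $k$-strategy is a $k$-tuple $\Sigma=(\sigma_1,\dots,\sigma_k)$ of strategies each with range in $\{\mathsf{ext_r},\mathsf{loc_r},\mathsf{all_r}\}$. For a set $\mathcal{P}$ of $k$-profiles and $1\le\ell\le k$ let $P_\ell=\{(A,B)\in P:|A\cap B|<\ell\}$ and $\mathcal{P}_\ell=\{P_\ell:P\in\mathcal{P}\}$. The set $N_\Sigma(G,\mathcal{P})$ determined by $\Sigma$ is defined recursively: for $k=1$, $N_\Sigma(G,\mathcal{P})=N_{\sigma_1}(S,\mathcal{P})$, where $S$ is the set of all proper separations of $G$ of order $<1$. For $k\ge2$ let $N=N_{(\sigma_1,\dots,\sigma_{k-1})}(G,\mathcal{P}_{k-1})$, let $S$ be the set of proper $(k-1)$-separations of $G$ that are nested with $N$, and put $N_\Sigma(G,\mathcal{P})=N\cup\bigcup_{O\in\mathcal{O}_N}N_{\sigma_k}(S_O,\mathcal{P}_O)$.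 The set $N_\Sigma(G,\mathcal{P})$ is a nested proper separation system. **Tree-decompositions.** A tree-decomposition of $G$ is a pair $(T,\mathcal{V})$ of a tree $T$ and a family $\mathcal{V}=(V_t)_{t\in T}$ of vertex sets $V_t\subseteq V$ (its parts) with $V=\bigcup_t V_t$, every edge of $G$ having both ends in some $V_t$, and $V_{t_1}\cap V_{t_3}\subseteq V_{t_2}$ whenever $t_2$ lies on the $t_1$–$t_3$ path in $T$. Its adhesion is the maximum of $|V_t\cap V_{t'}|$ over edges $tt'$ of $T$ (and $0$ if $T$ has no edge). An oriented edge $\vec e=t_1t_2$ of $T$ induces the separation $(\bigcup_{t\in T_1}V_t,\bigcup_{t\in T_2}V_t)$, where $T_1\ni t_1$ and $T_2\ni t_2$ are the components of $T-e$. Every nested proper separation system $N$ of $G$ is induced by some tree-decomposition $(T,\mathcal{V})$ of $G$, meaning that the separations of $G$ that correspond to edges of $T$ are precisely those in $N$. Under the assumption that parts corresponding to different nodes of $T$ are distinct (one could otherwise artificially enlarge the tree, without changing the set of separations, by duplicating a part), $(T,\mathcal{V})$ is taken to be uniquely determined by $N$. The tree-decomposition that $\Sigma$ defines on $G$ is the tree-decomposition, in this sense, that induces $N_\Sigma(G,\mathcal{P})$.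
   Formalization: Distinct parts alone do not determine the tree-decomposition (path abc: {a,b},{b,c} versus {a,b},{b},{b,c}); the one defined by Σ is therefore also required to have different tree edges induce different separations, which makes it exist and be unique. *)

theory Defs
  imports "Graph_Theory.Digraph_Component"
begin

text \<open>
  A finite simple undirected graph is a \<open>pair_graph\<close>: a finite vertex set \<open>pverts G\<close> with a
  symmetric irreflexive edge relation \<open>parcs G\<close>, so that an edge \<open>uv\<close> is present as the two
  pairs \<open>(u,v)\<close> and \<open>(v,u)\<close>.
\<close>

definition graph_iso ::
  "('a \<Rightarrow> 'b) \<Rightarrow> 'a pair_pre_digraph \<Rightarrow> 'b pair_pre_digraph \<Rightarrow> bool" where
  "graph_iso \<phi> G H \<longleftrightarrow> bij_betw \<phi> (pverts G) (pverts H) \<and>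
     (\<forall>u\<in>pverts G. \<forall>v\<in>pverts G. (u, v) \<in> parcs G \<longleftrightarrow> (\<phi> u, \<phi> v) \<in> parcs H)"


section \<open>Separations\<close>

type_synonym 'a sep = "'a set \<times> 'a set"

abbreviation sinv :: "'a sep \<Rightarrow> 'a sep" where
  "sinv \<equiv> prod.swap"

definition separation :: "'a pair_pre_digraph \<Rightarrow> 'a sep \<Rightarrow> bool" where
  "separation G s \<longleftrightarrow> (case s of (A, B) \<Rightarrow>
     A \<subseteq> pverts G \<and> B \<subseteq> pverts G \<and> A \<union> B = pverts G \<and>
     \<not> (\<exists>u\<in>A - B. \<exists>v\<in>B - A. (u, v) \<in> parcs G))"

definition sorder :: "'a sep \<Rightarrow> nat" where
  "sorder s = card (fst s \<inter> snd s)"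

definition proper_sep :: "'a sep \<Rightarrow> bool" where
  "proper_sep s \<longleftrightarrow> \<not> fst s \<subseteq> snd s \<and> \<not> snd s \<subseteq> fst s"

definition sle :: "'a sep \<Rightarrow> 'a sep \<Rightarrow> bool" (infix "\<preceq>" 50) where
  "s \<preceq> t \<longleftrightarrow> fst s \<subseteq> fst t \<and> snd t \<subseteq> snd s"

definition nested_sep :: "'a sep \<Rightarrow> 'a sep \<Rightarrow> bool" where
  "nested_sep s t \<longleftrightarrow> s \<preceq> t \<or> t \<preceq> s \<or> s \<preceq> sinv t \<or> sinv t \<preceq> s"

definition nested_with :: "'a sep \<Rightarrow> 'a sep set \<Rightarrow> bool" where
  "nested_with s S \<longleftrightarrow> (\<forall>t\<in>S. nested_sep s t)"

definition nested_set :: "'a sep set \<Rightarrow> bool" where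
  "nested_set S \<longleftrightarrow> (\<forall>s\<in>S. \<forall>t\<in>S. nested_sep s t)"

definition antisymmetric_seps :: "'a sep set \<Rightarrow> bool" where
  "antisymmetric_seps S \<longleftrightarrow> (\<forall>s\<in>S. sinv s \<notin> S)"


section \<open>Profiles, blocks and tangles\<close>

definition consistent :: "'a pair_pre_digraph \<Rightarrow> 'a sep set \<Rightarrow> bool" where
  "consistent G P \<longleftrightarrow> (\<forall>s\<in>P. separation G s) \<and>
     (\<forall>s\<in>P. \<forall>t. separation G t \<and> t \<preceq> s \<longrightarrow> sinv t \<notin> P)"

definition profile :: "'a pair_pre_digraph \<Rightarrow> 'a sep set \<Rightarrow> bool" where
  "profile G P \<longleftrightarrow> consistent G P \<and>
     (\<forall>A B C D. (A, B) \<in> P \<and> (C, D) \<in> P \<longrightarrow> (B \<inter> D, A \<union> C) \<notin> P)"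

definition k_profile :: "'a pair_pre_digraph \<Rightarrow> nat \<Rightarrow> 'a sep set \<Rightarrow> bool" where
  "k_profile G k P \<longleftrightarrow> profile G P \<and> (\<forall>s\<in>P. sorder s < k) \<and>
     (\<forall>s. separation G s \<and> sorder s < k \<longrightarrow> (s \<in> P) \<noteq> (sinv s \<in> P))"

definition orients :: "'a sep set \<Rightarrow> 'a sep set \<Rightarrow> bool" where
  "orients P S \<longleftrightarrow> antisymmetric_seps P \<and> (\<forall>s\<in>S. s \<in> P \<or> sinv s \<in> P \<inter> S)"

definition consistent_orientations ::
  "'a pair_pre_digraph \<Rightarrow> 'a sep set \<Rightarrow> 'a sep set set" where
  "consistent_orientations G N = {Q. Q \<subseteq> N \<and> orients Q N \<and> consistent G Q}"

definition distinguishes :: "'a sep \<Rightarrow> 'a sep set \<Rightarrow> 'a sep set \<Rightarrow> bool" where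
  "distinguishes s P P' \<longleftrightarrow>
     (s \<in> P - P' \<and> sinv s \<in> P' - P) \<or> (s \<in> P' - P \<and> sinv s \<in> P - P')"

definition splits :: "'a pair_pre_digraph \<Rightarrow> 'a sep \<Rightarrow> 'a sep set \<Rightarrow> bool" where
  "splits G s Q \<longleftrightarrow> consistent G (Q \<union> {s}) \<and> consistent G (Q \<union> {sinv s})"

definition k_inseparable :: "'a pair_pre_digraph \<Rightarrow> nat \<Rightarrow> 'a set \<Rightarrow> bool" where
  "k_inseparable G k b \<longleftrightarrow> b \<subseteq> pverts G \<and> card b \<ge> k \<and>
     (\<forall>A B. separation G (A, B) \<and> sorder (A, B) < k \<longrightarrow> b \<subseteq> A \<or> b \<subseteq> B)"

definition k_block :: "'a pair_pre_digraph \<Rightarrow> nat \<Rightarrow> 'a set \<Rightarrow> bool" where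
  "k_block G k b \<longleftrightarrow> k_inseparable G k b \<and> (\<forall>b'. k_inseparable G k b' \<and> b \<subseteq> b' \<longrightarrow> b' = b)"

definition block_profile :: "'a pair_pre_digraph \<Rightarrow> nat \<Rightarrow> 'a set \<Rightarrow> 'a sep set" where
  "block_profile G k b = {(A, B). separation G (A, B) \<and> sorder (A, B) < k \<and> b \<subseteq> B}"

definition tangle :: "'a pair_pre_digraph \<Rightarrow> nat \<Rightarrow> 'a sep set \<Rightarrow> bool" where
  "tangle G k \<theta> \<longleftrightarrow> (\<forall>s\<in>\<theta>. separation G s \<and> sorder s < k) \<and>
     (\<forall>s. separation G s \<and> sorder s < k \<longrightarrow> (s \<in> \<theta>) \<noteq> (sinv s \<in> \<theta>)) \<and>
     (\<forall>A\<^sub>1 B\<^sub>1 A\<^sub>2 B\<^sub>2 A\<^sub>3 B\<^sub>3. (A\<^sub>1, B\<^sub>1) \<in> \<theta> \<and> (A\<^sub>2, B\<^sub>2) \<in> \<theta> \<and> (A\<^sub>3, B\<^sub>3) \<in> \<theta> \<longrightarrow>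
        union (union (with_proj G \<restriction> A\<^sub>1) (with_proj G \<restriction> A\<^sub>2)) (with_proj G \<restriction> A\<^sub>3) \<noteq> with_proj G)"


section \<open>Operations and strategies\<close>

definition reduction :: "'a sep set \<Rightarrow> 'a sep set set \<Rightarrow> 'a sep set" where
  "reduction S \<P> = {s \<in> S. \<exists>P\<in>\<P>. \<exists>P'\<in>\<P>. distinguishes s P P'}"

definition extremal :: "'a sep set \<Rightarrow> 'a sep \<Rightarrow> bool" where
  "extremal S s \<longleftrightarrow> s \<in> S \<and> (\<forall>t\<in>S. t \<preceq> s \<or> sinv t \<preceq> s)"

definition maximal_seps :: "'a sep set \<Rightarrow> 'a sep set" where
  "maximal_seps S = {s \<in> S. \<forall>t\<in>S. s \<preceq> t \<longrightarrow> t = s}"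

definition well_separated :: "'a sep set \<Rightarrow> 'a sep set \<Rightarrow> bool" where
  "well_separated S P \<longleftrightarrow> nested_set (maximal_seps (P \<inter> S))"

definition locally_maximal :: "'a sep set \<Rightarrow> 'a sep set set \<Rightarrow> 'a sep \<Rightarrow> bool" where
  "locally_maximal S \<P> s \<longleftrightarrow> (\<exists>P\<in>\<P>. well_separated S P \<and> s \<in> maximal_seps (P \<inter> S))"

definition ext_seps :: "'a sep set \<Rightarrow> 'a sep set" where
  "ext_seps S = {s. extremal S s} \<union> sinv ` {s. extremal S s}"

definition loc_seps :: "'a sep set \<Rightarrow> 'a sep set set \<Rightarrow> 'a sep set" where
  "loc_seps S \<P> = {s. locally_maximal S \<P> s} \<union> sinv ` {s. locally_maximal S \<P> s}"

definition all_seps :: "'a sep set \<Rightarrow> 'a sep set" where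
  "all_seps S = {s \<in> S. nested_with s S}"

datatype operation = Ext | Loc | All | ExtR | LocR | AllR

definition reduced_ops :: "operation set" where
  "reduced_ops = {ExtR, LocR, AllR}"

fun apply_op :: "operation \<Rightarrow> 'a sep set \<Rightarrow> 'a sep set set \<Rightarrow> 'a sep set" where
  "apply_op Ext S \<P> = ext_seps S"
| "apply_op Loc S \<P> = loc_seps S \<P>"
| "apply_op All S \<P> = all_seps S"
| "apply_op ExtR S \<P> = ext_seps (reduction S \<P>)"
| "apply_op LocR S \<P> = loc_seps (reduction S \<P>) \<P>"
| "apply_op AllR S \<P> = all_seps (reduction S \<P>)"

definition strategy :: "(nat \<Rightarrow> operation) \<Rightarrow> bool" where
  "strategy \<sigma> \<longleftrightarrow> infinite {i. \<sigma> i \<in> reduced_ops}"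

definition first_reduced :: "(nat \<Rightarrow> operation) \<Rightarrow> nat" where
  "first_reduced \<sigma> = (LEAST r. \<sigma> r \<in> reduced_ops)"

definition splitting :: "'a pair_pre_digraph \<Rightarrow> 'a sep set \<Rightarrow> 'a sep set \<Rightarrow> 'a sep set" where
  "splitting G S Q = {s \<in> S. splits G s Q}"

definition inducing :: "'a sep set set \<Rightarrow> 'a sep set \<Rightarrow> 'a sep set \<Rightarrow> 'a sep set set" where
  "inducing \<P> N Q = {P \<in> \<P>. P \<inter> N = Q}"

text \<open>
  \<open>N_strat G \<sigma> S \<P>\<close> is \<open>N\<^sub>\<sigma>(S, \<P>)\<close>. The recursion is well-founded only for feasible tasks
  \<open>(S, \<P>)\<close> of \<open>G\<close>: there \<open>|S|\<close> drops, or stays the same while \<open>r\<^sub>\<sigma>\<close> drops. It is therefore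
  introduced as a partial function, about whose values nothing is known where the recursion does
  not terminate.
\<close>

function (domintros) N_strat ::
  "'a pair_pre_digraph \<Rightarrow> (nat \<Rightarrow> operation) \<Rightarrow> 'a sep set \<Rightarrow> 'a sep set set \<Rightarrow> 'a sep set" where
  "N_strat G \<sigma> S \<P> =
     (if S = {} then {}
      else if first_reduced \<sigma> = 0 \<and> reduction S \<P> \<subset> S then N_strat G \<sigma> (reduction S \<P>) \<P>
      else apply_op (\<sigma> 0) S \<P> \<union>
        (\<Union>Q\<in>consistent_orientations G (apply_op (\<sigma> 0) S \<P>).
           N_strat G (\<lambda>i. \<sigma> (Suc i)) (splitting G S Q) (inducing \<P> (apply_op (\<sigma> 0) S \<P>) Q)))"
  by pat_completeness auto

definition k_strategy :: "nat \<Rightarrow> (nat \<Rightarrow> operation) list \<Rightarrow> bool" where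
  "k_strategy k \<Sigma> \<longleftrightarrow> length \<Sigma> = k \<and> (\<forall>\<sigma>\<in>set \<Sigma>. strategy \<sigma> \<and> range \<sigma> \<subseteq> reduced_ops)"

definition restrict_profile :: "nat \<Rightarrow> 'a sep set \<Rightarrow> 'a sep set" where
  "restrict_profile l P = {s \<in> P. sorder s < l}"

text \<open>
  Here \<open>\<Sigma> = [\<sigma>\<^sub>1, \<dots>, \<sigma>\<^sub>k]\<close> with \<open>k = length \<Sigma>\<close>; only \<open>k \<ge> 1\<close> is meaningful.
\<close>

function N_kstrat ::
  "'a pair_pre_digraph \<Rightarrow> (nat \<Rightarrow> operation) list \<Rightarrow> 'a sep set set \<Rightarrow> 'a sep set" where
  "N_kstrat G \<Sigma> \<P> =
     (if length \<Sigma> \<le> 1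
      then N_strat G (hd \<Sigma>) {s. separation G s \<and> proper_sep s \<and> sorder s < 1} \<P>
      else (let k = length \<Sigma>;
                N = N_kstrat G (butlast \<Sigma>) (restrict_profile (k - 1) ` \<P>);
                S = {s. separation G s \<and> proper_sep s \<and> sorder s = k - 1 \<and> nested_with s N}
            in N \<union> (\<Union>Q\<in>consistent_orientations G N.
                       N_strat G (last \<Sigma>) (splitting G S Q) (inducing \<P> N Q))))"
  by pat_completeness auto
termination
  by (relation "measure (\<lambda>(G, \<Sigma>, \<P>). length \<Sigma>)") auto

declare N_kstrat.simps[simp del]


section \<open>Tree-decompositions\<close>

text \<open>
  The library predicate \<open>tree\<close> is of no use for graphs given by symmetric arcs, as it regards every
  edge, traversed back and forth, as a cycle. In a \<open>pair_graph\<close> the undirected cycles are the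
  directed ones of length at least 3.
\<close>

definition tree_graph :: "'n pair_pre_digraph \<Rightarrow> bool" where
  "tree_graph T \<longleftrightarrow> pair_graph T \<and> connected (with_proj T) \<and>
     \<not> (\<exists>p. pre_digraph.cycle (with_proj T) p \<and> length p \<ge> 3)"

definition tree_decomposition ::
  "'a pair_pre_digraph \<Rightarrow> 'n pair_pre_digraph \<Rightarrow> ('n \<Rightarrow> 'a set) \<Rightarrow> bool" where
  "tree_decomposition G T \<V> \<longleftrightarrow> tree_graph T \<and>
     (\<Union>t\<in>pverts T. \<V> t) = pverts G \<and>
     (\<forall>(u, v)\<in>parcs G. \<exists>t\<in>pverts T. u \<in> \<V> t \<and> v \<in> \<V> t) \<and>
     (\<forall>t\<^sub>1 t\<^sub>2 t\<^sub>3 p. pre_digraph.apath (with_proj T) t\<^sub>1 p t\<^sub>3 \<and>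
        t\<^sub>2 \<in> set (pre_digraph.awalk_verts (with_proj T) t\<^sub>1 p) \<longrightarrow> \<V> t\<^sub>1 \<inter> \<V> t\<^sub>3 \<subseteq> \<V> t\<^sub>2)"

definition adhesion :: "'n pair_pre_digraph \<Rightarrow> ('n \<Rightarrow> 'a set) \<Rightarrow> nat" where
  "adhesion T \<V> = (if parcs T = {} then 0 else Max ((\<lambda>(s, t). card (\<V> s \<inter> \<V> t)) ` parcs T))"

definition delete_edge :: "'n pair_pre_digraph \<Rightarrow> 'n \<times> 'n \<Rightarrow> 'n pair_pre_digraph" where
  "delete_edge T e = \<lparr> pverts = pverts T, parcs = parcs T - {e, prod.swap e} \<rparr>"

definition component_of :: "'n pair_pre_digraph \<Rightarrow> 'n \<Rightarrow> 'n set" where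
  "component_of T s = {t. s \<rightarrow>\<^sup>*\<^bsub>with_proj T\<^esub> t}"

definition edge_sep ::
  "'n pair_pre_digraph \<Rightarrow> ('n \<Rightarrow> 'a set) \<Rightarrow> 'n \<times> 'n \<Rightarrow> 'a sep" where
  "edge_sep T \<V> e =
     ((\<Union>t\<in>component_of (delete_edge T e) (fst e). \<V> t),
      (\<Union>t\<in>component_of (delete_edge T e) (snd e). \<V> t))"

text \<open>
  The tree-decomposition that a set \<open>N\<close> of separations defines, up to renaming the nodes of \<open>T\<close>.
  Distinctness of the parts alone does not rule out artificial enlargements of \<open>T\<close>: for the path
  \<open>abc\<close>, the edge with parts \<open>{a,b}, {b,c}\<close> and the path with parts \<open>{a,b}, {b}, {b,c}\<close> induce the
  same separations. Hence different edges of \<open>T\<close> are also required to induce different separations;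
  this determines \<open>T\<close> and its parts.
\<close>

definition td_of_seps ::
  "'a pair_pre_digraph \<Rightarrow> 'a sep set \<Rightarrow> 'n pair_pre_digraph \<Rightarrow> ('n \<Rightarrow> 'a set) \<Rightarrow> bool" where
  "td_of_seps G N T \<V> \<longleftrightarrow> tree_decomposition G T \<V> \<and> edge_sep T \<V> ` parcs T = N \<and>
     inj_on \<V> (pverts T) \<and> inj_on (edge_sep T \<V>) (parcs T)"

definition defines_td ::
  "(nat \<Rightarrow> operation) list \<Rightarrow> 'a pair_pre_digraph \<Rightarrow> 'n pair_pre_digraph \<Rightarrow> ('n \<Rightarrow> 'a set) \<Rightarrow> bool"
  where
  "defines_td \<Sigma> G T \<V> \<longleftrightarrow> td_of_seps G (N_kstrat G \<Sigma> {P. k_profile G (length \<Sigma>) P}) T \<V>"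

definition distinguishes_blocks_and_tangles ::
  "nat \<Rightarrow> 'a pair_pre_digraph \<Rightarrow> 'n pair_pre_digraph \<Rightarrow> ('n \<Rightarrow> 'a set) \<Rightarrow> bool" where
  "distinguishes_blocks_and_tangles k G T \<V> \<longleftrightarrow>
     (\<forall>P P'. P \<noteq> P' \<and>
        ((\<exists>b. k_block G k b \<and> P = block_profile G k b) \<or> tangle G k P) \<and>
        ((\<exists>b. k_block G k b \<and> P' = block_profile G k b) \<or> tangle G k P') \<longrightarrow>
        (\<exists>e\<in>parcs T. distinguishes (edge_sep T \<V> e) P P')) \<and>
     (\<forall>b b'. b \<noteq> b' \<and> k_block G k b \<and> k_block G k b' \<longrightarrow>
        (\<exists>e\<in>parcs T. distinguishes (edge_sep T \<V> e) (block_profile G k b) (block_profile G k b')))"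

definition td_iso ::
  "('a \<Rightarrow> 'b) \<Rightarrow> 'n pair_pre_digraph \<Rightarrow> ('n \<Rightarrow> 'a set) \<Rightarrow>
   'm pair_pre_digraph \<Rightarrow> ('m \<Rightarrow> 'b set) \<Rightarrow> bool" where
  "td_iso \<phi> T \<V> T' \<V>' \<longleftrightarrow>
     (\<exists>\<psi>. graph_iso \<psi> T T' \<and> (\<forall>t\<in>pverts T. \<V>' (\<psi> t) = \<phi> ` \<V> t))"

end

(*
  Each operation only selects separations nested with the whole current system, because a
  consistent profile orients that system; hence all the sets N_strat and N_kstrat are nested.
  Maximal elements of a reduced feasible task are extremal, so every step selects something
  and the recursion ends. Submodularity gives feasibility at each order and, for profiles that
  first differ at that order, a distinguishing separation nested with everything chosen before.

  The nodes of a tree inducing a nested proper system N correspond to the consistent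
  orientations of N, edges to flips of a maximal element, and the part at an orientation is the
  intersection of the sides it points to. So the tree-decomposition is determined by N up to
  isomorphism. It exists with distinct parts because a selected separation is nested with
  all its competitors: for a general nested N two nodes may have the same part, e.g. when four
  components share a separator X and N pairs them up.
*)
theory Submission imports Defs begin

section \<open>The order on separations\<close>

text \<open>The obstacle that shapes the proof is that distinct nodes must get distinct parts, which
  nestedness alone does not give. The recursion therefore carries a witness for each chosen
  \<open>u\<close>: two profiles that \<open>u\<close> distinguishes efficiently, such that
  \<open>u\<close> is nested with every separation of its order that distinguishes them and is
  nested with all chosen separations of smaller order. These competitors are described without
  reference to the course of the recursion, so the condition survives the passage to higher orders,
  where only separations of larger order are added. Two nodes with the same part would yield a
  competitor crossing \<open>u\<close>. The smallest order is treated as a step from the empty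
  system, so that each invariant has a single proof. Canonicity is proved for separations rather
  than vertices: profiles and the recursion depend only on inverse, \<preceq>, joins, orders and
  properness, and vertices return only with the parts.\<close>

definition sjoin :: "'a sep \<Rightarrow> 'a sep \<Rightarrow> 'a sep" where
  "sjoin s t = (fst s \<union> fst t, snd s \<inter> snd t)"

definition smeet :: "'a sep \<Rightarrow> 'a sep \<Rightarrow> 'a sep" where
  "smeet s t = (fst s \<inter> fst t, snd s \<union> snd t)"

lemma sle_refl [simp, intro]: "s \<preceq> s"
  by (simp add: sle_def)

lemma sle_trans [trans]: "s \<preceq> t \<Longrightarrow> t \<preceq> u \<Longrightarrow> s \<preceq> u"
  by (auto simp: sle_def)

lemma sle_antisym: "s \<preceq> t \<Longrightarrow> t \<preceq> s \<Longrightarrow> s = t"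
  by (auto simp: sle_def intro: prod_eqI)

lemma sle_sinv_iff: "sinv s \<preceq> t \<longleftrightarrow> sinv t \<preceq> s"
  and sle_sinv_iff': "s \<preceq> sinv t \<longleftrightarrow> t \<preceq> sinv s"
  and sinv_sle_sinv [simp]: "sinv s \<preceq> sinv t \<longleftrightarrow> t \<preceq> s"
  by (auto simp: sle_def)

lemma sinv_eq_iff: "sinv s = t \<longleftrightarrow> s = sinv t"
  by auto

lemma sjoin_upper [simp, intro]: "s \<preceq> sjoin s t" "t \<preceq> sjoin s t"
  and sjoin_least: "s \<preceq> u \<Longrightarrow> t \<preceq> u \<Longrightarrow> sjoin s t \<preceq> u"
  and smeet_lower [simp, intro]: "smeet s t \<preceq> s" "smeet s t \<preceq> t"
  and smeet_greatest: "u \<preceq> s \<Longrightarrow> u \<preceq> t \<Longrightarrow> u \<preceq> smeet s t"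
  by (auto simp: sle_def sjoin_def smeet_def)

lemma sinv_sjoin: "sinv (sjoin s t) = smeet (sinv s) (sinv t)"
  and sinv_smeet: "sinv (smeet s t) = sjoin (sinv s) (sinv t)"
  by (auto simp: sjoin_def smeet_def)

lemma sorder_sinv [simp]: "sorder (sinv s) = sorder s"
  by (simp add: sorder_def Int_commute)

lemma proper_sinv [simp]: "proper_sep (sinv s) \<longleftrightarrow> proper_sep s"
  by (auto simp: proper_sep_def)

lemma proper_not_sle_sinv: "proper_sep s \<Longrightarrow> \<not> s \<preceq> sinv s" "proper_sep s \<Longrightarrow> \<not> sinv s \<preceq> s"
  by (auto simp: proper_sep_def sle_def)

lemma nested_sep_sym: "nested_sep s t \<longleftrightarrow> nested_sep t s"
  and nested_sep_sinv_left [simp]: "nested_sep (sinv s) t \<longleftrightarrow> nested_sep s t"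
  and nested_sep_sinv_right [simp]: "nested_sep s (sinv t) \<longleftrightarrow> nested_sep s t"
  by (auto simp: nested_sep_def sle_def)

lemma nested_sep_refl [simp, intro]: "nested_sep s s"
  by (simp add: nested_sep_def)

lemma nested_sepI: "s \<preceq> t \<Longrightarrow> nested_sep s t" "t \<preceq> s \<Longrightarrow> nested_sep s t"
    "s \<preceq> sinv t \<Longrightarrow> nested_sep s t" "sinv t \<preceq> s \<Longrightarrow> nested_sep s t"
  by (auto simp: nested_sep_def)

text \<open>If \<open>t\<close> or \<open>sinv t\<close> lies below \<open>s\<close> or
  \<open>s'\<close>, it lies below the join; if \<open>s\<close> and \<open>s'\<close> both lie
  below \<open>t\<close>, or both below \<open>sinv t\<close>, so does the join. The excluded
  situations are the mixed ones, where \<open>t\<close> separates \<open>s\<close> from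
  \<open>s'\<close>.\<close>

lemma nested_sjoin:
  assumes "nested_sep t s" "nested_sep t s'"
    and "\<not> (s \<preceq> t \<and> s' \<preceq> sinv t)" "\<not> (s \<preceq> sinv t \<and> s' \<preceq> t)"
  shows "nested_sep t (sjoin s s')"
proof -
  have "(t \<preceq> s \<or> sinv t \<preceq> s) \<or> (t \<preceq> s' \<or> sinv t \<preceq> s') \<or> (s \<preceq> t \<and> s' \<preceq> t)
      \<or> (s \<preceq> sinv t \<and> s' \<preceq> sinv t)"
    using assms unfolding nested_sep_def by (metis sle_sinv_iff sle_sinv_iff')
  then show ?thesis
    unfolding nested_sep_def
    by (metis sjoin_upper sle_trans sjoin_least sle_sinv_iff sle_sinv_iff')
qed

text \<open>In a mixed situation \<open>t\<close> would lie between one of \<open>s\<close>,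
  \<open>s'\<close> and the inverse of the other, so these two would be nested. This is the corner
  argument behind \<open>crossings_sjoin_less\<close> and \<open>level_feasible\<close>.\<close>

lemma nested_sjoin_crossing:
  assumes "nested_sep t s" "nested_sep t s'" "\<not> nested_sep s s'"
  shows "nested_sep t (sjoin s s')"
proof (rule nested_sjoin[OF assms(1,2)])
  show "\<not> (s \<preceq> t \<and> s' \<preceq> sinv t)" "\<not> (s \<preceq> sinv t \<and> s' \<preceq> t)"
    using assms(3) by (meson nested_sepI sle_trans sle_sinv_iff')+
qed

lemma distinguishes_sinv [simp]: "distinguishes (sinv s) P Q \<longleftrightarrow> distinguishes s P Q"
  by (auto simp: distinguishes_def)

lemma distinguishes_sym: "distinguishes s P Q \<longleftrightarrow> distinguishes s Q P"
  by (auto simp: distinguishes_def)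

lemma reduction_subset: "reduction S \<P> \<subseteq> S"
  by (auto simp: reduction_def)

lemma inducing_subset: "inducing \<P> N Q \<subseteq> \<P>"
  by (auto simp: inducing_def)

lemma ex_maximal_above:
  assumes "finite S" "s \<in> S" shows "\<exists>t\<in>maximal_seps S. s \<preceq> t"
proof -
  have "wf {(y, x). x \<in> S \<and> y \<in> S \<and> x \<preceq> y \<and> x \<noteq> y}"
  proof (rule finite_acyclic_wf)
    show "finite {(y, x). x \<in> S \<and> y \<in> S \<and> x \<preceq> y \<and> x \<noteq> y}"
      by (rule finite_subset[of _ "S \<times> S"]) (auto simp: assms)
    have *: "trans {(y, x). x \<in> S \<and> y \<in> S \<and> x \<preceq> y \<and> x \<noteq> y}"
      by (rule transI) (auto dest: sle_antisym sle_trans)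
    show "acyclic {(y, x). x \<in> S \<and> y \<in> S \<and> x \<preceq> y \<and> x \<noteq> y}"
      unfolding acyclic_def trancl_id[OF *] by auto
  qed
  then show ?thesis
    using assms(2)
  proof (induction s rule: wf_induct_rule)
    case (less s)
    show ?case
    proof (cases "s \<in> maximal_seps S")
      case False
      then obtain t where "t \<in> S" "s \<preceq> t" "t \<noteq> s"
        using less.prems by (auto simp: maximal_seps_def)
      then show ?thesis
        using less.IH[of t] less.prems sle_trans by blast
    qed auto
  qed
qed

lemma extremal_nested: "extremal S s \<Longrightarrow> t \<in> S \<Longrightarrow> nested_sep s t"
  by (auto simp: extremal_def nested_sep_def)

lemma first_reduced_0: "\<sigma> 0 \<in> reduced_ops \<Longrightarrow> first_reduced \<sigma> = 0"
  unfolding first_reduced_def by (rule Least_eq_0)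

lemma maximal_in: "u \<in> maximal_seps Q \<Longrightarrow> u \<in> Q"
  by (simp add: maximal_seps_def)

lemma maximal_eq: "u \<in> maximal_seps Q \<Longrightarrow> t \<in> Q \<Longrightarrow> u \<preceq> t \<Longrightarrow> t = u"
  unfolding maximal_seps_def by blast

section \<open>Separations of a fixed graph and their orders\<close>

context pair_graph
begin

lemma separation_subset: "separation G s \<Longrightarrow> fst s \<subseteq> pverts G" "separation G s \<Longrightarrow> snd s \<subseteq> pverts G"
  and separation_Un: "separation G s \<Longrightarrow> fst s \<union> snd s = pverts G"
  by (auto simp: separation_def split: prod.splits)

lemma separation_sinv [simp]: "separation G (sinv s) \<longleftrightarrow> separation G s"
  unfolding separation_def by (cases s) (auto dest: arcs_symmetric)

lemma separation_arc:
  assumes "separation G s" "(a, b) \<in> parcs G"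
  shows "(a \<in> fst s \<and> b \<in> fst s) \<or> (a \<in> snd s \<and> b \<in> snd s)"
proof (rule ccontr)
  assume *: "\<not> ?thesis"
  have "a \<in> fst s \<union> snd s" "b \<in> fst s \<union> snd s"
    using separation_Un[OF assms(1)] assms(2) in_arcsD1 in_arcsD2 by blast+
  then have "(a \<in> fst s - snd s \<and> b \<in> snd s - fst s) \<or> (b \<in> fst s - snd s \<and> a \<in> snd s - fst s)"
    using * by blast
  then show False
    using assms arcs_symmetric[OF assms(2)] unfolding separation_def by (auto split: prod.splits)
qed

lemma finite_separations: "finite {s. separation G s}"
proof (rule finite_subset)
  show "{s. separation G s} \<subseteq> Pow (pverts G) \<times> Pow (pverts G)"
    by (auto simp: separation_def split: prod.splits)
qed (simp add: pair_finite_verts)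

lemma separation_sjoin:
  assumes "separation G s" "separation G t" shows "separation G (sjoin s t)"
proof -
  have Un: "fst s \<union> snd s = pverts G" "fst t \<union> snd t = pverts G"
    using assms separation_Un by blast+
  have e: "\<And>u v. u \<in> fst s - snd s \<Longrightarrow> v \<in> snd s - fst s \<Longrightarrow> (u, v) \<notin> parcs G"
    "\<And>u v. u \<in> fst t - snd t \<Longrightarrow> v \<in> snd t - fst t \<Longrightarrow> (u, v) \<notin> parcs G"
    using assms unfolding separation_def by (auto split: prod.splits)
  have "(u, v) \<notin> parcs G" if "u \<in> (fst s \<union> fst t) - (snd s \<inter> snd t)" "v \<in> (snd s \<inter> snd t) - (fst s \<union> fst t)"
    for u v
  proof (cases "u \<in> snd s")
    case True
    then have "u \<in> fst t - snd t" "v \<in> snd t - fst t" using that Un by blast+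
    then show ?thesis using e by blast
  next
    case False
    then have "u \<in> fst s - snd s" "v \<in> snd s - fst s" using that Un by blast+
    then show ?thesis using e by blast
  qed
  moreover have "(fst s \<union> fst t) \<union> (snd s \<inter> snd t) = pverts G" using Un by blast
  ultimately show ?thesis
    unfolding separation_def sjoin_def split_beta fst_conv snd_conv by blast
qed

lemma separation_smeet:
  "separation G s \<Longrightarrow> separation G t \<Longrightarrow> separation G (smeet s t)"
  by (metis separation_sinv separation_sjoin sinv_smeet)

text \<open>Both separations cover the same vertex set, so the separators of join and meet have the
  same union and the same intersection as the two given separators. Hence an equality.\<close>

lemma sorder_submodular:
  assumes "separation G s" "separation G t"
  shows "sorder (sjoin s t) + sorder (smeet s t) = sorder s + sorder t"
proof -
  have fin: "finite (fst s)" "finite (snd s)" "finite (fst t)" "finite (snd t)"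
    using assms[THEN separation_subset(1)] assms[THEN separation_subset(2)]
    by (auto intro: finite_subset[OF _ pair_finite_verts])
  define X Y where "X = fst (sjoin s t) \<inter> snd (sjoin s t)" and "Y = fst (smeet s t) \<inter> snd (smeet s t)"
  have *: "fst s \<union> snd s = fst t \<union> snd t"
    using assms separation_Un by blast
  have "X \<union> Y = (fst s \<inter> snd s) \<union> (fst t \<inter> snd t)"
    using * unfolding X_def Y_def sjoin_def smeet_def by auto
  moreover have "X \<inter> Y = (fst s \<inter> snd s) \<inter> (fst t \<inter> snd t)"
    using * unfolding X_def Y_def sjoin_def smeet_def by auto
  moreover have "card X + card Y = card (X \<union> Y) + card (X \<inter> Y)"
    by (rule card_Un_Int) (use fin in \<open>auto simp: X_def Y_def sjoin_def smeet_def\<close>)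
  moreover have "card (fst s \<inter> snd s) + card (fst t \<inter> snd t) =
      card ((fst s \<inter> snd s) \<union> (fst t \<inter> snd t)) + card ((fst s \<inter> snd s) \<inter> (fst t \<inter> snd t))"
    by (rule card_Un_Int) (use fin in auto)
  ultimately show ?thesis
    unfolding sorder_def X_def Y_def by simp
qed

section \<open>Consistency and profiles\<close>

text \<open>Instantiating the quantified separation by inverses of elements turns consistency into a
  condition on pairs from \<open>P\<close>. The case \<open>s = t\<close> matters: it excludes
  \<open>sinv s \<preceq> s\<close>, from which properness of distinguishing separations is
  derived.\<close>

lemma consistent_iff:
  "consistent G P \<longleftrightarrow> (\<forall>s\<in>P. separation G s) \<and> (\<forall>s\<in>P. \<forall>t\<in>P. \<not> sinv t \<preceq> s)"
proof
  assume *: "consistent G P"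
  have "\<not> sinv t \<preceq> s" if "s \<in> P" "t \<in> P" for s t
  proof
    assume "sinv t \<preceq> s"
    moreover have "separation G (sinv t)"
      using * that by (auto simp: consistent_def)
    ultimately have "sinv (sinv t) \<notin> P"
      using * that(1) unfolding consistent_def by blast
    then show False using that by simp
  qed
  then show "(\<forall>s\<in>P. separation G s) \<and> (\<forall>s\<in>P. \<forall>t\<in>P. \<not> sinv t \<preceq> s)"
    using * by (auto simp: consistent_def)
next
  assume *: "(\<forall>s\<in>P. separation G s) \<and> (\<forall>s\<in>P. \<forall>t\<in>P. \<not> sinv t \<preceq> s)"
  then show "consistent G P"
    unfolding consistent_def by (metis swap_swap)
qed

lemma consistentD: "consistent G P \<Longrightarrow> s \<in> P \<Longrightarrow> t \<in> P \<Longrightarrow> \<not> sinv t \<preceq> s"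
  by (simp add: consistent_iff)

lemma consistent_sepD: "consistent G P \<Longrightarrow> s \<in> P \<Longrightarrow> separation G s"
  by (simp add: consistent_iff)

lemma consistent_sinvD: "consistent G P \<Longrightarrow> s \<in> P \<Longrightarrow> sinv s \<notin> P"
  using consistentD[of P s "sinv s"] by auto

lemma consistent_downD: "consistent G P \<Longrightarrow> s \<in> P \<Longrightarrow> t \<preceq> s \<Longrightarrow> sinv t \<notin> P"
  using consistentD[of P s "sinv t"] by auto

lemma consistent_subset: "consistent G P \<Longrightarrow> Q \<subseteq> P \<Longrightarrow> consistent G Q"
  by (auto simp: consistent_iff)

lemma consistent_antisymmetric: "consistent G P \<Longrightarrow> antisymmetric_seps P"
  by (auto simp: antisymmetric_seps_def dest: consistent_sinvD)

lemma distinguishes_proper: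
  assumes "consistent G P" "consistent G Q" "distinguishes s P Q"
  shows "separation G s" "proper_sep s"
proof -
  obtain R R' where R: "consistent G R" "s \<in> R" and R': "consistent G R'" "sinv s \<in> R'"
    using assms unfolding distinguishes_def by blast
  show "separation G s" using R consistent_sepD by blast
  have "\<not> sinv s \<preceq> s" "\<not> s \<preceq> sinv s"
    using consistentD[OF R R(2)] consistentD[OF R' R'(2)] by simp_all
  then show "proper_sep s"
    unfolding proper_sep_def sle_def fst_swap snd_swap by blast
qed

section \<open>Feasible tasks\<close>

text \<open>Task and feasibility in one predicate, the form in which the recursion carries them.
  Members of \<P> enter through consistency and through how they orient \<open>S\<close>; their
  behaviour under joins is spent when feasibility is proved, in
  \<open>level_feasible\<close>.\<close>

definition feasible :: "'a sep set \<Rightarrow> 'a sep set set \<Rightarrow> bool" where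
  "feasible S \<P> \<longleftrightarrow>
     (\<forall>s\<in>S. separation G s \<and> proper_sep s \<and> sinv s \<in> S) \<and>
     (\<forall>P\<in>\<P>. consistent G P \<and> orients P S) \<and>
     (\<forall>P\<in>\<P>. \<forall>Q\<in>\<P>. P \<noteq> Q \<longrightarrow> (\<exists>s\<in>S. distinguishes s P Q)) \<and>
     (\<forall>P\<in>\<P>. \<forall>Q\<in>\<P>. \<forall>s\<in>S. \<forall>t\<in>S. \<not> nested_sep s t \<and> s \<in> P \<and> t \<in> P \<and> sinv s \<in> Q \<and> sinv t \<in> Q \<longrightarrow>
        (\<exists>e\<in>P \<inter> S. s \<preceq> e \<and> t \<preceq> e))"

lemma feasible_sepD: "feasible S \<P> \<Longrightarrow> s \<in> S \<Longrightarrow> separation G s"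
  and feasible_properD: "feasible S \<P> \<Longrightarrow> s \<in> S \<Longrightarrow> proper_sep s"
  and feasible_sinv: "feasible S \<P> \<Longrightarrow> s \<in> S \<Longrightarrow> sinv s \<in> S"
  and feasible_consistent: "feasible S \<P> \<Longrightarrow> P \<in> \<P> \<Longrightarrow> consistent G P"
  and feasible_distinguish: "feasible S \<P> \<Longrightarrow> P \<in> \<P> \<Longrightarrow> Q \<in> \<P> \<Longrightarrow> P \<noteq> Q \<Longrightarrow> \<exists>s\<in>S. distinguishes s P Q"
  by (simp_all add: feasible_def)
lemma feasible_orient: "feasible S \<P> \<Longrightarrow> P \<in> \<P> \<Longrightarrow> s \<in> S \<Longrightarrow> s \<notin> P \<Longrightarrow> sinv s \<in> P"
  by (auto simp: feasible_def orients_def)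
lemma feasible_finite: "feasible S \<P> \<Longrightarrow> finite S"
  by (rule finite_subset[OF _ finite_separations]) (auto simp: feasible_def)

lemma feasible_crossing:
  assumes "feasible S \<P>" "P \<in> \<P>" "Q \<in> \<P>" "s \<in> S" "t \<in> S" "\<not> nested_sep s t"
    "s \<in> P" "t \<in> P" "sinv s \<in> Q" "sinv t \<in> Q"
  shows "\<exists>e\<in>P \<inter> S. s \<preceq> e \<and> t \<preceq> e"
  using assms(1)[unfolded feasible_def, THEN conjunct2, THEN conjunct2, THEN conjunct2] assms(2-)
  by meson

text \<open>The crossing condition survives because its witness \<open>e\<close> is itself a
  distinguishing separation: lying above an element whose inverse is in \<open>Q\<close>, it cannot
  be in \<open>Q\<close>, hence its inverse is. So \<open>S'\<close> has to keep only what
  distinguishes two of the remaining profiles; reduction and splitting are both of this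
  kind.\<close>

lemma feasible_sub:
  assumes f: "feasible S \<P>" and "S' \<subseteq> S" "\<P>' \<subseteq> \<P>" "\<And>s. s \<in> S' \<Longrightarrow> sinv s \<in> S'"
    and *: "\<And>s P Q. s \<in> S \<Longrightarrow> P \<in> \<P>' \<Longrightarrow> Q \<in> \<P>' \<Longrightarrow> distinguishes s P Q \<Longrightarrow> s \<in> S'"
  shows "feasible S' \<P>'"
  unfolding feasible_def
proof (intro conjI ballI impI)
  fix s assume s: "s \<in> S'"
  show "separation G s" "proper_sep s" "sinv s \<in> S'"
    using assms feasible_sepD[OF f] feasible_properD[OF f] s by blast+
next
  fix P assume P: "P \<in> \<P>'"
  then show c: "consistent G P" using assms feasible_consistent by blast
  show "orients P S'"
    unfolding orients_def using consistent_antisymmetric[OF c] feasible_orient[OF f, of P] P assms by blast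
next
  fix P Q assume "P \<in> \<P>'" "Q \<in> \<P>'" "P \<noteq> Q"
  then obtain s where "s \<in> S" "distinguishes s P Q"
    using feasible_distinguish[OF f] assms by blast
  then show "\<exists>s\<in>S'. distinguishes s P Q"
    using * \<open>P \<in> \<P>'\<close> \<open>Q \<in> \<P>'\<close> by blast
next
  fix P Q s t assume P: "P \<in> \<P>'" "Q \<in> \<P>'" and "s \<in> S'" "t \<in> S'"
    and **: "\<not> nested_sep s t \<and> s \<in> P \<and> t \<in> P \<and> sinv s \<in> Q \<and> sinv t \<in> Q"
  then obtain e where e: "e \<in> P \<inter> S" "s \<preceq> e" "t \<preceq> e"
    using feasible_crossing[OF f, of P Q s t] assms by blast
  have c: "consistent G P" "consistent G Q"
    using P assms feasible_consistent[OF f] by blast+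
  have "e \<notin> Q"
    using consistent_downD[OF c(2)] e(2) ** by blast
  then have "sinv e \<in> Q"
    using feasible_orient[OF f, of Q] P e assms by blast
  then have "distinguishes e P Q"
    using \<open>e \<notin> Q\<close> e consistent_sinvD[OF c(1)] unfolding distinguishes_def by blast
  then show "\<exists>e\<in>P \<inter> S'. s \<preceq> e \<and> t \<preceq> e"
    using e * P by blast
qed

lemma feasible_reduction:
  assumes "feasible S \<P>" shows "feasible (reduction S \<P>) \<P>"
  by (rule feasible_sub[OF assms])
    (use feasible_sinv[OF assms] in \<open>auto simp: reduction_def\<close>)

lemma splitting_subset: "splitting G S Q \<subseteq> S"
  by (auto simp: splitting_def)

lemma splits_sinv [simp]: "splits G (sinv s) Q \<longleftrightarrow> splits G s Q"
  by (auto simp: splits_def)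

lemma splits_if_distinguishes:
  assumes "consistent G P" "consistent G P'" "Q \<subseteq> P" "Q \<subseteq> P'" "distinguishes s P P'"
  shows "splits G s Q"
proof -
  have "\<exists>P. consistent G P \<and> Q \<union> {s} \<subseteq> P" "\<exists>P. consistent G P \<and> Q \<union> {sinv s} \<subseteq> P"
    using assms unfolding distinguishes_def by blast+
  then show ?thesis
    unfolding splits_def using consistent_subset by blast
qed

lemma feasible_splitting:
  assumes f: "feasible S \<P>"
  shows "feasible (splitting G S Q) (inducing \<P> N Q)"
proof (rule feasible_sub[OF f splitting_subset inducing_subset])
  show "sinv s \<in> splitting G S Q" if "s \<in> splitting G S Q" for s
    using that feasible_sinv[OF f] by (auto simp: splitting_def)
  show "s \<in> splitting G S Q" if "s \<in> S" "P \<in> inducing \<P> N Q" "P' \<in> inducing \<P> N Q" "distinguishes s P P'"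
    for s P P'
    using that splits_if_distinguishes[of P P' Q s] feasible_consistent[OF f]
    by (auto simp: splitting_def inducing_def)
qed

section \<open>What the operations select\<close>

lemma consistent_nestedD:
  assumes "consistent G P" "s \<in> P" "t \<in> P" "nested_sep s t"
  shows "s \<preceq> t \<or> t \<preceq> s \<or> s \<preceq> sinv t"
  using assms consistentD[of P s t] unfolding nested_sep_def by blast

text \<open>Every element of \<open>P \<inter> S\<close> lies below a maximal \<open>u\<close>.
  Being nested and both maximal in a consistent set, \<open>s\<close> and \<open>u\<close> coincide
  or satisfy \<open>s \<preceq> sinv u\<close>; either way \<open>s\<close> is nested with
  everything below \<open>u\<close>.\<close>

lemma locally_maximal_nested:
  assumes f: "feasible S \<P>" and "locally_maximal S \<P> s" "t \<in> S"
  shows "nested_sep s t"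
proof -
  obtain P where P: "P \<in> \<P>" "well_separated S P" "s \<in> maximal_seps (P \<inter> S)"
    using assms(2) by (auto simp: locally_maximal_def)
  have *: "nested_sep s t" if t: "t \<in> P \<inter> S" for t
  proof -
    obtain u where u: "u \<in> maximal_seps (P \<inter> S)" "t \<preceq> u"
      using ex_maximal_above[OF _ t] feasible_finite[OF f] by blast
    have "nested_sep s u"
      using P u unfolding well_separated_def nested_set_def by blast
    then have "s \<preceq> u \<or> u \<preceq> s \<or> s \<preceq> sinv u"
      using consistent_nestedD[of P s u] feasible_consistent[OF f P(1)] P(3) u(1)
      by (auto simp: maximal_seps_def)
    then consider "u = s" | "s \<preceq> sinv u"
      using P(3) u(1) by (auto simp: maximal_seps_def)
    then show ?thesis
    proof cases
      case 2
      then have "s \<preceq> sinv t" using u(2) sle_trans sinv_sle_sinv by blast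
      then show ?thesis by (simp add: nested_sep_def)
    qed (use u in \<open>simp add: nested_sep_def\<close>)
  qed
  show ?thesis
    using *[of t] *[of "sinv t"] feasible_orient[OF f P(1) assms(3)] assms(3) feasible_sinv[OF f] by auto
qed

text \<open>A strategy of reduced operations applies one only when \<open>S\<close> equals its
  reduction. The operations then coincide with their unreduced versions, which leaves three
  cases.\<close>

lemma apply_op_reduced:
  assumes f: "feasible S \<P>" and op: "op \<in> reduced_ops" and "reduction S \<P> = S"
  shows "apply_op op S \<P> \<subseteq> all_seps S" and "s \<in> apply_op op S \<P> \<Longrightarrow> sinv s \<in> apply_op op S \<P>"
proof -
  have sym: "A \<union> sinv ` A \<subseteq> all_seps S" if "\<And>s. s \<in> A \<Longrightarrow> s \<in> all_seps S" for A
  proof -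
    have "sinv s \<in> all_seps S" if "s \<in> all_seps S" for s
      using that feasible_sinv[OF f] by (simp add: all_seps_def nested_with_def)
    then show ?thesis using that by blast
  qed
  have "ext_seps S \<subseteq> all_seps S"
    unfolding ext_seps_def
  proof (intro sym)
    fix s assume "s \<in> {s. extremal S s}"
    then have e: "extremal S s" by simp
    then show "s \<in> all_seps S"
      unfolding all_seps_def nested_with_def using extremal_nested[OF e] e[unfolded extremal_def] by blast
  qed
  moreover have "loc_seps S \<P> \<subseteq> all_seps S"
    unfolding loc_seps_def
  proof (intro sym)
    fix s assume "s \<in> {s. locally_maximal S \<P> s}"
    then have l: "locally_maximal S \<P> s" by simp
    then have "s \<in> S" by (auto simp: locally_maximal_def maximal_seps_def)
    then show "s \<in> all_seps S"
      unfolding all_seps_def nested_with_def using locally_maximal_nested[OF f l] by blast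
  qed
  ultimately show "apply_op op S \<P> \<subseteq> all_seps S"
    using assms(2) by (auto simp: reduced_ops_def assms(3))
  assume s: "s \<in> apply_op op S \<P>"
  have inv: "sinv s \<in> A \<union> sinv ` A" if "s \<in> A \<union> sinv ` A" for A :: "'a sep set"
    using that by force
  consider "apply_op op S \<P> = ext_seps S" | "apply_op op S \<P> = loc_seps S \<P>"
    | "apply_op op S \<P> = all_seps S"
    using op by (auto simp: reduced_ops_def assms(3))
  then show "sinv s \<in> apply_op op S \<P>"
  proof cases
    case 1 show ?thesis using s unfolding 1 ext_seps_def by (rule inv)
  next
    case 2 show ?thesis using s unfolding 2 loc_seps_def by (rule inv)
  next
    case 3 then show ?thesis
      using s feasible_sinv[OF f] by (simp add: all_seps_def nested_with_def)
  qed
qed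

text \<open>Feasibility forbids two profiles to disagree on both \<open>s\<close> and some
  \<open>t\<close> crossing it: it would give an element of \<open>S\<close> above both, which is
  \<open>s\<close> by maximality, so that they would be nested. As \<open>s\<close> and
  \<open>t\<close> each distinguish some profiles, two such profiles would exist whenever
  \<open>t\<close> crosses \<open>s\<close>.\<close>

lemma maximal_extremal:
  assumes f: "feasible S \<P>" and red: "reduction S \<P> = S" and m: "s \<in> maximal_seps S"
  shows "extremal S s"
proof -
  have sS: "s \<in> S" using m by (simp add: maximal_seps_def)
  have max: "e = s" if "e \<in> S" "s \<preceq> e" for e
    using m that by (auto simp: maximal_seps_def)
  obtain P P' where P: "P \<in> \<P>" "P' \<in> \<P>" "s \<in> P" "sinv s \<in> P'"
    using sS red unfolding reduction_def distinguishes_def by blast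
  have no: "\<not> (t \<in> S \<and> \<not> nested_sep s t \<and> Q \<in> \<P> \<and> Q' \<in> \<P> \<and> s \<in> Q \<and> t \<in> Q \<and> sinv s \<in> Q' \<and> sinv t \<in> Q')"
    for t Q Q'
  proof
    assume *: "t \<in> S \<and> \<not> nested_sep s t \<and> Q \<in> \<P> \<and> Q' \<in> \<P> \<and> s \<in> Q \<and> t \<in> Q \<and> sinv s \<in> Q' \<and> sinv t \<in> Q'"
    then obtain e where "e \<in> S" "s \<preceq> e" "t \<preceq> e"
      using feasible_crossing[OF f, of Q Q' s t] sS by blast
    then show False using max[of e] * unfolding nested_sep_def by blast
  qed
  have cross: "\<not> (t \<in> S \<and> \<not> nested_sep s t \<and> t \<in> P)" for t
  proof
    assume t: "t \<in> S \<and> \<not> nested_sep s t \<and> t \<in> P"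
    then have t': "sinv t \<in> S" "\<not> nested_sep s (sinv t)" using feasible_sinv[OF f] by auto
    have "sinv t \<notin> P'" using no[of t P P'] t P by auto
    then have "t \<in> P'" using feasible_orient[OF f, of P' "sinv t"] P t' by auto
    \<comment> \<open>\<open>P\<close> has \<open>s\<close> and \<open>t\<close>, and
      \<open>P'\<close> has \<open>sinv s\<close> and \<open>t\<close>; a profile with
      \<open>sinv t\<close> disagrees on both separations with one of the two.\<close>
    have "t \<in> reduction S \<P>" using t red by simp
    then obtain Q where Q: "Q \<in> \<P>" "sinv t \<in> Q"
      unfolding reduction_def distinguishes_def by blast
    show False
    proof (cases "s \<in> Q")
      case True
      then show False using no[of "sinv t" Q P'] Q P \<open>t \<in> P'\<close> t' by auto
    next
      case False
      then have "sinv s \<in> Q" using feasible_orient[OF f Q(1) sS] by simp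
      then show False using no[of t P Q] Q P t by auto
    qed
  qed
  show ?thesis
    unfolding extremal_def
  proof (intro conjI ballI sS)
    fix t assume t: "t \<in> S"
    have "nested_sep s t"
      using cross[of t] cross[of "sinv t"] feasible_orient[OF f P(1) t] t feasible_sinv[OF f t] by auto
    then show "t \<preceq> s \<or> sinv t \<preceq> s"
      unfolding nested_sep_def using max[of t] max[of "sinv t"] t feasible_sinv[OF f t] by auto
  qed
qed

text \<open>For \<open>t\<close> in \<open>P \<inter> S\<close>, the alternative
  \<open>sinv t \<preceq> s\<close> contradicts consistency. So \<open>s\<close> is the only maximal
  element and \<open>P\<close> is trivially well separated.\<close>

lemma extremal_locally_maximal:
  assumes f: "feasible S \<P>" and red: "reduction S \<P> = S" and e: "extremal S s"
  shows "locally_maximal S \<P> s"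
proof -
  have sS: "s \<in> S" using e by (simp add: extremal_def)
  obtain P where P: "P \<in> \<P>" "s \<in> P"
    using sS red unfolding reduction_def distinguishes_def by blast
  have *: "t \<preceq> s" if "t \<in> P \<inter> S" for t
    using e that consistentD[OF feasible_consistent[OF f P(1)] P(2), of t] by (auto simp: extremal_def)
  then have "maximal_seps (P \<inter> S) = {s}"
    using P sS sle_antisym unfolding maximal_seps_def by blast
  then have "well_separated S P \<and> s \<in> maximal_seps (P \<inter> S)"
    by (simp add: well_separated_def nested_set_def)
  then show ?thesis
    using P(1) unfolding locally_maximal_def by blast
qed

lemma apply_op_nonempty:
  assumes f: "feasible S \<P>" and op: "op \<in> reduced_ops" and red: "reduction S \<P> = S" and "S \<noteq> {}"
  shows "apply_op op S \<P> \<noteq> {}"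
proof -
  obtain s where "s \<in> maximal_seps S"
    using ex_maximal_above[OF feasible_finite[OF f]] assms(4) by blast
  then have e: "extremal S s" by (rule maximal_extremal[OF f red])
  have "s \<in> all_seps S" using e extremal_nested[OF e] by (auto simp: all_seps_def nested_with_def extremal_def)
  moreover have "s \<in> ext_seps S" using e by (simp add: ext_seps_def)
  moreover have "s \<in> loc_seps S \<P>" using extremal_locally_maximal[OF f red e] by (simp add: loc_seps_def)
  ultimately show ?thesis
    using op by (auto simp: reduced_ops_def red)
qed

text \<open>\<open>Q\<close> already orients \<open>s\<close>, so adding both orientations of
  \<open>s\<close> cannot stay consistent. This is what makes \<open>S\<close> shrink.\<close>

lemma splitting_disjoint:
  assumes Q: "Q \<in> consistent_orientations G N" and "s \<in> N"
  shows "s \<notin> splitting G S Q"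
proof
  assume s: "s \<in> splitting G S Q"
  have "s \<in> Q \<or> sinv s \<in> Q"
    using assms by (auto simp: consistent_orientations_def orients_def)
  then show False
    using s consistent_sinvD[of "Q \<union> {s}" s] consistent_sinvD[of "Q \<union> {sinv s}" s]
    by (auto simp: splitting_def splits_def)
qed

lemma splitting_apply_op_less:
  assumes f: "feasible S \<P>" and op: "op \<in> reduced_ops" and red: "reduction S \<P> = S" and "S \<noteq> {}"
    and Q: "Q \<in> consistent_orientations G (apply_op op S \<P>)"
  shows "splitting G S Q \<subset> S"
proof -
  obtain s where s: "s \<in> apply_op op S \<P>" using apply_op_nonempty[OF assms(1-4)] by blast
  then have "s \<in> S" using apply_op_reduced(1)[OF f op red] by (auto simp: all_seps_def)
  then show ?thesis
    using splitting_disjoint[OF Q s, of S] splitting_subset by blast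
qed

text \<open>Since every operation is a reduced one, the recursion of \<open>N_strat\<close> is on \<open>|S|\<close> alone.\<close>

lemma feasible_strategy_induct [consumes 2, case_names empty reduce split]:
  assumes "feasible S \<P>" "range \<sigma> \<subseteq> reduced_ops"
    and "\<And>\<sigma> \<P>. feasible {} \<P> \<Longrightarrow> range \<sigma> \<subseteq> reduced_ops \<Longrightarrow> thesis \<sigma> {} \<P>"
    and "\<And>\<sigma> S \<P>. feasible S \<P> \<Longrightarrow> range \<sigma> \<subseteq> reduced_ops \<Longrightarrow> S \<noteq> {} \<Longrightarrow> reduction S \<P> \<subset> S \<Longrightarrow>
          thesis \<sigma> (reduction S \<P>) \<P> \<Longrightarrow> thesis \<sigma> S \<P>"
    and "\<And>\<sigma> S \<P>. feasible S \<P> \<Longrightarrow> range \<sigma> \<subseteq> reduced_ops \<Longrightarrow> S \<noteq> {} \<Longrightarrow> reduction S \<P> = S \<Longrightarrow>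
          (\<And>Q. Q \<in> consistent_orientations G (apply_op (\<sigma> 0) S \<P>) \<Longrightarrow>
             thesis (\<lambda>i. \<sigma> (Suc i)) (splitting G S Q) (inducing \<P> (apply_op (\<sigma> 0) S \<P>) Q)) \<Longrightarrow>
          thesis \<sigma> S \<P>"
  shows "thesis \<sigma> S \<P>"
  using assms(1,2)
proof (induction "card S" arbitrary: S \<P> \<sigma> rule: less_induct)
  case less
  note f = less.prems(1) and r = less.prems(2)
  have fin: "finite S" using feasible_finite[OF f] .
  consider "S = {}" | "S \<noteq> {}" "reduction S \<P> \<subset> S" | "S \<noteq> {}" "reduction S \<P> = S"
    using reduction_subset[of S \<P>] by blast
  then show ?case
  proof cases
    case 1 then show ?thesis using assms(3) less.prems by blast
  next
    case 2
    show ?thesis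
      by (rule assms(4)[OF f r 2], rule less.hyps)
        (use 2 psubset_card_mono[OF fin] feasible_reduction[OF f] r in auto)
  next
    case 3
    have "\<sigma> 0 \<in> reduced_ops" using r by auto
    then show ?thesis
      using splitting_apply_op_less[OF f _ 3(2,1)] psubset_card_mono[OF fin] feasible_splitting[OF f] r
      by (intro assms(5)[OF f r 3], intro less.hyps) auto
  qed
qed

section \<open>Recursion equations on feasible tasks and their consequences\<close>

lemma N_strat_dom:
  assumes "feasible S \<P>" "range \<sigma> \<subseteq> reduced_ops"
  shows "N_strat_dom (G, \<sigma>, S, \<P>)"
  using assms
proof (induction rule: feasible_strategy_induct)
  case (empty \<sigma> \<P>)
  show ?case by (rule N_strat.domintros) auto
next
  case (reduce \<sigma> S \<P>)
  then have "first_reduced \<sigma> = 0" using first_reduced_0 by blast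
  with reduce show ?case by (intro N_strat.domintros) auto
next
  case (split \<sigma> S \<P>)
  then show ?case by (intro N_strat.domintros) auto
qed

lemma N_strat_empty: "range \<sigma> \<subseteq> reduced_ops \<Longrightarrow> feasible {} \<P> \<Longrightarrow> N_strat G \<sigma> {} \<P> = {}"
  by (subst N_strat.psimps[OF N_strat_dom]) auto

lemma N_strat_reduce:
  assumes "feasible S \<P>" "range \<sigma> \<subseteq> reduced_ops" "S \<noteq> {}" "reduction S \<P> \<subset> S"
  shows "N_strat G \<sigma> S \<P> = N_strat G \<sigma> (reduction S \<P>) \<P>"
proof -
  have "\<sigma> 0 \<in> reduced_ops" using assms by blast
  then show ?thesis
    using assms first_reduced_0[of \<sigma>] by (subst N_strat.psimps[OF N_strat_dom]) simp_all
qed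

lemma N_strat_split:
  assumes "feasible S \<P>" "range \<sigma> \<subseteq> reduced_ops" "S \<noteq> {}" "reduction S \<P> = S"
  shows "N_strat G \<sigma> S \<P> = apply_op (\<sigma> 0) S \<P> \<union>
        (\<Union>Q\<in>consistent_orientations G (apply_op (\<sigma> 0) S \<P>).
           N_strat G (\<lambda>i. \<sigma> (Suc i)) (splitting G S Q) (inducing \<P> (apply_op (\<sigma> 0) S \<P>) Q))"
  using assms by (subst N_strat.psimps[OF N_strat_dom]) auto

text \<open>Consistency of \<open>Q\<close> with both orientations of \<open>s\<close> rules out
  \<open>sinv t\<close> below either of them; nestedness leaves \<open>t\<close> below one.\<close>

lemma splits_nested_above:
  assumes "splits G s Q" "t \<in> Q" "nested_sep s t"
  shows "t \<preceq> s \<or> t \<preceq> sinv s"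
proof -
  have "\<not> sinv t \<preceq> s" "\<not> sinv t \<preceq> sinv s"
    using assms(1,2) consistentD[of "Q \<union> {s}" s t] consistentD[of "Q \<union> {sinv s}" "sinv s" t]
    by (auto simp: splits_def)
  then show ?thesis
    using assms(3) unfolding nested_sep_def by (metis sinv_sle_sinv sle_sinv_iff')
qed

lemma orientation_cases:
  "Q \<in> consistent_orientations G N \<Longrightarrow> s \<in> N \<Longrightarrow> s \<in> Q \<or> sinv s \<in> Q"
  by (auto simp: consistent_orientations_def orients_def)

lemma orientations_differ:
  assumes "Q \<in> consistent_orientations G N" "Q' \<in> consistent_orientations G N" "Q \<noteq> Q'"
  shows "\<exists>t\<in>Q. sinv t \<in> Q'"
proof -
  have "\<not> Q \<subseteq> Q'"
  proof
    assume "Q \<subseteq> Q'"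
    then obtain t where t: "t \<in> Q'" "t \<notin> Q" using assms(3) by blast
    then have "sinv t \<in> Q" 
      using assms(2) orientation_cases[OF assms(1), of t] by (auto simp: consistent_orientations_def)
    then show False
      using \<open>Q \<subseteq> Q'\<close> t assms(2) consistent_sinvD[of Q' t] by (auto simp: consistent_orientations_def)
  qed
  then show ?thesis
    using orientation_cases[OF assms(2)] assms(1) by (auto simp: consistent_orientations_def)
qed

text \<open>For \<open>Q \<noteq> Q'\<close> some \<open>t\<close> lies in \<open>Q\<close> with
  inverse in \<open>Q'\<close>. A separation splitting \<open>Q\<close> has an orientation above
  \<open>t\<close>, one splitting \<open>Q'\<close> has an orientation above \<open>sinv t\<close>,
  so the two lie on different sides of \<open>t\<close>. \<open>M\<close> is arbitrary because the
  lemma serves both inside a strategy and for passing to the next order.\<close>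

lemma nested_splitting_union:
  assumes N: "nested_set N" "\<And>s. s \<in> N \<Longrightarrow> sinv s \<in> N" and S: "\<And>s. s \<in> S \<Longrightarrow> nested_with s N"
    and M: "\<And>Q. Q \<in> consistent_orientations G N \<Longrightarrow> nested_set (M Q) \<and> M Q \<subseteq> splitting G S Q"
  shows "nested_set (N \<union> (\<Union>Q\<in>consistent_orientations G N. M Q))"
proof -
  have NM: "nested_sep s t" if "s \<in> M Q" "Q \<in> consistent_orientations G N" "t \<in> N" for s t Q
  proof -
    have "s \<in> S" using that(1) M[OF that(2)] splitting_subset[of S Q] by blast
    then show ?thesis using S[of s] that(3) by (simp add: nested_with_def)
  qed
  have MM: "nested_sep s s'" if s: "s \<in> M Q" "Q \<in> consistent_orientations G N"
    and s': "s' \<in> M Q'" "Q' \<in> consistent_orientations G N" for s s' Q Q'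
  proof (cases "Q = Q'")
    case True then show ?thesis using M[OF s(2)] s(1) s'(1) unfolding nested_set_def by blast
  next
    case False
    then obtain t where t: "t \<in> Q" "sinv t \<in> Q'"
      using orientations_differ s s' by blast
    have tN: "t \<in> N" using t s by (auto simp: consistent_orientations_def)
    have spl: "splits G s Q" "splits G s' Q'"
      using s s' M[OF s(2)] M[OF s'(2)] unfolding splitting_def by blast+
    have "t \<preceq> s \<or> t \<preceq> sinv s"
      using splits_nested_above[OF spl(1) t(1)] NM[OF s tN] by blast
    moreover have "sinv t \<preceq> s' \<or> sinv t \<preceq> sinv s'"
      using splits_nested_above[OF spl(2) t(2)] NM[OF s' tN] by simp
    ultimately show ?thesis
      unfolding nested_sep_def by (metis sle_sinv_iff sle_sinv_iff' sle_trans swap_swap)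
  qed
  show ?thesis
    unfolding nested_set_def
  proof (intro ballI)
    fix s t assume st: "s \<in> N \<union> (\<Union>Q\<in>consistent_orientations G N. M Q)"
      "t \<in> N \<union> (\<Union>Q\<in>consistent_orientations G N. M Q)"
    then consider "s \<in> N" "t \<in> N"
      | Q where "Q \<in> consistent_orientations G N" "s \<in> M Q" "t \<in> N"
      | Q where "Q \<in> consistent_orientations G N" "t \<in> M Q" "s \<in> N"
      | Q Q' where "Q \<in> consistent_orientations G N" "s \<in> M Q"
          "Q' \<in> consistent_orientations G N" "t \<in> M Q'"
      by blast
    then show "nested_sep s t"
    proof cases
      case 1 then show ?thesis using N(1) by (simp add: nested_set_def)
    next
      case 2 then show ?thesis using NM by blast
    next
      case 3 then show ?thesis using NM nested_sep_sym by blast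
    next
      case 4 then show ?thesis using MM by blast
    qed
  qed
qed

theorem N_strat_system:
  assumes "feasible S \<P>" "range \<sigma> \<subseteq> reduced_ops"
  shows "N_strat G \<sigma> S \<P> \<subseteq> S \<and> nested_set (N_strat G \<sigma> S \<P>) \<and>
    (\<forall>s\<in>N_strat G \<sigma> S \<P>. sinv s \<in> N_strat G \<sigma> S \<P>)"
  using assms
proof (induction rule: feasible_strategy_induct)
  case (empty \<sigma> \<P>)
  then show ?case by (simp add: N_strat_empty nested_set_def)
next
  case (reduce \<sigma> S \<P>)
  then show ?case
    unfolding N_strat_reduce[OF reduce(1-4)] using reduction_subset[of S \<P>] by blast
next
  case (split \<sigma> S \<P>)
  let ?N = "apply_op (\<sigma> 0) S \<P>"
  let ?M = "\<lambda>Q. N_strat G (\<lambda>i. \<sigma> (Suc i)) (splitting G S Q) (inducing \<P> ?N Q)"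
  have op: "\<sigma> 0 \<in> reduced_ops" using split by auto
  note N = apply_op_reduced[OF split(1) op split(4)]
  have "nested_set (?N \<union> (\<Union>Q\<in>consistent_orientations G ?N. ?M Q))"
  proof (rule nested_splitting_union[where S = S])
    show "nested_set ?N"
      using N(1) by (auto simp: nested_set_def all_seps_def nested_with_def)
    show "\<And>s. s \<in> ?N \<Longrightarrow> sinv s \<in> ?N" by (rule N(2))
    show "\<And>s. s \<in> S \<Longrightarrow> nested_with s ?N"
      using N(1) nested_sep_sym unfolding all_seps_def nested_with_def by blast
    show "\<And>Q. Q \<in> consistent_orientations G ?N \<Longrightarrow> nested_set (?M Q) \<and> ?M Q \<subseteq> splitting G S Q"
      using split.IH by blast
  qed
  moreover have "?N \<union> (\<Union>Q\<in>consistent_orientations G ?N. ?M Q) \<subseteq> S"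
  proof -
    have "?N \<subseteq> S" using N(1) unfolding all_seps_def by blast
    then show ?thesis using split.IH splitting_subset[of S] by blast
  qed
  moreover have "\<forall>s\<in>?N \<union> (\<Union>Q\<in>consistent_orientations G ?N. ?M Q).
      sinv s \<in> ?N \<union> (\<Union>Q\<in>consistent_orientations G ?N. ?M Q)"
    using N(2) split.IH by blast
  ultimately show ?case
    unfolding N_strat_split[OF split(1-4)] by blast
qed

lemma inducing_orientation:
  assumes f: "feasible S \<P>" and "N \<subseteq> S" "\<And>s. s \<in> N \<Longrightarrow> sinv s \<in> N" "P \<in> \<P>"
  shows "P \<inter> N \<in> consistent_orientations G N"
proof -
  have "consistent G (P \<inter> N)"
    using feasible_consistent[OF f assms(4)] consistent_subset by blast
  moreover have "s \<in> P \<inter> N \<or> sinv s \<in> P \<inter> N \<inter> N" if "s \<in> N" for s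
    using that assms(2,3) feasible_orient[OF f assms(4), of s] by blast
  ultimately show ?thesis
    using consistent_antisymmetric unfolding consistent_orientations_def orients_def by blast
qed

text \<open>If the selected set does not separate the two profiles, both induce the same orientation
  of it and stay together in one subtask.\<close>

theorem N_strat_distinguishes:
  assumes "feasible S \<P>" "range \<sigma> \<subseteq> reduced_ops" "P \<in> \<P>" "P' \<in> \<P>" "P \<noteq> P'"
  shows "\<exists>s\<in>N_strat G \<sigma> S \<P>. distinguishes s P P'"
  using assms
proof (induction rule: feasible_strategy_induct)
  case (empty \<sigma> \<P>)
  then show ?case using feasible_distinguish by blast
next
  case (reduce \<sigma> S \<P>)
  then show ?case unfolding N_strat_reduce[OF reduce(1-4)] by blast
next
  case (split \<sigma> S \<P>)
  let ?N = "apply_op (\<sigma> 0) S \<P>"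
  have op: "\<sigma> 0 \<in> reduced_ops" using split by auto
  have N: "?N \<subseteq> S" "\<And>s. s \<in> ?N \<Longrightarrow> sinv s \<in> ?N"
    using apply_op_reduced[OF split(1) op split(4)] by (auto simp: all_seps_def)
  show ?case
  proof (cases "P \<inter> ?N = P' \<inter> ?N")
    case True
    let ?Q = "P \<inter> ?N"
    have "P \<in> inducing \<P> ?N ?Q" "P' \<in> inducing \<P> ?N ?Q"
      using split.prems True by (auto simp: inducing_def)
    then show ?thesis
      using split.IH[OF inducing_orientation[OF split(1) N split.prems(1)]] split.prems
        inducing_orientation[OF split(1) N split.prems(1)]
      unfolding N_strat_split[OF split(1-4)] by blast
  next
    case False
    then obtain s where s: "s \<in> ?N" "(s \<in> P) \<noteq> (s \<in> P')" by blast
    then have "distinguishes s P P'"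
      using N feasible_orient[OF split(1), of _ s] split.prems
        consistent_sinvD[OF feasible_consistent[OF split(1)], of P s]
        consistent_sinvD[OF feasible_consistent[OF split(1)], of P' s]
      unfolding distinguishes_def by blast
    then show ?thesis
      using s unfolding N_strat_split[OF split(1-4)] by blast
  qed
qed

text \<open>Separations only leave the system during the recursion when they no longer distinguish
  two of the remaining profiles.\<close>

theorem N_strat_witness:
  assumes "feasible S \<P>" "range \<sigma> \<subseteq> reduced_ops" "u \<in> N_strat G \<sigma> S \<P>"
  shows "\<exists>P\<in>\<P>. \<exists>P'\<in>\<P>. distinguishes u P P' \<and> (\<forall>w\<in>S. distinguishes w P P' \<longrightarrow> nested_sep u w)"
  using assms
proof (induction rule: feasible_strategy_induct)
  case (empty \<sigma> \<P>)
  then show ?case using N_strat_empty by blast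
next
  case (reduce \<sigma> S \<P>)
  then obtain P P' where "P \<in> \<P>" "P' \<in> \<P>" "distinguishes u P P'"
    "\<forall>w\<in>reduction S \<P>. distinguishes w P P' \<longrightarrow> nested_sep u w"
    using N_strat_reduce by blast
  then show ?case by (force simp: reduction_def)
next
  case (split \<sigma> S \<P>)
  let ?N = "apply_op (\<sigma> 0) S \<P>"
  have op: "\<sigma> 0 \<in> reduced_ops" using split by auto
  have N: "?N \<subseteq> all_seps S" using apply_op_reduced[OF split(1) op split(4)] by blast
  consider "u \<in> ?N" | Q where "Q \<in> consistent_orientations G ?N"
    "u \<in> N_strat G (\<lambda>i. \<sigma> (Suc i)) (splitting G S Q) (inducing \<P> ?N Q)"
    using split.prems unfolding N_strat_split[OF split(1-4)] by blast
  then show ?case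
  proof cases
    case 1
    then have "u \<in> S" "\<forall>w\<in>S. nested_sep u w" using N by (auto simp: all_seps_def nested_with_def)
    then show ?thesis using split(4) unfolding reduction_def by blast
  next
    case 2
    then obtain P P' where P: "P \<in> inducing \<P> ?N Q" "P' \<in> inducing \<P> ?N Q" "distinguishes u P P'"
      "\<forall>w\<in>splitting G S Q. distinguishes w P P' \<longrightarrow> nested_sep u w"
      using split.IH by blast
    have "w \<in> splitting G S Q" if "w \<in> S" "distinguishes w P P'" for w
      using that P splits_if_distinguishes[of P P' Q w] feasible_consistent[OF split(1)]
      by (auto simp: splitting_def inducing_def)
    then show ?thesis using P inducing_subset by blast
  qed
qed

end

section \<open>Uncrossing at one level\<close>

lemma distinguishesE:
  assumes "distinguishes s P P'"
  obtains "s \<in> P" "sinv s \<in> P'" | "s \<in> P'" "sinv s \<in> P"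
  using assms unfolding distinguishes_def by blast

definition crossings :: "'a sep set \<Rightarrow> 'a sep \<Rightarrow> nat" where
  "crossings N s = card {t \<in> N. \<not> nested_sep s t}"

lemma crossings_sinv [simp]: "crossings N (sinv s) = crossings N s"
  by (simp add: crossings_def)

text \<open>Elements of \<open>N\<close> nested with \<open>s\<close> are nested with
  \<open>t\<close> as well, hence with the join of the crossing pair; and \<open>t\<close> itself is
  no longer crossed.\<close>

lemma crossings_sjoin_less:
  assumes N: "finite N" "nested_set N" "t \<in> N" and st: "\<not> nested_sep s t"
  shows "crossings N (sjoin s t) < crossings N s"
proof -
  have "nested_sep (sjoin s t) u" if "u \<in> N" "nested_sep s u" for u
  proof -
    have "nested_sep u t" using N that by (simp add: nested_set_def)
    then have "nested_sep u (sjoin s t)"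
      using that(2) st nested_sep_sym by (intro nested_sjoin_crossing) blast+
    then show ?thesis using nested_sep_sym by blast
  qed
  moreover have "nested_sep (sjoin s t) t"
    by (rule nested_sepI) simp
  ultimately have "{u \<in> N. \<not> nested_sep (sjoin s t) u} \<subset> {u \<in> N. \<not> nested_sep s u}"
    using N(3) st by blast
  then show ?thesis
    unfolding crossings_def by (rule psubset_card_mono[rotated]) (simp add: N(1))
qed

lemma restrict_restrict: "l \<le> m \<Longrightarrow> restrict_profile l (restrict_profile m P) = restrict_profile l P"
  by (auto simp: restrict_profile_def)

lemma distinguishes_restrict:
  "sorder s < m \<Longrightarrow> distinguishes s (restrict_profile m P) (restrict_profile m P') \<longleftrightarrow> distinguishes s P P'"
  by (simp add: distinguishes_def restrict_profile_def)

context pair_graph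
begin

lemma k_profile_consistent: "k_profile G k P \<Longrightarrow> consistent G P"
  by (simp add: k_profile_def profile_def)

lemma k_profile_sorder: "k_profile G k P \<Longrightarrow> s \<in> P \<Longrightarrow> sorder s < k"
  unfolding k_profile_def by blast

lemma k_profile_orient: "k_profile G k P \<Longrightarrow> separation G s \<Longrightarrow> sorder s < k \<Longrightarrow> s \<notin> P \<Longrightarrow> sinv s \<in> P"
  unfolding k_profile_def by blast

lemma k_profile_down:
  assumes "k_profile G k P" "s \<in> P" "t \<preceq> s" "separation G t" "sorder t < k"
  shows "t \<in> P"
  using k_profile_orient[OF assms(1,4,5)] consistent_downD[OF k_profile_consistent[OF assms(1)] assms(2,3)]
  by blast

text \<open>The profile condition excludes the inverse of the join, while the order bound forces
  \<open>P\<close> to contain one of the two.\<close>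

lemma k_profile_sjoin:
  assumes P: "k_profile G k P" "s \<in> P" "t \<in> P" and o: "sorder (sjoin s t) < k"
  shows "sjoin s t \<in> P"
proof (rule ccontr)
  have sep: "separation G (sjoin s t)"
    using P separation_sjoin consistent_sepD[OF k_profile_consistent[OF P(1)]] by blast
  assume "sjoin s t \<notin> P"
  then have "sinv (sjoin s t) \<in> P"
    using k_profile_orient[OF P(1) sep o] by blast
  then have "(snd s \<inter> snd t, fst s \<union> fst t) \<in> P"
    by (simp add: sjoin_def)
  moreover have "(fst s, snd s) \<in> P" "(fst t, snd t) \<in> P"
    using P by simp_all
  ultimately show False
    using P(1) unfolding k_profile_def profile_def by blast
qed

lemma k_profile_restrict:
  assumes P: "k_profile G k P" and l: "l \<le> k"
  shows "k_profile G l (restrict_profile l P)"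
proof -
  have "consistent G (restrict_profile l P)"
    by (rule consistent_subset[OF k_profile_consistent[OF P]]) (auto simp: restrict_profile_def)
  moreover have "(B \<inter> D, A \<union> C) \<notin> restrict_profile l P"
    if "(A, B) \<in> restrict_profile l P" "(C, D) \<in> restrict_profile l P" for A B C D
    using that P unfolding k_profile_def profile_def restrict_profile_def by blast
  moreover have "(s \<in> restrict_profile l P) \<noteq> (sinv s \<in> restrict_profile l P)"
    if "separation G s" "sorder s < l" for s
  proof -
    have "sorder s < k" using that(2) l by simp
    then have "(s \<in> P) \<noteq> (sinv s \<in> P)" using that(1) P unfolding k_profile_def by blast
    then show ?thesis using that(2) by (simp add: restrict_profile_def)
  qed
  ultimately show ?thesis
    unfolding k_profile_def profile_def restrict_profile_def by blast
qed

lemma k_profiles_differ: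
  assumes "k_profile G k P" "k_profile G k P'" "P \<noteq> P'"
  shows "\<exists>s\<in>P. sinv s \<in> P'"
proof (cases "P \<subseteq> P'")
  case True
  then obtain s where s: "s \<in> P'" "s \<notin> P" using assms(3) by blast
  then have "sinv s \<in> P"
    using k_profile_orient[OF assms(1)] k_profile_sorder[OF assms(2)]
      consistent_sepD[OF k_profile_consistent[OF assms(2)]] by blast
  then show ?thesis using s by force
next
  case False
  then show ?thesis
    using k_profile_orient[OF assms(2)] k_profile_sorder[OF assms(1)]
      consistent_sepD[OF k_profile_consistent[OF assms(1)]] by blast
qed

lemma distinguishesI:
  assumes "consistent G P" "consistent G P'" "s \<in> P" "sinv s \<in> P'"
  shows "distinguishes s P P'"
  using assms consistent_sinvD[of P s] consistent_sinvD[of P' "sinv s"]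
  unfolding distinguishes_def by auto

text \<open>The system \<open>S\<close> of the step to \<open>k = m + 1\<close>, where
  \<open>N\<close> consists of separations of order below \<open>m\<close>. For \<open>m = 0\<close>
  and empty \<open>N\<close> it is the system of the base case.\<close>

definition level_seps :: "nat \<Rightarrow> 'a sep set \<Rightarrow> 'a sep set" where
  "level_seps m N = {s. separation G s \<and> proper_sep s \<and> sorder s = m \<and> nested_with s N}"

text \<open>The inverse of the corner lies below \<open>sinv s\<close>, hence in \<open>P'\<close>.
  So a corner of order at most \<open>m\<close> distinguishes the same two profiles as
  \<open>s\<close>.\<close>

lemma level_corner:
  assumes P: "k_profile G (Suc m) P" "k_profile G (Suc m) P'"
    and s: "s \<in> P" "sinv s \<in> P'" and t: "t \<in> P" and "sorder (sjoin s t) \<le> m"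
  shows "sjoin s t \<in> P" "sinv (sjoin s t) \<in> P'"
proof -
  show st: "sjoin s t \<in> P"
    using k_profile_sjoin[OF P(1) s(1) t] assms(6) by simp
  then have "separation G (sjoin s t)"
    using consistent_sepD[OF k_profile_consistent[OF P(1)]] by blast
  then show "sinv (sjoin s t) \<in> P'"
    using k_profile_down[OF P(2) s(2), of "sinv (sjoin s t)"] assms(6) by simp
qed

text \<open>Take \<open>s\<close> crossing as few elements of \<open>N\<close> as possible. If it crosses \<open>t\<close>, submodularity forces
  both \<open>smeet s t\<close> and \<open>smeet (sinv s) t\<close> below the order of \<open>t\<close>; two profiles that \<open>t\<close>
  distinguishes efficiently agree on them, but the one containing \<open>sinv t\<close> and some orientation of
  \<open>s\<close> cannot contain both.\<close>

lemma level_nested_ex: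
  assumes N: "finite N" "nested_set N" "\<And>t. t \<in> N \<Longrightarrow> sinv t \<in> N"
      "\<And>t. t \<in> N \<Longrightarrow> separation G t \<and> sorder t < m"
    and wit: "\<And>t. t \<in> N \<Longrightarrow> \<exists>Q Q'. k_profile G (Suc m) Q \<and> k_profile G (Suc m) Q' \<and>
        distinguishes t Q Q' \<and> restrict_profile (sorder t) Q = restrict_profile (sorder t) Q'"
    and P: "k_profile G (Suc m) P" "k_profile G (Suc m) P'" "P \<noteq> P'" "P \<inter> N = P' \<inter> N"
      "restrict_profile m P = restrict_profile m P'"
  shows "\<exists>s\<in>level_seps m N. distinguishes s P P'"
proof -
  obtain s where s: "s \<in> P \<and> sinv s \<in> P'"
    and min: "\<And>s'. s' \<in> P \<and> sinv s' \<in> P' \<Longrightarrow> crossings N s \<le> crossings N s'"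
    using k_profiles_differ[OF P(1-3)]
      ex_has_least_nat[of "\<lambda>s. s \<in> P \<and> sinv s \<in> P'" _ "crossings N"] by blast
  note c = k_profile_consistent[OF P(1)] k_profile_consistent[OF P(2)]
  have d: "distinguishes s P P'" using distinguishesI[OF c] s by blast
  note sep = distinguishes_proper[OF c d]
  have "\<not> sorder s < m"
  proof
    assume "sorder s < m"
    then have "s \<in> restrict_profile m P" using s by (simp add: restrict_profile_def)
    then have "s \<in> P'" unfolding P(5) by (simp add: restrict_profile_def)
    then show False using s consistent_sinvD[OF c(2)] by blast
  qed
  then have m: "sorder s = m" using k_profile_sorder[OF P(1)] s by fastforce
  have no: "nested_sep s t" if t: "t \<in> N" "t \<in> P" for t
  proof (rule ccontr)
    assume cr: "\<not> nested_sep s t"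
    have tP': "t \<in> P'" using t P(4) by blast
    have "\<not> sorder (sjoin s t) \<le> m"
      using level_corner[OF P(1,2) conjunct1[OF s] conjunct2[OF s] t(2)]
        min[of "sjoin s t"] crossings_sjoin_less[OF N(1,2) t(1) cr] by fastforce
    then have 1: "sorder (smeet s t) < sorder t"
      using sorder_submodular[OF sep(1), of t] N(4)[OF t(1)] m by linarith
    have "\<not> sorder (sjoin (sinv s) t) \<le> m"
    proof
      assume o: "sorder (sjoin (sinv s) t) \<le> m"
      have "sjoin (sinv s) t \<in> P'" "sinv (sjoin (sinv s) t) \<in> P"
        using level_corner[OF P(2,1) conjunct2[OF s] _ tP' o] s by auto
      then have "crossings N s \<le> crossings N (sjoin (sinv s) t)"
        using min[of "sinv (sjoin (sinv s) t)"] by simp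
      then show False
        using crossings_sjoin_less[OF N(1,2) t(1), of "sinv s"] cr by simp
    qed
    then have 2: "sorder (smeet (sinv s) t) < sorder t"
      using sorder_submodular[of "sinv s" t] sep(1) N(4)[OF t(1)] m by simp
    have sepm: "separation G (smeet s t)" "separation G (smeet (sinv s) t)"
      using sep(1) N(4)[OF t(1)] separation_smeet by simp_all
    obtain Q Q' where Q: "k_profile G (Suc m) Q" "k_profile G (Suc m) Q'" "t \<in> Q" "sinv t \<in> Q'"
      "restrict_profile (sorder t) Q = restrict_profile (sorder t) Q'"
      using wit[OF t(1)] by (metis distinguishesE)
    have o: "sorder t < Suc m" using N(4)[OF t(1)] by simp
    have in': "u \<in> Q'" if u: "u \<preceq> t" "sorder u < sorder t" "separation G u" for u
    proof -
      have "u \<in> Q" using k_profile_down[OF Q(1,3) u(1,3)] u(2) o by simp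
      then have "u \<in> restrict_profile (sorder t) Q'"
        using u(2) unfolding Q(5)[symmetric] by (simp add: restrict_profile_def)
      then show ?thesis by (simp add: restrict_profile_def)
    qed
    have no': False if r: "r \<in> Q'" "sorder (smeet (sinv r) t) < sorder t" "smeet (sinv r) t \<in> Q'" for r
    proof -
      have eq: "sjoin r (sinv t) = sinv (smeet (sinv r) t)" by (simp add: sinv_smeet)
      have "sjoin r (sinv t) \<in> Q'"
        by (rule k_profile_sjoin[OF Q(2) r(1) Q(4)]) (use r(2) o in \<open>simp add: eq\<close>)
      then show False
        using r(3) consistent_sinvD[OF k_profile_consistent[OF Q(2)]] unfolding eq by blast
    qed
    show False
    proof (cases "s \<in> Q'")
      case True
      then show False using no'[of s] in'[OF _ 2 sepm(2)] 2 by simp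
    next
      case False
      then have "sinv s \<in> Q'" using k_profile_orient[OF Q(2) sep(1)] m by simp
      then show False using no'[of "sinv s"] in'[OF _ 1 sepm(1)] 1 by simp
    qed
  qed
  have "nested_sep s t" if t: "t \<in> N" for t
  proof (cases "t \<in> P")
    case False
    then have "sinv t \<in> P" using k_profile_orient[OF P(1)] N(4)[OF t] by simp
    then show ?thesis using no[OF N(3)[OF t]] by simp
  qed (rule no[OF t])
  then show ?thesis
    using d sep m unfolding level_seps_def nested_with_def by blast
qed

text \<open>Profiles inducing the same orientation of \<open>N\<close> agree below order
  \<open>m\<close>. Therefore the meet of a crossing pair cannot have order below \<open>m\<close>,
  submodularity bounds the order of the join by \<open>m\<close>, and the join is the required
  separation above both; it stays nested with \<open>N\<close> by the corner argument.\<close>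

lemma level_feasible:
  assumes N: "finite N" "nested_set N" "\<And>t. t \<in> N \<Longrightarrow> sinv t \<in> N"
      "\<And>t. t \<in> N \<Longrightarrow> separation G t \<and> sorder t < m"
    and prof: "\<And>P. P \<in> \<P> \<Longrightarrow> k_profile G (Suc m) P"
    and wit: "\<And>t. t \<in> N \<Longrightarrow> \<exists>Q\<in>\<P>. \<exists>Q'\<in>\<P>.
        distinguishes t Q Q' \<and> restrict_profile (sorder t) Q = restrict_profile (sorder t) Q'"
    and dist: "\<And>P P'. P \<in> \<P> \<Longrightarrow> P' \<in> \<P> \<Longrightarrow> restrict_profile m P \<noteq> restrict_profile m P' \<Longrightarrow>
        \<exists>t\<in>N. distinguishes t P P'"
  shows "feasible (splitting G (level_seps m N) Q) (inducing \<P> N Q)"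
proof -
  let ?S = "level_seps m N" and ?PP = "inducing \<P> N Q"
  have kp: "k_profile G (Suc m) P" and con: "consistent G P" if "P \<in> ?PP" for P
    using that prof k_profile_consistent inducing_subset by blast+
  have S: "separation G s" "proper_sep s" "sorder s = m" "sinv s \<in> ?S" "\<And>t. t \<in> N \<Longrightarrow> nested_sep s t"
    if "s \<in> ?S" for s
    using that by (simp_all add: level_seps_def nested_with_def)
  have S_sinv: "sinv s \<in> splitting G ?S Q" if "s \<in> splitting G ?S Q" for s
    using that S(4) unfolding splitting_def by simp
  have eqN: "P \<inter> N = P' \<inter> N" if "P \<in> ?PP" "P' \<in> ?PP" for P P'
    using that by (simp add: inducing_def)
  have eqm: "restrict_profile m P = restrict_profile m P'" if PP: "P \<in> ?PP" "P' \<in> ?PP" for P P'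
  proof (rule ccontr)
    assume "restrict_profile m P \<noteq> restrict_profile m P'"
    then obtain t where "t \<in> N" "distinguishes t P P'"
      using dist PP inducing_subset by blast
    then show False using eqN[OF PP] N(3) unfolding distinguishes_def by blast
  qed
  have split: "s \<in> splitting G ?S Q" if PP: "P \<in> ?PP" "P' \<in> ?PP" and s: "s \<in> ?S" "distinguishes s P P'"
    for s P P'
    using splits_if_distinguishes[OF con[OF PP(1)] con[OF PP(2)] _ _ s(2), of Q] PP s(1)
    unfolding splitting_def inducing_def by blast
  show ?thesis
    unfolding feasible_def
  proof (intro conjI ballI impI)
    fix s assume s: "s \<in> splitting G ?S Q"
    then have "s \<in> ?S" using splitting_subset by blast
    then show "separation G s" "proper_sep s" using S by blast+
    show "sinv s \<in> splitting G ?S Q" using S_sinv[OF s] .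
  next
    fix P assume P: "P \<in> ?PP"
    then show "consistent G P" by (rule con)
    have "s \<in> P \<or> sinv s \<in> P \<inter> splitting G ?S Q" if s: "s \<in> splitting G ?S Q" for s
    proof -
      have "s \<in> ?S" using s splitting_subset by blast
      then show ?thesis using k_profile_orient[OF kp[OF P], of s] S S_sinv[OF s] by auto
    qed
    then show "orients P (splitting G ?S Q)"
      using consistent_antisymmetric[OF con[OF P]] unfolding orients_def by blast
  next
    fix P P' assume PP: "P \<in> ?PP" "P' \<in> ?PP" "P \<noteq> P'"
    have "\<exists>s\<in>?S. distinguishes s P P'"
    proof (rule level_nested_ex[OF N _ kp[OF PP(1)] kp[OF PP(2)] PP(3) eqN[OF PP(1,2)] eqm[OF PP(1,2)]])
      fix t assume "t \<in> N"
      then show "\<exists>Q Q'. k_profile G (Suc m) Q \<and> k_profile G (Suc m) Q' \<and>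
          distinguishes t Q Q' \<and> restrict_profile (sorder t) Q = restrict_profile (sorder t) Q'"
        using wit prof by meson
    qed
    then show "\<exists>s\<in>splitting G ?S Q. distinguishes s P P'"
      using split[OF PP(1,2)] by blast
  next
    fix P P' s t assume PP: "P \<in> ?PP" "P' \<in> ?PP"
      and st: "s \<in> splitting G ?S Q" "t \<in> splitting G ?S Q"
      and *: "\<not> nested_sep s t \<and> s \<in> P \<and> t \<in> P \<and> sinv s \<in> P' \<and> sinv t \<in> P'"
    have sS: "s \<in> ?S" and tS: "t \<in> ?S" using st splitting_subset by blast+
    note kP = kp[OF PP(1)] kp[OF PP(2)]
    note cP = con[OF PP(1)] con[OF PP(2)]
    \<comment> \<open>A smaller meet would lie in \<open>P\<close>, hence in \<open>P'\<close>,
      which contains \<open>sinv s\<close> and \<open>sinv t\<close> and so the inverse of the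
      meet.\<close>
    have "\<not> sorder (smeet s t) < m"
    proof
      assume o: "sorder (smeet s t) < m"
      have sepm: "separation G (smeet s t)" using separation_smeet S(1) sS tS by blast
      have "smeet s t \<in> P"
        using k_profile_down[OF kP(1), of s "smeet s t"] * o sepm by simp
      then have "smeet s t \<in> restrict_profile m P"
        using o by (simp add: restrict_profile_def)
      then have "smeet s t \<in> P'"
        unfolding eqm[OF PP] by (simp add: restrict_profile_def)
      moreover have "sjoin (sinv s) (sinv t) \<in> P'"
        by (rule k_profile_sjoin[OF kP(2)]) (use * o in \<open>simp_all flip: sinv_smeet\<close>)
      ultimately show False
        using consistent_sinvD[OF cP(2)] unfolding sinv_smeet[symmetric] by blast
    qed
    then have om: "sorder (sjoin s t) \<le> m"
      using sorder_submodular[OF S(1)[OF sS] S(1)[OF tS]] S(3)[OF sS] S(3)[OF tS] by linarith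
    have in': "sjoin s t \<in> P" "sinv (sjoin s t) \<in> P'"
      using level_corner[OF kP, of s t] * om by blast+
    have d: "distinguishes (sjoin s t) P P'" by (rule distinguishesI[OF cP in'])
    have "\<not> sorder (sjoin s t) < m"
    proof
      assume "sorder (sjoin s t) < m"
      then have "sjoin s t \<in> restrict_profile m P'"
        using in'(1) unfolding eqm[OF PP, symmetric] by (simp add: restrict_profile_def)
      then have "sjoin s t \<in> P'" by (simp add: restrict_profile_def)
      then show False using in'(2) consistent_sinvD[OF cP(2)] by blast
    qed
    moreover have "nested_sep (sjoin s t) u" if "u \<in> N" for u
      using nested_sjoin_crossing[of u s t] * S(5)[OF sS that] S(5)[OF tS that] nested_sep_sym by blast
    ultimately have "sjoin s t \<in> ?S"
      using distinguishes_proper[OF cP d] om unfolding level_seps_def nested_with_def by simp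
    then have "sjoin s t \<in> splitting G ?S Q" using split[OF PP _ d] by blast
    then show "\<exists>e\<in>P \<inter> splitting G ?S Q. s \<preceq> e \<and> t \<preceq> e"
      using in'(1) sjoin_upper by blast
  qed
qed

section \<open>The separations chosen by a \<open>k\<close>-strategy\<close>

text \<open>The quantification over \<open>w\<close> records that, when \<open>u\<close> is chosen, it is nested with every
  competitor for distinguishing \<open>P\<close> from \<open>P'\<close>; it is what rules out coinciding parts.\<close>

definition efficient_system :: "nat \<Rightarrow> 'a sep set set \<Rightarrow> 'a sep set \<Rightarrow> bool" where
  "efficient_system k \<P> N \<longleftrightarrow> nested_set N \<and>
     (\<forall>u\<in>N. separation G u \<and> proper_sep u \<and> sorder u < k \<and> sinv u \<in> N) \<and>
     (\<forall>u\<in>N. \<exists>P\<in>\<P>. \<exists>P'\<in>\<P>. distinguishes u P P' \<and>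
        restrict_profile (sorder u) P = restrict_profile (sorder u) P' \<and>
        (\<forall>w. sorder w = sorder u \<and> nested_with w {t \<in> N. sorder t < sorder u} \<and> distinguishes w P P' \<longrightarrow>
           nested_sep u w)) \<and>
     (\<forall>P\<in>\<P>. \<forall>P'\<in>\<P>. P \<noteq> P' \<longrightarrow> (\<exists>u\<in>N. distinguishes u P P'))"

lemma efficient_systemD:
  assumes "efficient_system k \<P> N"
  shows "nested_set N"
    and "\<And>u. u \<in> N \<Longrightarrow> separation G u \<and> proper_sep u \<and> sorder u < k \<and> sinv u \<in> N"
  using assms unfolding efficient_system_def by simp_all

text \<open>Only separations of order below \<open>m\<close> occur, and on these a profile agrees
  with its restriction; so witnesses found among the restrictions lift to members of \<P>.\<close>

lemma efficient_system_lift: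
  assumes e: "efficient_system m (restrict_profile m ` \<P>) N"
  shows "u \<in> N \<Longrightarrow> \<exists>P\<in>\<P>. \<exists>P'\<in>\<P>. distinguishes u P P' \<and>
        restrict_profile (sorder u) P = restrict_profile (sorder u) P' \<and>
        (\<forall>w. sorder w = sorder u \<and> nested_with w {t \<in> N. sorder t < sorder u} \<and> distinguishes w P P' \<longrightarrow>
           nested_sep u w)"
    and "P \<in> \<P> \<Longrightarrow> P' \<in> \<P> \<Longrightarrow> restrict_profile m P \<noteq> restrict_profile m P' \<Longrightarrow>
        \<exists>t\<in>N. distinguishes t P P'"
proof -
  note N = efficient_systemD[OF e]
  show "\<exists>P\<in>\<P>. \<exists>P'\<in>\<P>. distinguishes u P P' \<and>
        restrict_profile (sorder u) P = restrict_profile (sorder u) P' \<and>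
        (\<forall>w. sorder w = sorder u \<and> nested_with w {t \<in> N. sorder t < sorder u} \<and> distinguishes w P P' \<longrightarrow>
           nested_sep u w)" if u: "u \<in> N"
  proof -
    have o: "sorder u < m" using N(2)[OF u] by blast
    obtain P P' where P: "P \<in> \<P>" "P' \<in> \<P>" "distinguishes u (restrict_profile m P) (restrict_profile m P')"
      "restrict_profile (sorder u) (restrict_profile m P) = restrict_profile (sorder u) (restrict_profile m P')"
      "\<forall>w. sorder w = sorder u \<and> nested_with w {t \<in> N. sorder t < sorder u} \<and>
         distinguishes w (restrict_profile m P) (restrict_profile m P') \<longrightarrow> nested_sep u w"
      using e u unfolding efficient_system_def by blast
    show ?thesis
    proof (rule bexI[OF _ P(1)], rule bexI[OF _ P(2)], intro conjI allI impI)
      show "distinguishes u P P'" using P(3) distinguishes_restrict[OF o] by blast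
      show "restrict_profile (sorder u) P = restrict_profile (sorder u) P'"
        using P(4) o by (simp add: restrict_restrict)
      fix w assume "sorder w = sorder u \<and> nested_with w {t \<in> N. sorder t < sorder u} \<and> distinguishes w P P'"
      then have "sorder w = sorder u" "nested_with w {t \<in> N. sorder t < sorder u}"
        "distinguishes w (restrict_profile m P) (restrict_profile m P')"
        using distinguishes_restrict[of w m P P'] o by simp_all
      then show "nested_sep u w" using P(5) by blast
    qed
  qed
  show "\<exists>t\<in>N. distinguishes t P P'"
    if P: "P \<in> \<P>" "P' \<in> \<P>" "restrict_profile m P \<noteq> restrict_profile m P'"
  proof -
    have "\<exists>t\<in>N. distinguishes t (restrict_profile m P) (restrict_profile m P')"
      using e[unfolded efficient_system_def, THEN conjunct2, THEN conjunct2, THEN conjunct2] P by blast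
    then obtain t where t: "t \<in> N" "distinguishes t (restrict_profile m P) (restrict_profile m P')"
      by blast
    then show ?thesis using distinguishes_restrict[of t m P P'] N(2)[OF t(1)] by blast
  qed
qed

lemma level_task_feasible:
  assumes e: "efficient_system m (restrict_profile m ` \<P>) N"
    and prof: "\<And>P. P \<in> \<P> \<Longrightarrow> k_profile G (Suc m) P"
  shows "feasible (splitting G (level_seps m N) Q) (inducing \<P> N Q)"
proof (rule level_feasible[OF _ efficient_systemD(1)[OF e] _ _ prof _ efficient_system_lift(2)[OF e]])
  show "finite N"
    by (rule finite_subset[OF _ finite_separations]) (use efficient_systemD(2)[OF e] in blast)
qed (use efficient_systemD(2)[OF e] efficient_system_lift(1)[OF e] in blast)+

text \<open>A competitor of a new \<open>u\<close> has order \<open>m\<close> and is nested with all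
  of \<open>N\<close>; as it distinguishes two profiles that induce \<open>Q\<close>, it splits
  \<open>Q\<close> and so belongs to the task handed to the strategy, where
  \<open>N_strat_witness\<close> applies. For \<open>u\<close> in \<open>N\<close> nothing changes:
  all added separations have order \<open>m\<close>, while only orders below that of
  \<open>u\<close> are mentioned.\<close>

lemma efficient_system_level:
  assumes e: "efficient_system m (restrict_profile m ` \<P>) N"
    and prof: "\<And>P. P \<in> \<P> \<Longrightarrow> k_profile G (Suc m) P"
    and \<sigma>: "range \<sigma> \<subseteq> reduced_ops"
  shows "efficient_system (Suc m) \<P>
     (N \<union> (\<Union>Q\<in>consistent_orientations G N. N_strat G \<sigma> (splitting G (level_seps m N) Q) (inducing \<P> N Q)))"
    (is "efficient_system _ _ (N \<union> (\<Union>Q\<in>_. ?M Q))")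
proof -
  let ?S = "level_seps m N" and ?U = "\<Union>Q\<in>consistent_orientations G N. ?M Q"
  note N = efficient_systemD[OF e]
  note witN = efficient_system_lift(1)[OF e] and distN = efficient_system_lift(2)[OF e]
  note f = level_task_feasible[OF e prof]
  note sys = N_strat_system[OF f \<sigma>]
  have US: "?U \<subseteq> ?S"
    using sys splitting_subset by blast
  have S: "separation G u" "proper_sep u" "sorder u = m" "nested_with u N" if "u \<in> ?S" for u
    using that by (simp_all add: level_seps_def)
  have less: "{t \<in> N \<union> ?U. sorder t < l} = {t \<in> N. sorder t < l}" if "l \<le> m" for l
    using S(3) US that by fastforce
  show ?thesis
    unfolding efficient_system_def
  proof (intro conjI ballI impI)
    show "nested_set (N \<union> ?U)"
      by (rule nested_splitting_union[where S = ?S]) (use N S(4) sys in blast)+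
  next
    fix u assume u: "u \<in> N \<union> ?U"
    show "separation G u" "proper_sep u" "sorder u < Suc m"
      using u N(2)[of u] S[of u] US by (auto simp: less_Suc_eq)
    show "sinv u \<in> N \<union> ?U"
      using u N(2)[of u] sys by blast
    show "\<exists>P\<in>\<P>. \<exists>P'\<in>\<P>. distinguishes u P P' \<and>
        restrict_profile (sorder u) P = restrict_profile (sorder u) P' \<and>
        (\<forall>w. sorder w = sorder u \<and> nested_with w {t \<in> N \<union> ?U. sorder t < sorder u} \<and> distinguishes w P P' \<longrightarrow>
           nested_sep u w)"
    proof (cases "u \<in> N")
      case True
      have "sorder u \<le> m" using N(2)[OF True] by simp
      show ?thesis using witN[OF True] unfolding less[OF \<open>sorder u \<le> m\<close>] .
    next
      case False
      then obtain Q where Q: "Q \<in> consistent_orientations G N" "u \<in> ?M Q" using u by blast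
      then have um: "sorder u = m" using S(3) US by blast
      obtain P P' where P: "P \<in> inducing \<P> N Q" "P' \<in> inducing \<P> N Q" "distinguishes u P P'"
        "\<forall>w\<in>splitting G ?S Q. distinguishes w P P' \<longrightarrow> nested_sep u w"
        using N_strat_witness[OF f \<sigma> Q(2)] by blast
      have PP: "P \<in> \<P>" "P' \<in> \<P>" "Q \<subseteq> P" "Q \<subseteq> P'" "P \<inter> N = P' \<inter> N"
        using P(1,2) by (auto simp: inducing_def)
      have c: "consistent G P" "consistent G P'"
        using prof PP k_profile_consistent by blast+
      have "restrict_profile m P = restrict_profile m P'"
      proof (rule ccontr)
        assume "\<not> ?thesis"
        then obtain t where "t \<in> N" "distinguishes t P P'" using distN PP by blast
        then show False using PP(5) N(2)[of t] unfolding distinguishes_def by blast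
      qed
      moreover have "nested_sep u w"
        if w: "sorder w = m" "nested_with w {t \<in> N \<union> ?U. sorder t < m}" "distinguishes w P P'" for w
      proof -
        have "nested_with w N" using w(2) N(2) unfolding less[OF order_refl] nested_with_def by blast
        then have "w \<in> ?S"
          using w distinguishes_proper[OF c w(3)] unfolding level_seps_def by blast
        then show ?thesis
          using P(4) w(3) splits_if_distinguishes[OF c PP(3,4) w(3)] unfolding splitting_def by blast
      qed
      ultimately show ?thesis
        using PP(1,2) P(3) unfolding um by blast
    qed
  next
    fix P P' assume PP: "P \<in> \<P>" "P' \<in> \<P>" "P \<noteq> P'"
    show "\<exists>u\<in>N \<union> ?U. distinguishes u P P'"
    proof (cases "restrict_profile m P = restrict_profile m P'")
      case False then show ?thesis using distN PP by blast
    next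
      case True
      have orP: "t \<in> P \<or> sinv t \<in> P" if "P \<in> \<P>" "t \<in> N" for t P
        using k_profile_orient[OF prof[OF that(1)], of t] N(2)[OF that(2)] by auto
      have "consistent G (P \<inter> N)"
        using k_profile_consistent[OF prof[OF PP(1)]] consistent_subset by blast
      moreover have "t \<in> P \<inter> N \<or> sinv t \<in> P \<inter> N \<inter> N" if "t \<in> N" for t
        using orP[OF PP(1) that] N(2)[OF that] that by blast
      ultimately have Q: "P \<inter> N \<in> consistent_orientations G N"
        using consistent_antisymmetric unfolding consistent_orientations_def orients_def by blast
      have "t \<in> P \<longleftrightarrow> t \<in> P'" if "t \<in> N" for t
      proof -
        have "t \<in> restrict_profile m P \<longleftrightarrow> t \<in> restrict_profile m P'" using True by simp
        then show ?thesis using N(2)[OF that] by (simp add: restrict_profile_def)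
      qed
      then have "P' \<inter> N = P \<inter> N" by blast
      then have "P \<in> inducing \<P> N (P \<inter> N)" "P' \<in> inducing \<P> N (P \<inter> N)"
        using PP by (simp_all add: inducing_def)
      then show ?thesis
        using N_strat_distinguishes[OF f \<sigma> _ _ PP(3)] Q by blast
    qed
  qed
qed

lemma consistent_orientations_empty: "consistent_orientations G {} = {{}}"
  by (auto simp: consistent_orientations_def orients_def antisymmetric_seps_def consistent_iff)

lemma splitting_empty: "splitting G (level_seps m N) {} = level_seps m N"
proof -
  have "splits G s {}" if "s \<in> level_seps m N" for s
    using that proper_not_sle_sinv[of s]
    by (simp add: splits_def consistent_iff level_seps_def)
  then show ?thesis unfolding splitting_def by blast
qed

text \<open>Written as a union over the orientations of the empty system, so that the base case is
  the step with \<open>m = 0\<close>.\<close>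

lemma N_kstrat_1:
  "N_kstrat G [\<sigma>] \<P> = {} \<union> (\<Union>Q\<in>consistent_orientations G {}.
     N_strat G \<sigma> (splitting G (level_seps 0 {}) Q) (inducing \<P> {} Q))"
proof -
  have "inducing \<P> {} {} = \<P>" by (simp add: inducing_def)
  moreover have "level_seps 0 {} = {s. separation G s \<and> proper_sep s \<and> sorder s < 1}"
    by (simp add: level_seps_def nested_with_def)
  ultimately show ?thesis
    using splitting_empty[of 0 "{}"] by (simp add: N_kstrat.simps consistent_orientations_empty)
qed

lemma N_kstrat_snoc:
  assumes "\<Sigma> \<noteq> []" and N: "N = N_kstrat G \<Sigma> (restrict_profile (length \<Sigma>) ` \<P>)"
  shows "N_kstrat G (\<Sigma> @ [\<sigma>]) \<P> = N \<union> (\<Union>Q\<in>consistent_orientations G N.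
     N_strat G \<sigma> (splitting G (level_seps (length \<Sigma>) N) Q) (inducing \<P> N Q))"
  using assms(1) by (subst N_kstrat.simps) (simp add: N level_seps_def Let_def)

theorem N_kstrat_efficient:
  assumes "\<Sigma> \<noteq> []" "\<And>\<sigma>. \<sigma> \<in> set \<Sigma> \<Longrightarrow> range \<sigma> \<subseteq> reduced_ops"
    and "\<And>P. P \<in> \<P> \<Longrightarrow> k_profile G (length \<Sigma>) P"
  shows "efficient_system (length \<Sigma>) \<P> (N_kstrat G \<Sigma> \<P>)"
  using assms
proof (induction \<Sigma> arbitrary: \<P> rule: rev_nonempty_induct)
  case (single \<sigma>)
  have "restrict_profile 0 P = {}" for P :: "'a sep set" by (simp add: restrict_profile_def)
  then have "efficient_system 0 (restrict_profile 0 ` \<P>) {}"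
    unfolding efficient_system_def nested_set_def by auto
  then have "efficient_system (Suc 0) \<P> (N_kstrat G [\<sigma>] \<P>)"
    unfolding N_kstrat_1 by (rule efficient_system_level) (use single in auto)
  then show ?case by simp
next
  case (snoc \<sigma> \<Sigma>)
  let ?N = "N_kstrat G \<Sigma> (restrict_profile (length \<Sigma>) ` \<P>)"
  have k: "k_profile G (Suc (length \<Sigma>)) P" if "P \<in> \<P>" for P
    using snoc.prems(2)[OF that] by simp
  have "efficient_system (length \<Sigma>) (restrict_profile (length \<Sigma>) ` \<P>) ?N"
    by (rule snoc.IH) (use snoc.prems k_profile_restrict[OF k] in auto)
  then have "efficient_system (Suc (length \<Sigma>)) \<P> (N_kstrat G (\<Sigma> @ [\<sigma>]) \<P>)"
    unfolding N_kstrat_snoc[OF snoc.hyps(1) refl]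
    by (rule efficient_system_level) (use snoc.prems k in auto)
  then show ?case by simp
qed

end

section \<open>Consistent orientations of a nested system\<close>

text \<open>For \<open>Q = {}\<close>, the only node of a trivial tree, this is the whole vertex
  set.\<close>

definition part_of :: "'a pair_pre_digraph \<Rightarrow> 'a sep set \<Rightarrow> 'a set" where
  "part_of G Q = {x \<in> pverts G. \<forall>s\<in>Q. x \<in> snd s}"

text \<open>Passing from the node \<open>Q\<close> across the tree edge \<open>u\<close>; meaningful
  when \<open>u\<close> is maximal in \<open>Q\<close>.\<close>

definition flip :: "'a sep \<Rightarrow> 'a sep set \<Rightarrow> 'a sep set" where
  "flip u Q = insert (sinv u) (Q - {u})"

locale nested_system = pair_graph +
  fixes N :: "'a sep set"
  assumes nested: "nested_set N"
    and N_sep: "\<And>u. u \<in> N \<Longrightarrow> separation G u"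
    and N_proper: "\<And>u. u \<in> N \<Longrightarrow> proper_sep u"
    and N_sinv: "\<And>u. u \<in> N \<Longrightarrow> sinv u \<in> N"
begin

abbreviation orientations :: "'a sep set set" where
  "orientations \<equiv> consistent_orientations G N"

lemma finite_N: "finite N"
  by (rule finite_subset[OF _ finite_separations]) (use N_sep in blast)

lemma N_nested: "s \<in> N \<Longrightarrow> t \<in> N \<Longrightarrow> nested_sep s t"
  using nested by (simp add: nested_set_def)

lemma orientation_iff:
  "Q \<in> orientations \<longleftrightarrow> Q \<subseteq> N \<and> consistent G Q \<and> (\<forall>s\<in>N. s \<in> Q \<or> sinv s \<in> Q)"
  using consistent_antisymmetric[of Q] N_sinv
  unfolding consistent_orientations_def orients_def by blast

lemma orientationD:
  assumes "Q \<in> orientations"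
  shows "Q \<subseteq> N" "consistent G Q" "\<And>s. s \<in> Q \<Longrightarrow> s \<in> N" "\<And>s. s \<in> N \<Longrightarrow> s \<notin> Q \<Longrightarrow> sinv s \<in> Q"
    "\<And>s. s \<in> Q \<Longrightarrow> sinv s \<notin> Q"
  using assms consistent_sinvD unfolding orientation_iff by blast+

lemma orientation_down:
  assumes "Q \<in> orientations" "s \<in> Q" "t \<in> N" "t \<preceq> s" shows "t \<in> Q"
  using orientationD(4)[OF assms(1,3)] consistent_downD[OF orientationD(2)[OF assms(1)] assms(2,4)] by blast

lemma finite_orientation: "Q \<in> orientations \<Longrightarrow> finite Q"
  using finite_N finite_subset orientationD(1) by blast

text \<open>Of the four ways of being nested, consistency and the maximality of \<open>u\<close>
  leave these two.\<close>

lemma maximal_cases: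
  assumes Q: "Q \<in> orientations" and u: "u \<in> maximal_seps Q" and t: "t \<in> Q"
  shows "t \<preceq> u \<or> t \<preceq> sinv u"
proof -
  have "nested_sep t u" using N_nested orientationD(3)[OF Q] maximal_in[OF u] t by blast
  then show ?thesis
    using consistent_nestedD[OF orientationD(2)[OF Q] t maximal_in[OF u]] maximal_eq[OF u t] sle_refl
    by metis
qed

text \<open>An oriented edge has only one head. An element of \<open>Q\<close> below
  \<open>u\<close> is in \<open>Q'\<close> by downward closure; one below \<open>sinv u\<close> has
  \<open>u\<close> below its inverse, so that its inverse could be in \<open>Q'\<close> only by
  being \<open>u\<close>.\<close>

lemma maximal_unique:
  assumes Q: "Q \<in> orientations" "Q' \<in> orientations" and u: "u \<in> maximal_seps Q" "u \<in> maximal_seps Q'"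
  shows "Q = Q'"
proof -
  have *: "Q \<subseteq> Q'" if Q: "Q \<in> orientations" "Q' \<in> orientations"
    and u: "u \<in> maximal_seps Q" "u \<in> maximal_seps Q'" for Q Q'
  proof
    fix t assume t: "t \<in> Q"
    have tN: "t \<in> N" using orientationD(3)[OF Q(1) t] .
    show "t \<in> Q'"
    proof (rule ccontr)
      assume "t \<notin> Q'"
      then have t': "sinv t \<in> Q'" using orientationD(4)[OF Q(2) tN] by blast
      have "\<not> t \<preceq> u" using orientation_down[OF Q(2) maximal_in[OF u(2)] tN] \<open>t \<notin> Q'\<close> by blast
      then have 1: "t \<preceq> sinv u" using maximal_cases[OF Q(1) u(1) t] by blast
      then have "u \<preceq> sinv t" using sle_sinv_iff' by blast
      then have "sinv t = u" using maximal_eq[OF u(2) t'] by blast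
      then show False using maximal_in[OF u(1)] orientationD(5)[OF Q(1) t] by simp
    qed
  qed
  show ?thesis using *[OF Q u] *[OF Q(2,1) u(2,1)] by blast
qed

lemma sinv_neq: "u \<in> N \<Longrightarrow> sinv u \<noteq> u"
  using proper_not_sle_sinv[OF N_proper[of u]] by force

text \<open>A violation involving \<open>sinv u\<close> amounts to \<open>u \<preceq> t\<close> for
  another element \<open>t\<close>, against maximality. The new element is maximal because
  consistency of \<open>Q\<close> excludes \<open>sinv u \<preceq> t\<close>.\<close>

lemma flip_orientation:
  assumes Q: "Q \<in> orientations" and u: "u \<in> maximal_seps Q"
  shows "flip u Q \<in> orientations" "sinv u \<in> maximal_seps (flip u Q)"
proof -
  have uQ: "u \<in> Q" and uN: "u \<in> N" using maximal_in[OF u] orientationD(3)[OF Q] by blast+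
  note c = orientationD(2)[OF Q]
  have up: "\<not> u \<preceq> t" if "t \<in> Q - {u}" for t
    using maximal_eq[OF u, of t] that by blast
  have "\<not> sinv t \<preceq> s" if st: "s \<in> flip u Q" "t \<in> flip u Q" for s t
  proof -
    consider "s \<in> Q" "t \<in> Q" | "s = sinv u" "t = sinv u" | "s = sinv u" "t \<in> Q - {u}"
      | "s \<in> Q - {u}" "t = sinv u"
      using st unfolding flip_def by blast
    then show ?thesis
    proof cases
      case 1 then show ?thesis using consistentD[OF c] by blast
    next
      case 2 then show ?thesis using proper_not_sle_sinv[OF N_proper[OF uN]] by simp
    next
      case 3 then show ?thesis using up by simp
    next
      case 4 then show ?thesis using up by simp
    qed
  qed
  moreover have "flip u Q \<subseteq> N"
    using orientationD(1)[OF Q] N_sinv[OF uN] unfolding flip_def by blast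
  moreover have "s \<in> flip u Q \<or> sinv s \<in> flip u Q" if s: "s \<in> N" for s
  proof (cases "s \<in> Q")
    case True then show ?thesis unfolding flip_def by blast
  next
    case False
    then have "sinv s \<in> Q" using orientationD(4)[OF Q s] by blast
    then show ?thesis unfolding flip_def by (cases "sinv s = u") (simp_all flip: sinv_eq_iff)
  qed
  ultimately show "flip u Q \<in> orientations"
    using N_sep unfolding orientation_iff consistent_iff by blast
  have "\<not> sinv u \<preceq> t" if "t \<in> Q" for t
    using consistentD[OF c that uQ] .
  then show "sinv u \<in> maximal_seps (flip u Q)"
    unfolding maximal_seps_def flip_def by blast
qed

text \<open>Together with \<open>flip_orientation\<close>, adjacency can be recognised from the two
  orientations alone.\<close>

lemma maximal_if_flip:
  assumes Q: "Q \<in> orientations" and f: "flip u Q \<in> orientations" and u: "u \<in> Q"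
  shows "u \<in> maximal_seps Q"
proof -
  have "t = u" if t: "t \<in> Q" "u \<preceq> t" for t
  proof (rule ccontr)
    assume "t \<noteq> u"
    then have "t \<in> flip u Q" "sinv u \<in> flip u Q" using t unfolding flip_def by blast+
    then show False
      using consistent_downD[OF orientationD(2)[OF f] _ t(2)] by blast
  qed
  then show ?thesis using u unfolding maximal_seps_def by blast
qed

lemma ex_maximal_orientation:
  assumes u: "u \<in> N" shows "\<exists>Q\<in>orientations. u \<in> maximal_seps Q"
proof -
  \<comment> \<open>Each separation gets the orientation that is below \<open>u\<close> or below
    \<open>sinv u\<close>; \<open>sinv u\<close> meets the second condition by reflexivity and is
    taken out.\<close>
  define Q where "Q = {t \<in> N. t \<noteq> sinv u \<and> (t \<preceq> u \<or> t \<preceq> sinv u)}"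
  note p = proper_not_sle_sinv[OF N_proper[OF u]]
  have "\<not> sinv t \<preceq> s" if st: "s \<in> Q" "t \<in> Q" for s t
  proof
    assume le: "sinv t \<preceq> s"
    have ne: "s \<noteq> sinv u" "t \<noteq> sinv u" using st by (simp_all add: Q_def)
    consider "s \<preceq> u" "t \<preceq> u" | "s \<preceq> u" "t \<preceq> sinv u" | "s \<preceq> sinv u" "t \<preceq> u"
      | "s \<preceq> sinv u" "t \<preceq> sinv u"
      using st unfolding Q_def by blast
    then show False
    proof cases
      case 1
      then have "sinv u \<preceq> sinv t" by simp
      then show False using p 1 le sle_trans by blast
    next
      case 2
      then have "u \<preceq> sinv t" using sle_sinv_iff' by blast
      then have "sinv t = u" using 2 le sle_trans sle_antisym by blast
      then show False using ne(2) by force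
    next
      case 3
      then have "sinv u \<preceq> sinv t" by simp
      then have "s = sinv u" using 3 le sle_trans sle_antisym by blast
      then show False using ne(1) by blast
    next
      case 4
      then have "u \<preceq> sinv t" using sle_sinv_iff' by blast
      then show False using 4 le p sle_trans by blast
    qed
  qed
  moreover have "s \<in> Q \<or> sinv s \<in> Q" if s: "s \<in> N" for s
  proof -
    have "s \<preceq> u \<or> s \<preceq> sinv u \<or> sinv s \<preceq> u \<or> sinv s \<preceq> sinv u"
      using N_nested[OF s u] unfolding nested_sep_def by (metis sinv_sle_sinv sle_sinv_iff)
    moreover have "s = sinv u \<Longrightarrow> sinv s = u" "sinv s = sinv u \<Longrightarrow> s = u" by (metis swap_swap)+
    ultimately show ?thesis
      using s N_sinv[OF s] u sinv_neq[OF u] sle_refl unfolding Q_def by (metis (mono_tags, lifting) mem_Collect_eq)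
  qed
  moreover have "Q \<subseteq> N" by (auto simp: Q_def)
  ultimately have "Q \<in> orientations"
    using N_sep unfolding orientation_iff consistent_iff by blast
  moreover have "t = u" if t: "t \<in> Q" "u \<preceq> t" for t
  proof -
    have "\<not> t \<preceq> sinv u" using p(1) sle_trans[OF t(2)] by blast
    then have "t \<preceq> u" using t(1) unfolding Q_def by blast
    then show ?thesis using t(2) by (rule sle_antisym)
  qed
  moreover have "u \<in> Q"
    using u sinv_neq[OF u] unfolding Q_def by force
  ultimately have "Q \<in> orientations" "u \<in> maximal_seps Q"
    unfolding maximal_seps_def by blast+
  then show ?thesis by blast
qed

text \<open>In a maximal consistent superset, \<open>s\<close> and \<open>sinv s\<close> can both be
  missing only if elements \<open>t\<close> and \<open>t'\<close> block them, and then
  \<open>sinv t \<preceq> s \<preceq> t'\<close> contradicts consistency.\<close>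

lemma orientation_extends:
  assumes "F \<subseteq> N" "consistent G F"
  shows "\<exists>Q\<in>orientations. F \<subseteq> Q"
proof -
  let ?C = "{Q. F \<subseteq> Q \<and> Q \<subseteq> N \<and> consistent G Q}"
  have "finite ?C" by (rule finite_subset[of _ "Pow N"]) (auto simp: finite_N)
  moreover have "F \<in> ?C" using assms by blast
  ultimately have "\<exists>Q\<in>?C. F \<subseteq> Q \<and> (\<forall>Q'\<in>?C. Q \<subseteq> Q' \<longrightarrow> Q = Q')"
    by (rule finite_has_maximal2)
  then obtain Q where "Q \<in> ?C" and Qmax: "\<forall>Q'\<in>?C. Q \<subseteq> Q' \<longrightarrow> Q = Q'"
    by (elim bexE conjE)
  then have Q: "F \<subseteq> Q" "Q \<subseteq> N" "consistent G Q" by simp_all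
  have ins: "\<exists>t\<in>Q. sinv t \<preceq> s" if s: "s \<in> N" "s \<notin> Q" for s
  proof (rule ccontr)
    assume *: "\<not> (\<exists>t\<in>Q. sinv t \<preceq> s)"
    have **: "\<not> sinv s \<preceq> t" if "t \<in> Q" for t using * that sle_sinv_iff by blast
    have "\<not> sinv t \<preceq> t'" if tt: "t \<in> insert s Q" "t' \<in> insert s Q" for t t'
    proof -
      consider "t = s" "t' = s" | "t = s" "t' \<in> Q" | "t \<in> Q" "t' = s" | "t \<in> Q" "t' \<in> Q"
        using tt by blast
      then show ?thesis
      proof cases
        case 1 then show ?thesis using proper_not_sle_sinv[OF N_proper[OF s(1)]] by blast
      next
        case 4 then show ?thesis using consistentD[OF Q(3)] by blast
      qed (use * ** in blast)+
    qed
    then have "consistent G (insert s Q)"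
      using consistent_sepD[OF Q(3)] N_sep[OF s(1)] unfolding consistent_iff by blast
    then have "insert s Q \<in> ?C" using Q s(1) by blast
    then have "Q = insert s Q" using Qmax by blast
    then show False using s(2) by blast
  qed
  have "s \<in> Q \<or> sinv s \<in> Q" if s: "s \<in> N" for s
  proof (rule ccontr)
    assume "\<not> ?thesis"
    then obtain t t' where t: "t \<in> Q" "sinv t \<preceq> s" "t' \<in> Q" "sinv t' \<preceq> sinv s"
      using ins[of s] ins[of "sinv s"] s N_sinv[OF s] by blast
    then have "s \<preceq> t'" by simp
    with t(2) have "sinv t \<preceq> t'" by (rule sle_trans)
    then show False using consistentD[OF Q(3) t(3,1)] by blast
  qed
  then have "Q \<in> orientations" using Q unfolding orientation_iff by blast
  then show ?thesis using Q(1) by blast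
qed

text \<open>In tree terms, the first edge on the way from \<open>Q\<close> to \<open>Q'\<close>. A
  maximal element above a disputed one is disputed as well, because \<open>Q'\<close> is closed
  downwards.\<close>

lemma ex_maximal_diff:
  assumes Q: "Q \<in> orientations" "Q' \<in> orientations" "Q \<noteq> Q'"
  shows "\<exists>u\<in>maximal_seps Q. u \<notin> Q'"
proof -
  obtain t where t: "t \<in> Q" "sinv t \<in> Q'" using orientations_differ[OF Q] by blast
  obtain u where u: "u \<in> maximal_seps Q" "t \<preceq> u"
    using ex_maximal_above[OF finite_orientation[OF Q(1)] t(1)] by blast
  have "u \<notin> Q'"
    using consistent_downD[OF orientationD(2)[OF Q(2)] _ u(2)] t(2) by blast
  then show ?thesis using u by blast
qed

lemma part_of_iff: "x \<in> part_of G Q \<longleftrightarrow> x \<in> pverts G \<and> (\<forall>s\<in>Q. x \<in> snd s)"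
  by (simp add: part_of_def)

lemma part_of_iff_maximal:
  assumes "Q \<in> orientations"
  shows "x \<in> part_of G Q \<longleftrightarrow> x \<in> pverts G \<and> (\<forall>s\<in>maximal_seps Q. x \<in> snd s)"
  using ex_maximal_above[OF finite_orientation[OF assms]] maximal_in
  unfolding part_of_iff sle_def by blast

text \<open>Elements of \<open>Q\<close> lie below \<open>u\<close> or \<open>sinv u\<close>, so
  their second sides contain a side of \<open>u\<close> and thus its separator.\<close>

lemma maximal_separator_subset:
  assumes Q: "Q \<in> orientations" and u: "u \<in> maximal_seps Q"
  shows "fst u \<inter> snd u \<subseteq> part_of G Q"
proof
  fix x assume x: "x \<in> fst u \<inter> snd u"
  have "x \<in> snd t" if "t \<in> Q" for t
    using maximal_cases[OF Q u that] x unfolding sle_def by auto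
  moreover have "x \<in> pverts G"
    using x separation_subset(1)[OF N_sep[OF orientationD(3)[OF Q maximal_in[OF u]]]] by blast
  ultimately show "x \<in> part_of G Q" by (simp add: part_of_iff)
qed

text \<open>Seen from \<open>Q\<close> the common part lies in \<open>snd u\<close>, seen from
  \<open>Q'\<close> in \<open>fst u\<close>. For maximal \<open>u\<close> it is therefore equal to
  the separator of \<open>u\<close>.\<close>

lemma separator_eq_if_parts_eq:
  assumes Q: "Q \<in> orientations" "Q' \<in> orientations" "part_of G Q = part_of G Q'"
    and u: "u \<in> Q" "u \<notin> Q'"
  shows "part_of G Q \<subseteq> fst u \<inter> snd u"
proof -
  have "sinv u \<in> Q'" using orientationD(4)[OF Q(2) orientationD(3)[OF Q(1) u(1)] u(2)] .
  then have "part_of G Q' \<subseteq> snd (sinv u)" unfolding part_of_def by blast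
  then have "part_of G Q' \<subseteq> fst u" by simp
  moreover have "part_of G Q \<subseteq> snd u" using u unfolding part_of_def by blast
  ultimately show ?thesis using Q(3) by blast
qed

end

lemma (in pair_graph) efficient_nested_system:
  "efficient_system k \<P> N \<Longrightarrow> nested_system G N"
  by unfold_locales (simp_all add: efficient_system_def)

section \<open>Distinct orientations have distinct parts\<close>

context pair_graph
begin

lemma separation_eqI:
  assumes "separation G s" "separation G t" "fst s = fst t" "fst s \<inter> snd s = fst t \<inter> snd t"
  shows "s = t"
proof -
  have "snd s = (pverts G - fst s) \<union> (fst s \<inter> snd s)" "snd t = (pverts G - fst t) \<union> (fst t \<inter> snd t)"
    using assms(1,2) separation_Un[of s] separation_Un[of t] by blast+
  then show ?thesis using assms(3,4) by (simp add: prod_eq_iff)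
qed

lemma k_profile_small:
  assumes P: "k_profile G k P" and X: "X \<subseteq> pverts G" "card X < k"
  shows "(X, pverts G) \<in> P"
proof (rule ccontr)
  assume "(X, pverts G) \<notin> P"
  moreover have s: "separation G (X, pverts G)" "sorder (X, pverts G) < k"
    using X by (auto simp: separation_def sorder_def Int_absorb2)
  ultimately have "(pverts G, X) \<in> P"
    using k_profile_orient[OF P s] by simp
  then show False
    using consistentD[OF k_profile_consistent[OF P], of "(pverts G, X)" "(pverts G, X)"] X(1)
    by (simp add: sle_def)
qed

text \<open>If all branches at the node \<open>Q\<close> other than that of \<open>u\<close> pointed towards \<open>Q\<close> in \<open>P\<close>, then so
  would their union \<open>sinv u\<close>, because \<open>Q\<close> contributes only the separator \<open>X\<close> of \<open>u\<close>.\<close>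

lemma ex_branch:
  assumes e: "efficient_system k \<P> N"
    and Q: "Q \<in> consistent_orientations G N" and u: "u \<in> maximal_seps Q"
    and X: "part_of G Q = fst u \<inter> snd u"
    and P: "k_profile G k P" "k_profile G k P'" "u \<in> P" "sinv u \<in> P'"
      "restrict_profile (sorder u) P = restrict_profile (sorder u) P'"
  shows "\<exists>w\<in>maximal_seps Q. w \<noteq> u \<and> sinv w \<in> P \<and> w \<in> P' \<and> w \<preceq> sinv u \<and> fst w \<inter> snd w = fst u \<inter> snd u"
proof -
  interpret nested_system G N using efficient_nested_system[OF e] .
  note c = k_profile_consistent[OF P(1)]
  let ?W = "maximal_seps Q - {u}" and ?X = "fst u \<inter> snd u"
  have uN: "u \<in> N" using orientationD(3)[OF Q maximal_in[OF u]] .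
  have ok: "sorder w < k" if "w \<in> N" for w
    using that e unfolding efficient_system_def by simp
  have XV: "?X \<subseteq> pverts G" using separation_subset(1)[OF N_sep[OF uN]] by blast
  have finX: "finite ?X" by (rule finite_subset[OF XV pair_finite_verts])
  have cX: "card ?X < k" using ok[OF uN] by (simp add: sorder_def)
  have WN: "w \<in> N" if "w \<in> maximal_seps Q" for w
    using orientationD(3)[OF Q maximal_in[OF that]] .
  have small: "card Y < k" if "Y \<subseteq> ?X" for Y
    using card_mono[OF finX that] cX by simp
  have "\<not> (\<forall>w\<in>?W. w \<in> P)"
  proof
    assume W: "\<forall>w\<in>?W. w \<in> P"
    \<comment> \<open>The branches are joined one by one, starting from \<open>?X\<close>. Each
      separator of a branch lies in the part, which is \<open>?X\<close>, so the partial joins keep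
      their separators inside \<open>?X\<close> and their orders below \<open>k\<close>.\<close>
    have "(?X \<union> (\<Union>w\<in>I. fst w), pverts G \<inter> (\<Inter>w\<in>I. snd w)) \<in> P" if "finite I" "I \<subseteq> ?W" for I
      using that
    proof (induction I rule: finite_induct)
      case empty
      then show ?case using k_profile_small[OF P(1) XV cX] by simp
    next
      case (insert w I)
      let ?J = "(?X \<union> (\<Union>w\<in>I. fst w), pverts G \<inter> (\<Inter>w\<in>I. snd w))"
      have eq: "sjoin w ?J = (?X \<union> (\<Union>w\<in>insert w I. fst w), pverts G \<inter> (\<Inter>w\<in>insert w I. snd w))"
        by (auto simp: sjoin_def)
      have "(?X \<union> (\<Union>w\<in>insert w I. fst w)) \<inter> (pverts G \<inter> (\<Inter>w\<in>insert w I. snd w)) \<subseteq> ?X"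
      proof
        fix x assume x: "x \<in> (?X \<union> (\<Union>w\<in>insert w I. fst w)) \<inter> (pverts G \<inter> (\<Inter>w\<in>insert w I. snd w))"
        show "x \<in> ?X"
        proof (rule ccontr)
          assume "x \<notin> ?X"
          then obtain v where "v \<in> insert w I" "x \<in> fst v" "x \<in> snd v" using x by blast
          then show False
            using maximal_separator_subset[OF Q, of v] insert.prems \<open>x \<notin> ?X\<close> unfolding X by blast
        qed
      qed
      then have "sorder (sjoin w ?J) < k"
        unfolding eq sorder_def fst_conv snd_conv by (rule small)
      then have "sjoin w ?J \<in> P"
        using insert W by (intro k_profile_sjoin[OF P(1)]) blast+
      then show ?case unfolding eq .
    qed
    moreover have "finite ?W"
      using finite_orientation[OF Q] maximal_in by (metis finite_Diff finite_subset subsetI)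
    ultimately have J: "(?X \<union> (\<Union>w\<in>?W. fst w), pverts G \<inter> (\<Inter>w\<in>?W. snd w)) \<in> P" by blast
    have inX: "x \<in> ?X" if "x \<in> pverts G" "x \<in> snd u" "\<forall>w\<in>?W. x \<in> snd w" for x
      using that unfolding X[symmetric] part_of_iff_maximal[OF Q] by blast
    have Un: "fst w \<union> snd w = pverts G" if "w \<in> N" for w
      using separation_Un[OF N_sep[OF that]] .
    \<comment> \<open>A vertex of \<open>snd u\<close> outside all branches is in the part, hence in
      \<open>?X\<close>; so \<open>?X\<close> and the branches fill the second side of
      \<open>u\<close>.\<close>
    have "sinv u \<preceq> (?X \<union> (\<Union>w\<in>?W. fst w), pverts G \<inter> (\<Inter>w\<in>?W. snd w))"
      unfolding sle_def fst_swap snd_swap fst_conv snd_conv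
    proof (intro conjI subsetI)
      fix x assume x: "x \<in> snd u"
      then have xV: "x \<in> pverts G" using Un[OF uN] by blast
      show "x \<in> ?X \<union> (\<Union>w\<in>?W. fst w)"
      proof (rule ccontr)
        assume *: "\<not> ?thesis"
        have "x \<in> snd w" if "w \<in> ?W" for w
          using Un[OF WN[of w]] that * xV by blast
        then show False using inX[OF xV x] * by blast
      qed
    next
      fix x assume x: "x \<in> pverts G \<inter> (\<Inter>w\<in>?W. snd w)"
      show "x \<in> fst u" using inX[of x] x Un[OF uN] by blast
    qed
    then show False using consistent_downD[OF c J, of "sinv u"] P(3) by simp
  qed
  then obtain w where w: "w \<in> maximal_seps Q" "w \<noteq> u" "w \<notin> P" by blast
  note wN = WN[OF w(1)]
  have w': "sinv w \<in> P" using k_profile_orient[OF P(1) N_sep[OF wN] ok[OF wN] w(3)] .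
  have "\<not> w \<preceq> u" using maximal_eq[OF w(1) maximal_in[OF u]] w(2) by blast
  then have wu: "w \<preceq> sinv u" using maximal_cases[OF Q u maximal_in[OF w(1)]] by blast
  have wP': "w \<in> P'" using k_profile_down[OF P(2,4) wu N_sep[OF wN] ok[OF wN]] .
  \<comment> \<open>\<open>w\<close> distinguishes \<open>P'\<close> from \<open>P\<close>, which
    agree below the order of \<open>u\<close>. Its separator thus has at least as many vertices as
    \<open>?X\<close>, in which it is contained.\<close>
  have "\<not> sorder w < sorder u"
  proof
    assume "sorder w < sorder u"
    then have "w \<in> restrict_profile (sorder u) P"
      using wP' unfolding P(5) by (simp add: restrict_profile_def)
    then show False using w(3) by (simp add: restrict_profile_def)
  qed
  moreover have sub: "fst w \<inter> snd w \<subseteq> ?X" using maximal_separator_subset[OF Q w(1)] unfolding X .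
  ultimately have "fst w \<inter> snd w = ?X"
    using card_subset_eq[OF finX sub] card_mono[OF finX sub] unfolding sorder_def by linarith
  then show ?thesis using w w' wu wP' by blast
qed

text \<open>Suppose two nodes have the same part \<open>X\<close>, and let \<open>u\<close> be the edge at \<open>Q0\<close> towards \<open>Q1\<close>.
  Both sides of \<open>u\<close> fall into two pieces with separator \<open>X\<close>: a branch (\<open>l\<close> at \<open>Q0\<close>, \<open>r\<close> at
  \<open>Q1\<close>) and the rest. Joining pieces from different sides yields \<open>w\<close>, which crosses \<open>u\<close> but
  was available when \<open>u\<close> was chosen.\<close>

theorem part_of_inj:
  assumes e: "efficient_system k \<P> N" and kp: "\<And>P. P \<in> \<P> \<Longrightarrow> k_profile G k P"
  shows "inj_on (part_of G) (consistent_orientations G N)"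
proof (rule inj_onI, rule ccontr)
  fix Q0 Q1
  assume Q: "Q0 \<in> consistent_orientations G N" "Q1 \<in> consistent_orientations G N"
    and eq: "part_of G Q0 = part_of G Q1" and ne: "Q0 \<noteq> Q1"
  interpret nested_system G N using efficient_nested_system[OF e] .
  define X where "X = part_of G Q0"
  have ok: "sorder w < k" if "w \<in> N" for w
    using that e unfolding efficient_system_def by simp
  have wit: "\<exists>P P'. k_profile G k P \<and> k_profile G k P' \<and> u \<in> P \<and> sinv u \<in> P' \<and>
        restrict_profile (sorder u) P = restrict_profile (sorder u) P' \<and>
        (\<forall>w. sorder w = sorder u \<and> nested_with w {t \<in> N. sorder t < sorder u} \<and> distinguishes w P P' \<longrightarrow>
           nested_sep u w)" if u: "u \<in> N" for u
  proof -
    have "\<exists>P\<in>\<P>. \<exists>P'\<in>\<P>. distinguishes u P P' \<and>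
        restrict_profile (sorder u) P = restrict_profile (sorder u) P' \<and>
        (\<forall>w. sorder w = sorder u \<and> nested_with w {t \<in> N. sorder t < sorder u} \<and> distinguishes w P P' \<longrightarrow>
           nested_sep u w)"
      using e[unfolded efficient_system_def, THEN conjunct2, THEN conjunct2, THEN conjunct1] u by (rule bspec)
    then obtain P P' where P: "P \<in> \<P>" "P' \<in> \<P>" "distinguishes u P P'"
        "restrict_profile (sorder u) P = restrict_profile (sorder u) P'"
        "\<forall>w. sorder w = sorder u \<and> nested_with w {t \<in> N. sorder t < sorder u} \<and> distinguishes w P P' \<longrightarrow>
           nested_sep u w"
      by blast
    from P(3) show ?thesis
    proof (rule distinguishesE)
      assume "u \<in> P" "sinv u \<in> P'"
      then show ?thesis using P kp by blast
    next
      assume "u \<in> P'" "sinv u \<in> P"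
      moreover have "restrict_profile (sorder u) P' = restrict_profile (sorder u) P" using P(4) by simp
      ultimately show ?thesis using P(1,2,5) kp distinguishes_sym[of _ P P'] by blast
    qed
  qed
  have sepX: "fst u \<inter> snd u = part_of G Q"
    if "Q \<in> orientations" "Q' \<in> orientations" "part_of G Q = part_of G Q'" "u \<in> maximal_seps Q" "u \<notin> Q'"
    for Q Q' u
    using separator_eq_if_parts_eq[OF that(1-3) maximal_in[OF that(4)] that(5)]
      maximal_separator_subset[OF that(1,4)] by (rule subset_antisym[rotated])
  obtain u where u: "u \<in> maximal_seps Q0" "u \<notin> Q1" using ex_maximal_diff[OF Q ne] by blast
  obtain u' where u': "u' \<in> maximal_seps Q1" "u' \<notin> Q0" using ex_maximal_diff[OF Q(2,1)] ne by blast
  have uX: "fst u \<inter> snd u = X" using sepX[OF Q eq u] unfolding X_def .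
  have uX': "fst u' \<inter> snd u' = X" using sepX[OF Q(2,1) eq[symmetric] u'] unfolding X_def eq .
  have uN: "u \<in> N" and uN': "u' \<in> N"
    using orientationD(3) Q maximal_in u(1) u'(1) by blast+
  have in0: "sinv u' \<in> Q0" using orientationD(4)[OF Q(1) uN' u'(2)] .
  \<comment> \<open>The first and the last edge of the path between the two nodes are comparable
    when both are oriented towards \<open>Q0\<close>.\<close>
  have "\<not> sinv u' \<preceq> sinv u"
    using orientation_down[OF Q(2) maximal_in[OF u'(1)] uN] u(2) by auto
  then have u'u: "sinv u' \<preceq> u" using maximal_cases[OF Q(1) u(1) in0] by blast
  have cX: "card X < k" using ok[OF uN] uX by (simp add: sorder_def)
  have ordX: "sorder s = card X" if "fst s \<inter> snd s = X" for s using that by (simp add: sorder_def)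
  obtain P P' where P: "k_profile G k P" "k_profile G k P'" "u \<in> P" "sinv u \<in> P'"
    "restrict_profile (sorder u) P = restrict_profile (sorder u) P'"
    and Pw: "\<And>w. sorder w = sorder u \<Longrightarrow> nested_with w {t \<in> N. sorder t < sorder u} \<Longrightarrow>
       distinguishes w P P' \<Longrightarrow> nested_sep u w"
    using wit[OF uN] by blast
  obtain l where l: "l \<in> maximal_seps Q0" "l \<noteq> u" "sinv l \<in> P" "l \<in> P'" "l \<preceq> sinv u" "fst l \<inter> snd l = X"
    using ex_branch[OF e Q(1) u(1) _ P] uX unfolding X_def by blast
  obtain R R' where R: "k_profile G k R" "k_profile G k R'" "u' \<in> R" "sinv u' \<in> R'"
    "restrict_profile (sorder u') R = restrict_profile (sorder u') R'"
    using wit[OF uN'] by blast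
  obtain r where r: "r \<in> maximal_seps Q1" "r \<preceq> sinv u'" "fst r \<inter> snd r = X"
    using ex_branch[OF e Q(2) u'(1) _ R] uX' unfolding X_def eq by blast
  have lN: "l \<in> N" and rN: "r \<in> N" using orientationD(3) Q maximal_in l(1) r(1) by blast+
  have ru: "r \<preceq> u" using r(2) u'u sle_trans by blast
  have rne: "r \<noteq> u" using maximal_in[OF r(1)] u(2) by blast
  note c = k_profile_consistent[OF P(1)] k_profile_consistent[OF P(2)]
  \<comment> \<open>A separation on which the two nodes differ has the common part \<open>X\<close>
    in its separator, so its order is at least \<open>card X\<close>.\<close>
  have low: "t \<in> Q0 \<longleftrightarrow> t \<in> Q1" if t: "t \<in> N" "sorder t < card X" for t
  proof -
    have "\<not> X \<subseteq> fst t \<inter> snd t"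
    proof
      assume "X \<subseteq> fst t \<inter> snd t"
      moreover have "finite (fst t \<inter> snd t)"
        by (rule finite_subset[OF _ pair_finite_verts])
          (use separation_subset(1)[OF N_sep[OF t(1)]] in blast)
      ultimately have "card X \<le> sorder t" unfolding sorder_def by (rule card_mono[rotated])
      then show False using t(2) by simp
    qed
    then show ?thesis
      using separator_eq_if_parts_eq[OF Q eq, of t] separator_eq_if_parts_eq[OF Q(2,1) eq[symmetric], of t]
      unfolding X_def eq by blast
  qed
  \<comment> \<open>Such a \<open>t\<close> would also be in \<open>Q1\<close>, where
    \<open>r\<close> is maximal; but \<open>r\<close> has order \<open>card X\<close>.\<close>
  have r_max: False if t: "t \<in> N" "sorder t < card X" "r \<preceq> t" "t \<in> Q0" for t
  proof -
    have "t = r" using maximal_eq[OF r(1) _ t(3)] low[OF t(1,2)] t(4) by blast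
    then show False using t(2) ordX[OF r(3)] by simp
  qed
  have l_max: "sinv t \<in> Q0" if t: "t \<in> N" "sorder t < card X" "l \<preceq> t" for t
  proof (rule ccontr)
    assume "sinv t \<notin> Q0"
    then have "t = l" using maximal_eq[OF l(1) _ t(3)] orientationD(4)[OF Q(1) t(1)] by blast
    then show False using t(2) ordX[OF l(6)] by simp
  qed
  \<comment> \<open>\<open>q\<close> is the piece of the first side of \<open>u\<close> in which
    \<open>P'\<close> does not live: the branch \<open>r\<close>, or what remains without
    \<open>r\<close> if \<open>P'\<close> lives in \<open>r\<close>. The last clause is the
    condition of \<open>nested_sjoin\<close> for joining \<open>l\<close> and
    \<open>q\<close>.\<close>
  have "\<exists>q. separation G q \<and> proper_sep q \<and> fst q \<inter> snd q = X \<and> q \<preceq> u \<and> q \<noteq> u \<and> q \<in> P' \<and>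
    (\<forall>t\<in>N. sorder t < card X \<longrightarrow> nested_sep t q \<and> \<not> (l \<preceq> t \<and> q \<preceq> sinv t))"
  proof (cases "r \<in> P'")
    case True
    have "\<not> (l \<preceq> t \<and> r \<preceq> sinv t)" if t: "t \<in> N" "sorder t < card X" for t
      using l_max[OF t] r_max[OF N_sinv[OF t(1)]] t(2) by auto
    then show ?thesis
      using True r(3) ru rne rN N_sep[OF rN] N_proper[OF rN] N_nested by blast
  next
    case False
    define q where "q = smeet u (sinv r)"
    have q_def': "fst q = fst u \<inter> snd r" "snd q = snd u \<union> fst r"
      by (simp_all add: q_def smeet_def)
    have ru': "fst r \<subseteq> fst u" "snd u \<subseteq> snd r" using ru by (simp_all add: sle_def)
    have rinv: "sinv r \<in> P'" using k_profile_orient[OF P(2) N_sep[OF rN] ok[OF rN] False] .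
    have sepq: "separation G q" using separation_smeet N_sep[OF uN] N_sep[OF rN] by (simp add: q_def)
    have qX: "fst q \<inter> snd q = X" using uX r(3) ru' unfolding q_def' by blast
    have qle: "q \<preceq> u" "q \<preceq> sinv r" by (simp_all add: q_def)
    have "\<not> fst q \<subseteq> snd q"
    proof
      assume "fst q \<subseteq> snd q"
      then have "fst u \<subseteq> fst r"
        using qX r(3) separation_Un[OF N_sep[OF rN]] separation_Un[OF N_sep[OF uN]] unfolding q_def' by blast
      then have "fst r = fst u" using ru' by blast
      then show False using separation_eqI[OF N_sep[OF rN] N_sep[OF uN]] uX r(3) rne by simp
    qed
    moreover have "\<not> snd q \<subseteq> fst q"
      using N_proper[OF uN] unfolding q_def' proper_sep_def by blast
    ultimately have pq: "proper_sep q" by (simp add: proper_sep_def)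
    have "q \<noteq> u"
    proof
      assume "q = u"
      then have "fst r \<subseteq> snd r" using ru' q_def'(1) by blast
      then show False using N_proper[OF rN] by (simp add: proper_sep_def)
    qed
    have no: False if "fst s \<inter> snd s = X" "q \<preceq> s" "q \<preceq> sinv s" for s
    proof -
      have "fst q \<subseteq> X" using that unfolding sle_def by auto
      then show False using pq qX unfolding proper_sep_def by blast
    qed
    have "q \<in> P'"
      using k_profile_down[OF P(2) rinv qle(2) sepq] ordX[OF qX] cX by simp
    moreover have "nested_sep t q" if t: "t \<in> N" "sorder t < card X" for t
    proof -
      have *: "\<not> (sinv u \<preceq> t \<and> r \<preceq> sinv t)" if t: "t \<in> N" "sorder t < card X" for t
      proof
        assume le: "sinv u \<preceq> t \<and> r \<preceq> sinv t"
        then have "sinv t \<preceq> u" using sle_sinv_iff by blast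
        then have "sinv t \<in> Q0"
          using orientation_down[OF Q(1) maximal_in[OF u(1)] N_sinv[OF t(1)]] by blast
        then show False using r_max[OF N_sinv[OF t(1)]] t(2) le by simp
      qed
      \<comment> \<open>\<open>q\<close> is the inverse of this join.\<close>
      have "nested_sep t (sjoin (sinv u) r)"
      proof (rule nested_sjoin)
        show "nested_sep t (sinv u)" "nested_sep t r" using N_nested t(1) uN rN N_sinv by blast+
        show "\<not> (sinv u \<preceq> t \<and> r \<preceq> sinv t)" using *[OF t] .
        show "\<not> (sinv u \<preceq> sinv t \<and> r \<preceq> t)" using *[OF N_sinv[OF t(1)]] t(2) by simp
      qed
      then have "nested_sep t (sinv (sjoin (sinv u) r))" by simp
      then show ?thesis unfolding sinv_sjoin q_def by simp
    qed
    moreover have "\<not> (l \<preceq> t \<and> q \<preceq> sinv t)" if t: "t \<in> N" "sorder t < card X" for t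
    proof
      assume le: "l \<preceq> t \<and> q \<preceq> sinv t"
      \<comment> \<open>\<open>?v\<close> lies above \<open>q\<close> and belongs to both nodes. As
        \<open>q\<close> is proper, \<open>?v\<close> cannot lie below \<open>r\<close> or
        \<open>sinv u\<close>, so it lies below \<open>sinv r\<close> and \<open>u\<close>, hence
        below \<open>q\<close>. Then \<open>?v = q\<close>, whose order is too large.\<close>
      let ?v = "sinv t"
      have v: "?v \<in> N" "sorder ?v < card X" "?v \<in> Q0"
        using N_sinv[OF t(1)] t l_max[OF t] le by simp_all
      then have v1: "?v \<in> Q1" using low by blast
      have "\<not> ?v \<preceq> r" using no[OF r(3)] le qle(2) sle_trans by blast
      then have 1: "?v \<preceq> sinv r" using maximal_cases[OF Q(2) r(1) v1] by blast
      have "\<not> ?v \<preceq> sinv u" using no[OF uX] le qle(1) sle_trans by blast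
      then have "?v \<preceq> u" using maximal_cases[OF Q(1) u(1) v(3)] by blast
      then have "?v \<preceq> q" using 1 smeet_greatest unfolding q_def by blast
      then have "?v = q" using le sle_antisym by blast
      then show False using v(2) ordX[OF qX] by simp
    qed
    ultimately show ?thesis
      using sepq pq qX qle(1) \<open>q \<noteq> u\<close> by blast
  qed
  then obtain q where q: "separation G q" "proper_sep q" "fst q \<inter> snd q = X" "q \<preceq> u" "q \<noteq> u" "q \<in> P'"
    and qt: "\<And>t. t \<in> N \<Longrightarrow> sorder t < card X \<Longrightarrow> nested_sep t q \<and> \<not> (l \<preceq> t \<and> q \<preceq> sinv t)"
    by blast
  \<comment> \<open>\<open>l\<close> is a branch on the other side of \<open>u\<close>, in which
    \<open>P\<close> lives. Joined with \<open>q\<close> it again separates \<open>P\<close> from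
    \<open>P'\<close>, with the same separator \<open>X\<close> as \<open>u\<close>.\<close>
  define w where "w = sjoin l q"
  have w: "fst w = fst l \<union> fst q" "snd w = snd l \<inter> snd q"
    by (simp_all add: w_def sjoin_def)
  have lu: "fst l \<subseteq> snd u" "fst u \<subseteq> snd l" and qu: "fst q \<subseteq> fst u" "snd u \<subseteq> snd q"
    using l(5) q(4) by (simp_all add: sle_def)
  have wX: "fst w \<inter> snd w = X" using l(6) q(3) unfolding w by blast
  have "w \<in> P'"
    using k_profile_sjoin[OF P(2) l(4) q(6)] ordX[OF wX] cX unfolding w_def by simp
  moreover have "sinv w \<in> P"
  proof (rule k_profile_down[OF P(1) l(3)])
    show "sinv w \<preceq> sinv l" by (simp add: w_def)
    show "separation G (sinv w)" using separation_sjoin[OF N_sep[OF lN] q(1)] by (simp add: w_def)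
    show "sorder (sinv w) < k" using ordX[OF wX] cX by simp
  qed
  ultimately have "distinguishes w P P'"
    using distinguishesI[OF c(2,1), of w] distinguishes_sym[of w P P'] by blast
  moreover have "nested_with w {t \<in> N. sorder t < sorder u}"
    unfolding nested_with_def
  proof
    fix t assume "t \<in> {t \<in> N. sorder t < sorder u}"
    then have t: "t \<in> N" "sorder t < card X" using ordX[OF uX] by simp_all
    have "nested_sep t w"
      unfolding w_def
    proof (rule nested_sjoin)
      show "nested_sep t l" using N_nested t(1) lN by blast
      show "nested_sep t q" "\<not> (l \<preceq> t \<and> q \<preceq> sinv t)" using qt[OF t] by blast+
      show "\<not> (l \<preceq> sinv t \<and> q \<preceq> t)" using qt[OF N_sinv[OF t(1)]] t(2) by simp
    qed
    then show "nested_sep w t" using nested_sep_sym by blast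
  qed
  ultimately have "nested_sep u w" using Pw[of w] ordX[OF wX] ordX[OF uX] by simp
  \<comment> \<open>Each way of being nested makes one of the pieces trivial: \<open>q = u\<close>,
    \<open>l\<close> improper, \<open>q\<close> improper, or \<open>l = sinv u\<close>.\<close>
  then consider "u \<preceq> w" | "w \<preceq> u" | "u \<preceq> sinv w" | "sinv w \<preceq> u" unfolding nested_sep_def by blast
  then show False
  proof cases
    case 1
    then have "fst u \<subseteq> fst q" using lu qu uX q(3) unfolding sle_def w by blast
    then have "fst q = fst u" using qu by blast
    then show False using separation_eqI[OF q(1) N_sep[OF uN]] uX q(3,5) by simp
  next
    case 2
    then have "fst l \<subseteq> X" using lu uX unfolding sle_def w by blast
    then show False using l(6) N_proper[OF lN] unfolding proper_sep_def by blast
  next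
    case 3
    then have "fst u \<subseteq> snd w" "fst w \<subseteq> snd u" unfolding sle_def by simp_all
    then have "fst q \<subseteq> X" using qu uX unfolding w by blast
    then show False using q(2,3) unfolding proper_sep_def by blast
  next
    case 4
    then have "snd u \<subseteq> fst w" unfolding sle_def by simp
    then have "snd u \<subseteq> fst l" using lu qu uX l(6) unfolding w by blast
    then have "fst l = fst (sinv u)" using lu by (simp add: subset_antisym)
    then have "l = sinv u"
      using separation_eqI[OF N_sep[OF lN], of "sinv u"] N_sep[OF uN] uX l(6) by (simp add: Int_commute)
    then show False using orientationD(5)[OF Q(1) maximal_in[OF u(1)]] maximal_in[OF l(1)] by simp
  qed
qed

end

section \<open>Edges of trees\<close>

lemma delete_edge_simps [simp]:
  "pverts (delete_edge T e) = pverts T" "parcs (delete_edge T e) = parcs T - {e, prod.swap e}"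
  by (simp_all add: delete_edge_def)

lemma delete_edge_swap [simp]: "delete_edge T (prod.swap e) = delete_edge T e"
  by (auto simp: delete_edge_def)

lemma pair_graph_delete_edge: "pair_graph T \<Longrightarrow> pair_graph (delete_edge T e)"
proof -
  assume "pair_graph T"
  then interpret T: pair_graph T .
  have "symmetric (with_proj (delete_edge T e))"
    unfolding symmetric_def with_proj_simps
    by (rule symI, cases e) (auto simp: T.arcs_symmetric)
  then show ?thesis
    by unfold_locales
      (auto simp: T.in_arcsD1 T.in_arcsD2 T.pair_finite_verts T.pair_finite_arcs dest: T.no_loops')
qed

lemma swap_arc: "pair_graph T \<Longrightarrow> e \<in> parcs T \<Longrightarrow> prod.swap e \<in> parcs T"
  using pair_sym_digraph.arcs_symmetric[of T "fst e" "snd e"]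
  by (cases e) (auto simp: pair_graph_def pair_pseudo_graph_def)

lemma (in pair_graph) component_of_refl: "s \<in> pverts G \<Longrightarrow> s \<in> component_of G s"
  and component_of_sym: "t \<in> component_of G s \<Longrightarrow> s \<in> component_of G t"
  and component_of_trans: "t \<in> component_of G s \<Longrightarrow> u \<in> component_of G t \<Longrightarrow> u \<in> component_of G s"
  and component_of_arc: "t \<in> component_of G s \<Longrightarrow> (t, u) \<in> parcs G \<Longrightarrow> u \<in> component_of G s"
  and component_of_verts: "t \<in> component_of G s \<Longrightarrow> s \<in> pverts G \<and> t \<in> pverts G"
  unfolding component_of_def mem_Collect_eq
      apply simp
     apply (erule symmetric_reachable')
    apply (erule (1) reachable_trans)
   apply (rule reachable_adj_trans, assumption, simp)
  apply (simp add: reachable_in_verts)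
  done

lemma (in pair_graph) component_of_induct [consumes 1, case_names base step]:
  assumes "t \<in> component_of G s"
    and "s \<in> pverts G \<Longrightarrow> P s"
    and "\<And>u v. u \<in> component_of G s \<Longrightarrow> (u, v) \<in> parcs G \<Longrightarrow> P u \<Longrightarrow> P v"
  shows "P t"
proof -
  have "s \<rightarrow>\<^sup>*\<^bsub>with_proj G\<^esub> t" using assms(1) by (simp add: component_of_def)
  then show ?thesis
    by (induction rule: reachable_induct) (use assms(2,3) in \<open>auto simp: component_of_def\<close>)
qed

lemma (in pair_graph) awalk_crossing:
  assumes "awalk a p b" "P a" "\<not> P b"
  shows "\<exists>e\<in>set p. P (fst e) \<and> \<not> P (snd e)"
  using assms
proof (induction p arbitrary: a)
  case Nil
  then show ?case by (auto simp: awalk_Nil_iff)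
next
  case (Cons e p)
  then show ?case by (cases "P (snd e)") (auto simp: awalk_Cons_iff)
qed

lemma (in pair_graph) connected_iff:
  "connected (with_proj G) \<longleftrightarrow> pverts G \<noteq> {} \<and> (\<forall>u\<in>pverts G. \<forall>v\<in>pverts G. v \<in> component_of G u)"
  unfolding connected_def strongly_connected_def component_of_def
  using reachable_mk_symmetric_eq[OF sym_arcs] by simp

text \<open>A graph in which every edge is a bridge has no cycle: a longer closed walk through \<open>ab\<close>
  without repetitions would return from \<open>b\<close> to \<open>a\<close> avoiding this edge.\<close>

lemma (in pair_graph) no_cycle_if_bridges:
  assumes bridge: "\<And>e. e \<in> parcs G \<Longrightarrow> fst e \<notin> component_of (delete_edge G e) (snd e)"
  shows "\<not> (\<exists>p. cycle p \<and> length p \<ge> 3)"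
proof
  assume "\<exists>p. cycle p \<and> length p \<ge> 3"
  then obtain p where p: "cycle p" "length p \<ge> 3" by blast
  then obtain e q where pe: "p = e # q" by (cases p) auto
  interpret D: pair_graph "delete_edge G e" by (rule pair_graph_delete_edge) (rule pair_graph)
  have q: "awalk (snd e) q (fst e)" "e \<in> parcs G" "distinct (pawalk_verts (snd e) q)" "length q \<ge> 2"
    using p unfolding cycle_def pe by (auto simp: awalk_Cons_iff)
  have "q \<noteq> []" using q(4) by auto
  have "pcas (snd e) q (fst e)" using q(1) by (simp add: awalk_def)
  then have "pawalk_verts (snd e) q = fst (hd q) # map snd q" "fst (hd q) = snd e"
    using awalk_verts_conv'[of "snd e" q "fst e"] \<open>q \<noteq> []\<close> by (simp, cases q, simp_all)
  then have heads: "pawalk_verts (snd e) q = snd e # map snd q" by simp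
  have "last (pawalk_verts (snd e) q) = fst e" using q(1) by (rule awlast_of_awalk) simp
  then have last: "snd (last q) = fst e" unfolding heads using \<open>q \<noteq> []\<close> by (simp add: last_map)
  then have tails: "pawalk_verts (snd e) q = map fst q @ [fst e]"
    using awalk_verts_conv[of "snd e" q] \<open>q \<noteq> []\<close> by simp
  have "e \<notin> set q"
    using q(3) unfolding heads by force
  moreover have "prod.swap e \<notin> set q"
  proof
    \<comment> \<open>The tail \<open>snd e\<close> of this arc is the first vertex of
      \<open>q\<close> and occurs only once, so the arc could only be the first one; but then
      \<open>fst e\<close>, the end of \<open>q\<close>, would be visited twice.\<close>
    assume *: "prod.swap e \<in> set q"
    obtain f q' where q': "q = f # q'" using q(4) by (cases q) auto
    have "fst f = snd e" using q(1) unfolding q' by (simp add: awalk_Cons_iff)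
    have "prod.swap e \<notin> set q'"
    proof
      assume "prod.swap e \<in> set q'"
      then have "snd e \<in> fst ` set q'" by force
      then show False using q(3)[unfolded tails, unfolded q'] \<open>fst f = snd e\<close> by simp
    qed
    then have "f = prod.swap e" using * unfolding q' by simp
    then have "snd f = fst e" by simp
    moreover have "q' \<noteq> []" using q(4) unfolding q' by auto
    then have "snd (last q') = fst e" "last q' \<in> set q'"
      using last unfolding q' by simp_all
    ultimately have "snd f \<in> snd ` set q'" by force
    then show False using q(3)[unfolded heads, unfolded q'] by simp
  qed
  ultimately have "D.awalk (snd e) q (fst e)"
    using q(1) unfolding awalk_def D.awalk_def by auto
  then have "fst e \<in> component_of (delete_edge G e) (snd e)"
    unfolding component_of_def using D.reachable_awalkI by blast
  then show False using bridge q(2) by blast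
qed

locale pair_tree = pair_graph T for T :: "'n pair_pre_digraph" +
  assumes tree_connected: "connected (with_proj T)"
    and no_long_cycle: "\<not> (\<exists>p. cycle p \<and> length p \<ge> 3)"

lemma tree_graph_iff: "tree_graph T \<longleftrightarrow> pair_tree T"
  by (auto simp: tree_graph_def pair_tree_def pair_tree_axioms_def)

text \<open>The nodes that \<open>e\<close> points to; \<open>edge_sep\<close> puts their parts into
  the second side.\<close>

definition beyond :: "'n pair_pre_digraph \<Rightarrow> 'n \<times> 'n \<Rightarrow> 'n set" where
  "beyond T e = component_of (delete_edge T e) (snd e)"

lemma edge_sep_beyond:
  "edge_sep T \<V> e = ((\<Union>t\<in>beyond T (prod.swap e). \<V> t), (\<Union>t\<in>beyond T e. \<V> t))"
  by (simp add: edge_sep_def beyond_def)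

lemma edge_sep_swap [simp]: "edge_sep T \<V> (prod.swap e) = sinv (edge_sep T \<V> e)"
  by (simp add: edge_sep_beyond)

context pair_tree
begin

lemma delete_graph: "pair_graph (delete_edge T e)"
  by (rule pair_graph_delete_edge) (rule pair_graph)

lemmas del_comp = pair_graph.component_of_refl[OF delete_graph] pair_graph.component_of_sym[OF delete_graph]
  pair_graph.component_of_trans[OF delete_graph] pair_graph.component_of_arc[OF delete_graph]
  pair_graph.component_of_verts[OF delete_graph]

lemma swap_in: "e \<in> parcs T \<Longrightarrow> prod.swap e \<in> parcs T"
  by (rule swap_arc) (rule pair_graph)

text \<open>A path between the ends that avoids the edge has at least two arcs, as a single one
  would be the edge itself; closed up by \<open>prod.swap e\<close> it is a cycle of length at least
  3.\<close>

lemma bridge: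
  assumes e: "e \<in> parcs T" shows "snd e \<notin> component_of (delete_edge T e) (fst e)"
proof
  interpret D: pair_graph "delete_edge T e" by (rule delete_graph)
  assume "snd e \<in> component_of (delete_edge T e) (fst e)"
  then obtain p where p: "D.apath (fst e) p (snd e)"
    unfolding component_of_def using D.reachable_apath by blast
  have "fst e \<noteq> snd e" using pair_no_loops[OF e] .
  then obtain f q where q: "p = f # q"
    using p by (cases p) (auto simp: D.apath_def D.awalk_Nil_iff)
  have "q \<noteq> []"
  proof
    assume "q = []"
    then have "f = e" "f \<in> parcs (delete_edge T e)"
      using p unfolding q D.apath_def by (auto simp: D.awalk_Cons_iff D.awalk_Nil_iff prod_eq_iff)
    then show False by simp
  qed
  have w: "awalk (fst e) p (snd e)" "distinct (pawalk_verts (fst e) p)"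
    using p unfolding D.apath_def D.awalk_def awalk_def by auto
  have "awalk (snd e) [prod.swap e] (fst e)"
    using swap_in[OF e] arc_fst_in_verts[OF e] by (simp add: awalk_Cons_iff awalk_Nil_iff)
  then have cyc: "awalk (fst e) (p @ [prod.swap e]) (fst e)"
    using w(1) by (auto intro: awalk_appendI)
  have "pawalk_verts (fst e) (p @ [prod.swap e]) = pawalk_verts (fst e) p @ [fst e]"
    using awalk_verts_append[OF cyc] w(1) by auto
  moreover have "pawalk_verts (fst e) p = fst e # tl (pawalk_verts (fst e) p)"
    using w(1) unfolding q by (simp add: awalk_Cons_iff)
  ultimately have "distinct (tl (pawalk_verts (fst e) (p @ [prod.swap e])))"
    using w(2) by (metis distinct.simps(2) distinct1_rotate list.sel(3) rotate1.simps(2) tl_append2 list.distinct(1))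
  then have "cycle (p @ [prod.swap e])"
    using cyc unfolding cycle_def by auto
  moreover have "length (p @ [prod.swap e]) \<ge> 3"
    using \<open>q \<noteq> []\<close> unfolding q by (cases q) auto
  ultimately show False using no_long_cycle by blast
qed

lemma beyond_subset: "beyond T e \<subseteq> pverts T"
  unfolding beyond_def using del_comp(5)[of _ e "snd e"] by fastforce

lemma snd_beyond: "e \<in> parcs T \<Longrightarrow> snd e \<in> beyond T e"
  unfolding beyond_def using del_comp(1)[of "snd e" e] arc_snd_in_verts by simp

lemma fst_not_beyond: "e \<in> parcs T \<Longrightarrow> fst e \<notin> beyond T e"
  using bridge[OF swap_in] unfolding beyond_def by simp

lemma beyond_arc:
  assumes "f \<in> parcs T" "f \<noteq> e" "f \<noteq> prod.swap e"
  shows "fst f \<in> beyond T e \<longleftrightarrow> snd f \<in> beyond T e"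
proof -
  have "(fst f, snd f) \<in> parcs (delete_edge T e)" "(snd f, fst f) \<in> parcs (delete_edge T e)"
    using assms swap_in[OF assms(1)] by (auto simp: prod.swap_def prod_eq_iff)
  then show ?thesis unfolding beyond_def using del_comp(4) by blast
qed

lemma beyond_swap:
  assumes e: "e \<in> parcs T" shows "beyond T (prod.swap e) = pverts T - beyond T e"
proof
  show "beyond T (prod.swap e) \<subseteq> pverts T - beyond T e"
  proof
    fix t assume t: "t \<in> beyond T (prod.swap e)"
    have "t \<notin> beyond T e"
    proof
      assume "t \<in> beyond T e"
      then have "fst e \<in> component_of (delete_edge T e) (snd e)"
        using t del_comp(2,3) unfolding beyond_def by (metis delete_edge_swap snd_swap)
      then show False using fst_not_beyond[OF e] by (simp add: beyond_def)
    qed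
    then show "t \<in> pverts T - beyond T e" using t beyond_subset by blast
  qed
  show "pverts T - beyond T e \<subseteq> beyond T (prod.swap e)"
  proof
    fix t assume t: "t \<in> pverts T - beyond T e"
    have "t \<in> component_of T (snd e)"
      using tree_connected t arc_snd_in_verts[OF e] unfolding connected_iff by blast
    then have "t \<in> beyond T e \<or> t \<in> beyond T (prod.swap e)"
    proof (induction rule: component_of_induct)
      case base then show ?case using snd_beyond[OF e] by blast
    next
      case (step u v)
      consider "(u, v) = e" | "(u, v) = prod.swap e" | "(u, v) \<noteq> e" "(u, v) \<noteq> prod.swap e" by blast
      then show ?case
      proof cases
        case 1 then show ?thesis using snd_beyond[OF e] by auto
      next
        case 2
        then have "snd (prod.swap e) = v" by (metis snd_conv)
        then show ?thesis using snd_beyond[OF swap_in[OF e]] by auto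
      next
        case 3
        then show ?thesis
          using step beyond_arc[of "(u, v)" e] beyond_arc[of "(u, v)" "prod.swap e"] by auto
      qed
    qed
    then show "t \<in> beyond T (prod.swap e)" using t by blast
  qed
qed

text \<open>The side of \<open>e\<close> away from \<open>f\<close> stays connected when
  \<open>f\<close> is removed, so it lies entirely on one side of \<open>f\<close>, the one
  containing \<open>fst e\<close>.\<close>

lemma beyond_laminar:
  assumes e: "e \<in> parcs T" and f: "f \<in> parcs T" "fst f \<in> beyond T e" "snd f \<in> beyond T e"
  shows "fst e \<in> beyond T f \<Longrightarrow> beyond T (prod.swap e) \<subseteq> beyond T f"
    and "fst e \<notin> beyond T f \<Longrightarrow> beyond T f \<subseteq> beyond T e"
proof -
  interpret D: pair_graph "delete_edge T e" by (rule delete_graph)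
  have sub: "t \<in> component_of (delete_edge T f) (fst e)" if t: "t \<in> beyond T (prod.swap e)" for t
    using t unfolding beyond_def delete_edge_swap snd_swap
  proof (induction rule: D.component_of_induct)
    case base
    then show ?case using del_comp(1) by simp
  next
    case (step u v)
    have uv: "u \<in> beyond T (prod.swap e)" using step(1) by (simp add: beyond_def)
    have "v \<in> beyond T (prod.swap e)"
      using D.component_of_arc[OF step(1,2)] by (simp add: beyond_def)
    then have "u \<notin> beyond T e" "v \<notin> beyond T e" using uv beyond_swap[OF e] by blast+
    then have "(u, v) \<noteq> f" "(u, v) \<noteq> prod.swap f"
      using f(2,3) by (metis fst_conv, metis fst_conv fst_swap)
    then have "(u, v) \<in> parcs (delete_edge T f)" using step(2) by simp
    then show ?case using del_comp(4) step(3) by blast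
  qed
  { assume "fst e \<in> beyond T f"
    then show "beyond T (prod.swap e) \<subseteq> beyond T f"
      using sub del_comp(3) unfolding beyond_def by blast }
  { assume "fst e \<notin> beyond T f"
    have "t \<notin> beyond T f" if "t \<in> beyond T (prod.swap e)" for t
      using sub[OF that] \<open>fst e \<notin> beyond T f\<close> del_comp(2,3) unfolding beyond_def by blast
    then show "beyond T f \<subseteq> beyond T e"
      using beyond_swap[OF e] beyond_subset[of f] by blast }
qed

text \<open>Two paths inside the components of the tree without the edge, joined through it. To this
  path the path axiom of a tree-decomposition is applied.\<close>

lemma path_through_edge:
  assumes e: "e \<in> parcs T" and s: "s \<in> beyond T (prod.swap e)" and t: "t \<in> beyond T e"
  shows "\<exists>p. apath s p t \<and> fst e \<in> set (pawalk_verts s p) \<and> snd e \<in> set (pawalk_verts s p)"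
proof -
  interpret D: pair_graph "delete_edge T e" by (rule delete_graph)
  have "fst e \<in> component_of (delete_edge T e) s" "t \<in> component_of (delete_edge T e) (snd e)"
    using s t del_comp(2) by (simp_all add: beyond_def)
  then obtain p q where p: "D.apath s p (fst e)" and q: "D.apath (snd e) q t"
    unfolding component_of_def using D.reachable_apath by blast
  have comp: "v \<in> component_of (delete_edge T e) a" if "D.apath a r b" "v \<in> set (pawalk_verts a r)" for a b r v
    using D.awalk_verts_reachable_from[of a r b v] that
    unfolding component_of_def D.apath_def by simp
  have pv: "set (pawalk_verts s p) \<subseteq> beyond T (prod.swap e)"
  proof
    fix v assume v: "v \<in> set (pawalk_verts s p)"
    then show "v \<in> beyond T (prod.swap e)"
      using comp[OF p v] s del_comp(3) by (simp add: beyond_def)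
  qed
  have qv: "set (pawalk_verts (snd e) q) \<subseteq> beyond T e"
    using comp[OF q] by (auto simp: beyond_def)
  have pT: "apath s p (fst e)" and qT: "apath (snd e) q t"
    using p q unfolding apath_def D.apath_def awalk_def D.awalk_def by auto
  have "fst e \<notin> set (pawalk_verts (snd e) q)"
    using qv fst_not_beyond[OF e] by blast
  then have eq: "apath (fst e) (e # q) t"
    using qT e by (simp add: apath_Cons_iff)
  have last: "last (pawalk_verts s p) = fst e"
    using pT by (auto simp: apath_def)
  have "set (pawalk_verts s p) \<inter> set (pawalk_verts (snd e) q) = {}"
    using pv qv beyond_swap[OF e] by blast
  then have "apath s (p @ e # q) t"
    unfolding apath_append_iff last using pT eq by simp
  moreover have "snd e \<in> set (pawalk_verts s (p @ e # q))" "fst e \<in> set (pawalk_verts s (p @ e # q))"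
    using calculation awalk_verts_arc2[of s "p @ e # q" t e] awalk_verts_arc1[of e "p @ e # q" s]
    by (auto simp: apath_def)
  ultimately show ?thesis by blast
qed

text \<open>The edge is the first one of a shortest path from \<open>Z\<close> to \<open>t\<close>.\<close>

lemma ex_edge_towards:
  assumes Z: "Z \<subseteq> pverts T" "Z \<noteq> {}" and t: "t \<in> pverts T" "t \<notin> Z"
  shows "\<exists>e\<in>parcs T. fst e \<in> Z \<and> snd e \<notin> Z \<and> t \<in> beyond T e"
proof -
  let ?P = "\<lambda>p. \<exists>s\<in>Z. apath s p t"
  obtain s where s: "s \<in> Z" using Z by blast
  have "t \<in> component_of T s" using tree_connected s Z t unfolding connected_iff by blast
  then have "\<exists>p. ?P p" using s unfolding component_of_def mem_Collect_eq reachable_apath by blast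
  then obtain p where p: "?P p" and min: "\<And>q. ?P q \<Longrightarrow> length p \<le> length q"
    using ex_has_least_nat[of ?P _ length] by blast
  then obtain s where s: "s \<in> Z" "apath s p t" by blast
  obtain e q where pe: "p = e # q"
    using s t by (cases p) (auto simp: apath_def awalk_Nil_iff)
  have e: "e \<in> parcs T" "fst e = s" "apath (snd e) q t" "fst e \<notin> set (pawalk_verts (snd e) q)"
    using s(2) unfolding pe by (auto simp: apath_Cons_iff)
  have "snd e \<notin> Z" using min[of q] e(3) unfolding pe by auto
  moreover have "t \<in> beyond T e"
  proof -
    interpret D: pair_graph "delete_edge T e" by (rule delete_graph)
    have w: "awalk (snd e) q t" using e(3) by (simp add: apath_def)
    have "f \<noteq> e \<and> f \<noteq> prod.swap e" if "f \<in> set q" for f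
      using awalk_verts_arc1[OF that, of "snd e"] awalk_verts_arc2[OF w that] e(4) by auto
    then have "D.awalk (snd e) q t" using w unfolding awalk_def D.awalk_def by auto
    then show ?thesis unfolding beyond_def component_of_def using D.reachable_awalkI by blast
  qed
  ultimately show ?thesis using e s by blast
qed

end

section \<open>Nodes of a tree-decomposition as orientations\<close>

definition node_orientation :: "'n pair_pre_digraph \<Rightarrow> ('n \<Rightarrow> 'a set) \<Rightarrow> 'n \<Rightarrow> 'a sep set" where
  "node_orientation T \<V> t = edge_sep T \<V> ` {e \<in> parcs T. t \<in> beyond T e}"

locale system_td = nested_system G N + T: pair_tree T
  for G :: "'a pair_pre_digraph" and N and T :: "'n pair_pre_digraph" +
  fixes \<V> :: "'n \<Rightarrow> 'a set"
  assumes td: "td_of_seps G N T \<V>"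
begin

abbreviation es where "es \<equiv> edge_sep T \<V>"

lemma td_facts:
  "(\<Union>t\<in>pverts T. \<V> t) = pverts G" "es ` parcs T = N" "inj_on es (parcs T)"
  using td by (simp_all add: td_of_seps_def tree_decomposition_def)

lemma es_in: "e \<in> parcs T \<Longrightarrow> es e \<in> N"
  using td_facts(2) by blast

lemma part_path:
  assumes "e \<in> parcs T" "s \<in> beyond T (prod.swap e)" "t \<in> beyond T e"
  shows "\<V> s \<inter> \<V> t \<subseteq> \<V> (fst e) \<inter> \<V> (snd e)"
proof -
  obtain p where p: "T.apath s p t" "fst e \<in> set (pawalk_verts s p)" "snd e \<in> set (pawalk_verts s p)"
    using T.path_through_edge[OF assms] by blast
  have "\<forall>t\<^sub>1 t\<^sub>2 t\<^sub>3 p. T.apath t\<^sub>1 p t\<^sub>3 \<and> t\<^sub>2 \<in> set (pawalk_verts t\<^sub>1 p) \<longrightarrow> \<V> t\<^sub>1 \<inter> \<V> t\<^sub>3 \<subseteq> \<V> t\<^sub>2"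
    using td unfolding td_of_seps_def tree_decomposition_def awalk_verts_with_proj_eq by blast
  then have "\<V> s \<inter> \<V> t \<subseteq> \<V> (fst e)" "\<V> s \<inter> \<V> t \<subseteq> \<V> (snd e)" using p by blast+
  then show ?thesis by blast
qed

lemma edge_separator:
  assumes e: "e \<in> parcs T" shows "fst (es e) \<inter> snd (es e) = \<V> (fst e) \<inter> \<V> (snd e)"
proof
  show "fst (es e) \<inter> snd (es e) \<subseteq> \<V> (fst e) \<inter> \<V> (snd e)"
    using part_path[OF e] unfolding edge_sep_beyond fst_conv snd_conv by blast
  show "\<V> (fst e) \<inter> \<V> (snd e) \<subseteq> fst (es e) \<inter> snd (es e)"
    using T.snd_beyond[OF e] T.snd_beyond[OF T.swap_in[OF e]] unfolding edge_sep_beyond by auto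
qed

text \<open>The order is reversed: the second side of \<open>es e\<close> collects the parts beyond
  \<open>e\<close>, so shrinking the set beyond an edge moves the separation up.\<close>

lemma es_mono:
  assumes "e \<in> parcs T" "f \<in> parcs T" "beyond T f \<subseteq> beyond T e" shows "es e \<preceq> es f"
  using assms T.beyond_swap[OF assms(1)] T.beyond_swap[OF assms(2)]
  unfolding sle_def edge_sep_beyond fst_conv snd_conv by blast

text \<open>In the last alternative the two edges point towards each other; recording
  \<open>f \<noteq> prod.swap e\<close> is what later turns injectivity of \<open>es\<close> into
  consistency.\<close>

lemma edge_cases:
  assumes e: "e \<in> parcs T" and f: "f \<in> parcs T" and t: "t \<in> beyond T e" "t \<in> beyond T f"
  shows "es e \<preceq> es f \<or> es f \<preceq> es e \<or> (es f \<preceq> sinv (es e) \<and> f \<noteq> prod.swap e)"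
proof (cases "f = e")
  case False
  have ne: "f \<noteq> prod.swap e"
    using t T.beyond_swap[OF e] by blast
  have ne': "e \<noteq> f" "e \<noteq> prod.swap f" using False ne by auto
  have fe: "fst f \<in> beyond T e \<longleftrightarrow> snd f \<in> beyond T e" by (rule T.beyond_arc[OF f False ne])
  have ef: "fst e \<in> beyond T f \<longleftrightarrow> snd e \<in> beyond T f" by (rule T.beyond_arc[OF e ne'])
  note [simp] = T.swap_in[OF e]
  show ?thesis
  proof (cases "fst f \<in> beyond T e")
    case True
    show ?thesis
    proof (cases "fst e \<in> beyond T f")
      case fst_in: True
      have "beyond T (prod.swap e) \<subseteq> beyond T f"
        by (rule T.beyond_laminar(1)[OF e f True _ fst_in]) (use True fe in blast)
      then have "es f \<preceq> es (prod.swap e)" by (rule es_mono[OF f T.swap_in[OF e]])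
      then show ?thesis using ne by simp
    next
      case fst_out: False
      have "beyond T f \<subseteq> beyond T e"
        by (rule T.beyond_laminar(2)[OF e f True _ fst_out]) (use True fe in blast)
      then show ?thesis using es_mono[OF e f] by blast
    qed
  next
    case f_out: False
    show ?thesis
    proof (cases "fst e \<in> beyond T f")
      case True
      have "beyond T e \<subseteq> beyond T f"
        by (rule T.beyond_laminar(2)[OF f e True _ f_out]) (use True ef in blast)
      then show ?thesis using es_mono[OF f e] by blast
    next
      case False
      have "fst f \<in> beyond T (prod.swap e)" "snd f \<in> beyond T (prod.swap e)"
        using f_out fe T.beyond_swap[OF e] T.arc_fst_in_verts[OF f] T.arc_snd_in_verts[OF f] by blast+
      then have "beyond T f \<subseteq> beyond T (prod.swap e)"
        using T.beyond_laminar(2)[of "prod.swap e" f] f False ef by simp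
      then show ?thesis using t T.beyond_swap[OF e] by blast
    qed
  qed
qed simp

abbreviation nor where "nor \<equiv> node_orientation T \<V>"

lemma in_nor_iff:
  assumes "e \<in> parcs T" shows "es e \<in> nor t \<longleftrightarrow> t \<in> beyond T e"
proof
  assume "es e \<in> nor t"
  then obtain f where "f \<in> parcs T" "t \<in> beyond T f" "es e = es f"
    unfolding node_orientation_def by blast
  then show "t \<in> beyond T e" using inj_onD[OF td_facts(3)] assms by blast
qed (use assms in \<open>auto simp: node_orientation_def\<close>)

lemma nor_subset: "nor t \<subseteq> N"
  unfolding node_orientation_def using es_in by blast

text \<open>An inconsistent pair of edges pointing to \<open>t\<close> would either be comparable,
  which makes one of the separations improper, or face each other with
  \<open>es f = es (prod.swap e)\<close>, which injectivity of \<open>es\<close> excludes.\<close>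

lemma nor_orientation:
  assumes t: "t \<in> pverts T" shows "nor t \<in> orientations"
proof -
  have "\<not> sinv v \<preceq> u" if "u \<in> nor t" "v \<in> nor t" for u v
  proof
    assume le: "sinv v \<preceq> u"
    obtain e f where e: "e \<in> parcs T" "t \<in> beyond T e" "u = es e"
      and f: "f \<in> parcs T" "t \<in> beyond T f" "v = es f"
      using \<open>u \<in> nor t\<close> \<open>v \<in> nor t\<close> unfolding node_orientation_def by blast
    note p = proper_not_sle_sinv(2)[OF N_proper[OF es_in[OF e(1)]]] proper_not_sle_sinv(2)[OF N_proper[OF es_in[OF f(1)]]]
    have le': "sinv u \<preceq> v" using le sle_sinv_iff by blast
    consider "u \<preceq> v" | "v \<preceq> u" | "v \<preceq> sinv u" "f \<noteq> prod.swap e"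
      using edge_cases[OF e(1) f(1) e(2) f(2)] unfolding e(3) f(3) by blast
    then show False
    proof cases
      case 1 then show False using le p(2) sle_trans unfolding f(3) by blast
    next
      case 2 then show False using le' p(1) sle_trans unfolding e(3) by blast
    next
      case 3
      then have "es f = es (prod.swap e)" using le' sle_antisym unfolding e(3) f(3) by simp
      then show False using 3(2) inj_onD[OF td_facts(3)] f(1) T.swap_in[OF e(1)] by blast
    qed
  qed
  moreover have "u \<in> nor t \<or> sinv u \<in> nor t" if "u \<in> N" for u
  proof -
    obtain e where e: "e \<in> parcs T" "u = es e" using \<open>u \<in> N\<close> td_facts(2) by blast
    have "t \<in> beyond T e \<or> t \<in> beyond T (prod.swap e)" using T.beyond_swap[OF e(1)] t by blast
    then show ?thesis
      using in_nor_iff[OF e(1)] in_nor_iff[OF T.swap_in[OF e(1)]] e(2) by simp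
  qed
  ultimately show ?thesis
    using nor_subset N_sep unfolding orientation_iff consistent_iff by blast
qed

lemma nor_inj: "inj_on nor (pverts T)"
proof (rule inj_onI, rule ccontr)
  fix s t assume st: "s \<in> pverts T" "t \<in> pverts T" "nor s = nor t" "s \<noteq> t"
  then obtain e where e: "e \<in> parcs T" "fst e = s" "t \<in> beyond T e"
    using T.ex_edge_towards[of "{s}" t] by blast
  then have "s \<in> beyond T e" using in_nor_iff[OF e(1)] st(3) by blast
  then show False using T.fst_not_beyond[OF e(1)] e(2) by simp
qed

text \<open>Every consistent orientation has a sink, namely the head of the edge of a maximal element.\<close>

lemma nor_surj:
  assumes Q: "Q \<in> orientations" shows "\<exists>t\<in>pverts T. Q = nor t"
proof (cases "Q = {}")
  case True
  then have "N = {}" using orientationD(4)[OF Q] by blast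
  moreover obtain t where "t \<in> pverts T" using T.tree_connected unfolding T.connected_iff by blast
  moreover have "nor t \<subseteq> N" by (rule nor_subset)
  ultimately show ?thesis using True by blast
next
  case False
  then obtain u where u: "u \<in> maximal_seps Q"
    using ex_maximal_above[OF finite_orientation[OF Q]] by blast
  obtain e where e: "e \<in> parcs T" "u = es e"
    using orientationD(3)[OF Q maximal_in[OF u]] td_facts(2) by blast
  define t where "t = snd e"
  have t: "t \<in> pverts T" using T.arc_snd_in_verts[OF e(1)] by (simp add: t_def)
  have "w \<in> nor t" if w: "w \<in> Q" for w
  proof -
    obtain f where f: "f \<in> parcs T" "w = es f"
      using orientationD(3)[OF Q w] td_facts(2) by blast
    have "t \<in> beyond T f"
    proof (rule ccontr)
      assume nt: "t \<notin> beyond T f"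
      have "f \<noteq> e" using nt T.snd_beyond[OF e(1)] by (auto simp: t_def)
      moreover have "f \<noteq> prod.swap e"
        using orientationD(5)[OF Q maximal_in[OF u]] w e(2) f(2) by auto
      ultimately have ne: "e \<noteq> f" "e \<noteq> prod.swap f" by auto
      have "fst e \<notin> beyond T f" using T.beyond_arc[OF e(1) ne] nt by (simp add: t_def)
      then have "fst e \<in> beyond T (prod.swap f)" "snd e \<in> beyond T (prod.swap f)"
        using nt t T.beyond_swap[OF f(1)] T.arc_fst_in_verts[OF e(1)] by (auto simp: t_def)
      \<comment> \<open>Either \<open>w\<close> lies above \<open>u\<close>, against maximality, or
        \<open>sinv w\<close> lies below \<open>u\<close>, against consistency.\<close>
      note lam = T.beyond_laminar[OF T.swap_in[OF f(1)] e(1) this]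
      show False
      proof (cases "snd f \<in> beyond T e")
        case True
        then have "beyond T f \<subseteq> beyond T e" using lam(1) by simp
        then have "u \<preceq> w" using es_mono[OF e(1) f(1)] e(2) f(2) by simp
        then have "w = u" using maximal_eq[OF u w] by blast
        then show False using \<open>f \<noteq> e\<close> inj_onD[OF td_facts(3)] e f by blast
      next
        case False
        then have "beyond T e \<subseteq> beyond T (prod.swap f)" using lam(2) by simp
        then have "es (prod.swap f) \<preceq> es e" using es_mono[OF T.swap_in[OF f(1)] e(1)] by blast
        then have "sinv w \<preceq> u" using e(2) f(2) by simp
        then show False using consistentD[OF orientationD(2)[OF Q] maximal_in[OF u] w] by blast
      qed
    qed
    then show ?thesis using in_nor_iff[OF f(1)] f(2) by simp
  qed
  then have "Q \<subseteq> nor t" by blast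
  moreover have "Q = nor t \<or> (\<exists>v\<in>Q. sinv v \<in> nor t)"
    using orientations_differ[OF Q nor_orientation[OF t]] by blast
  ultimately have "Q = nor t" using orientationD(5)[OF nor_orientation[OF t]] by blast
  then show ?thesis using t by blast
qed

lemma nor_bij: "bij_betw nor (pverts T) orientations"
  unfolding bij_betw_def using nor_inj nor_orientation nor_surj by blast

lemma nor_arc:
  assumes e: "e \<in> parcs T"
  shows "nor (snd e) = flip (sinv (es e)) (nor (fst e))" "sinv (es e) \<in> nor (fst e)"
proof -
  have fV: "fst e \<in> pverts T" "snd e \<in> pverts T" using T.arc_fst_in_verts[OF e] T.arc_snd_in_verts[OF e] .
  note se = T.swap_in[OF e]
  show in1: "sinv (es e) \<in> nor (fst e)"
    using in_nor_iff[OF se, of "fst e"] T.snd_beyond[OF se] by simp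
  have in2: "es e \<in> nor (snd e)"
    using in_nor_iff[OF e] T.snd_beyond[OF e] by simp
  have "w \<in> nor (fst e) \<longleftrightarrow> w \<in> nor (snd e)" if w: "w \<in> N" "w \<noteq> es e" "w \<noteq> sinv (es e)" for w
  proof -
    obtain f where f: "f \<in> parcs T" "w = es f" using w(1) td_facts(2) by blast
    have "e \<noteq> f" "e \<noteq> prod.swap f" using w f by auto
    then show ?thesis
      using T.beyond_arc[OF e] in_nor_iff[OF f(1)] f(2) by simp
  qed
  moreover have "es e \<notin> nor (fst e)" "sinv (es e) \<notin> nor (snd e)"
    using orientationD(5)[OF nor_orientation[OF fV(1)] in1] orientationD(5)[OF nor_orientation[OF fV(2)] in2]
    by simp_all
  ultimately have "nor (snd e) = insert (es e) (nor (fst e) - {sinv (es e)})"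
    using nor_subset in2 by blast
  then show "nor (snd e) = flip (sinv (es e)) (nor (fst e))"
    by (simp add: flip_def)
qed

text \<open>The edge that induces \<open>sinv u\<close> leaves a node in whose orientation
  \<open>u\<close> is maximal; \<open>s\<close> is such a node too, and there is only one.\<close>

lemma arc_iff:
  assumes st: "s \<in> pverts T" "t \<in> pverts T"
  shows "(s, t) \<in> parcs T \<longleftrightarrow> (\<exists>u\<in>nor s. nor t = flip u (nor s))"
proof
  assume "(s, t) \<in> parcs T"
  then show "\<exists>u\<in>nor s. nor t = flip u (nor s)" using nor_arc[of "(s, t)"] by auto
next
  assume "\<exists>u\<in>nor s. nor t = flip u (nor s)"
  then obtain u where u: "u \<in> nor s" "nor t = flip u (nor s)" by blast
  have "sinv u \<in> N" using N_sinv nor_subset u(1) by blast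
  then obtain e where e: "e \<in> parcs T" "sinv u = es e" using td_facts(2) by blast
  then have u_eq: "u = sinv (es e)" by (metis swap_swap)
  have V: "fst e \<in> pverts T" "snd e \<in> pverts T" using T.arc_fst_in_verts[OF e(1)] T.arc_snd_in_verts[OF e(1)] .
  have f: "nor (snd e) = flip u (nor (fst e))" "u \<in> nor (fst e)"
    using nor_arc[OF e(1)] u_eq by simp_all
  have "u \<in> maximal_seps (nor s)"
    using maximal_if_flip[OF nor_orientation[OF st(1)] _ u(1)] nor_orientation[OF st(2)] u(2) by simp
  moreover have "u \<in> maximal_seps (nor (fst e))"
    using maximal_if_flip[OF nor_orientation[OF V(1)] _ f(2)] nor_orientation[OF V(2)] f(1) by simp
  ultimately have "nor s = nor (fst e)"
    using maximal_unique nor_orientation st V by blast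
  then have "s = fst e" "t = snd e"
    using inj_onD[OF nor_inj] u(2) f(1) st V by simp_all
  then show "(s, t) \<in> parcs T" using e(1) by simp
qed

text \<open>If the set of nodes whose parts contain \<open>x\<close> misses \<open>t\<close>, the
  first edge leaving it towards \<open>t\<close> induces a separation with \<open>x\<close> outside
  its second side, although this separation belongs to \<open>nor t\<close>.\<close>

lemma part_eq:
  assumes t: "t \<in> pverts T" shows "\<V> t = part_of G (nor t)"
proof
  show "\<V> t \<subseteq> part_of G (nor t)"
  proof
    fix x assume x: "x \<in> \<V> t"
    then have "x \<in> pverts G" using td_facts(1) t by blast
    moreover have "x \<in> snd u" if "u \<in> nor t" for u
      using that x unfolding node_orientation_def edge_sep_beyond by auto
    ultimately show "x \<in> part_of G (nor t)" by (simp add: part_of_iff)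
  qed
  show "part_of G (nor t) \<subseteq> \<V> t"
  proof
    fix x assume x: "x \<in> part_of G (nor t)"
    show "x \<in> \<V> t"
    proof (rule ccontr)
      assume nx: "x \<notin> \<V> t"
      let ?Z = "{s \<in> pverts T. x \<in> \<V> s}"
      have "x \<in> pverts G" using x by (simp add: part_of_iff)
      then have "?Z \<noteq> {}" using td_facts(1) by blast
      then obtain e where e: "e \<in> parcs T" "fst e \<in> ?Z" "snd e \<notin> ?Z" "t \<in> beyond T e"
        using T.ex_edge_towards[of ?Z t] t nx by blast
      have nb: "x \<notin> \<V> (snd e)" using e(3) T.arc_snd_in_verts[OF e(1)] by blast
      have "fst e \<in> beyond T (prod.swap e)" using T.snd_beyond[OF T.swap_in[OF e(1)]] by simp
      then have "x \<notin> \<V> c" if "c \<in> beyond T e" for c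
        using part_path[OF e(1) _ that] e(2) nb by blast
      then have "x \<notin> snd (es e)" unfolding edge_sep_beyond by simp
      moreover have "es e \<in> nor t" using in_nor_iff[OF e(1)] e(4) by simp
      ultimately show False using x by (simp add: part_of_iff)
    qed
  qed
qed

lemma adhesion_less:
  assumes "\<And>u. u \<in> N \<Longrightarrow> sorder u < k" "k \<ge> 1"
  shows "adhesion T \<V> < k"
proof (cases "parcs T = {}")
  case False
  have "card (\<V> (fst e) \<inter> \<V> (snd e)) < k" if "e \<in> parcs T" for e
    using assms(1)[OF es_in[OF that]] edge_separator[OF that] by (simp add: sorder_def)
  then have "\<forall>n\<in>(\<lambda>(s, t). card (\<V> s \<inter> \<V> t)) ` parcs T. n < k" by force
  then show ?thesis
    using False T.pair_finite_arcs unfolding adhesion_def by (simp add: Max_less_iff)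
qed (use assms(2) in \<open>simp add: adhesion_def\<close>)

end

section \<open>The tree-decomposition of a nested system\<close>

text \<open>With the parts themselves as nodes, the family of parts is the identity and the node
  type is \<open>'a set\<close>. This represents the orientations faithfully when
  \<open>part_of G\<close> is injective on them.\<close>

definition orientation_tree :: "'a pair_pre_digraph \<Rightarrow> 'a sep set \<Rightarrow> 'a set pair_pre_digraph" where
  "orientation_tree G N =
     \<lparr> pverts = part_of G ` consistent_orientations G N,
       parcs = {(part_of G Q, part_of G (flip u Q)) | Q u.
                  Q \<in> consistent_orientations G N \<and> u \<in> maximal_seps Q} \<rparr>"

text \<open>Orient towards \<open>K\<close> whatever has it on one side only, and add
  \<open>U\<close>: the members of an inconsistent pair would both have \<open>K\<close> on both
  sides and so lie in \<open>U\<close>. Single vertices and edges as \<open>K\<close> give the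
  covering axioms; \<open>U = {u}\<close> prescribes the side of a tree edge.\<close>

lemma (in nested_system) ex_part_containing:
  assumes K: "K \<subseteq> pverts G" "\<And>s. s \<in> N \<Longrightarrow> K \<subseteq> fst s \<or> K \<subseteq> snd s"
    and U: "U \<subseteq> N" "consistent G U" "\<And>u. u \<in> U \<Longrightarrow> K \<subseteq> snd u"
  shows "\<exists>Q\<in>orientations. U \<subseteq> Q \<and> K \<subseteq> part_of G Q"
proof -
  let ?F = "{s \<in> N. K \<subseteq> snd s \<and> \<not> K \<subseteq> fst s} \<union> U"
  have "\<not> sinv t \<preceq> s" if st: "s \<in> ?F" "t \<in> ?F" for s t
  proof
    assume le: "sinv t \<preceq> s"
    then have sub: "snd t \<subseteq> fst s" "snd s \<subseteq> fst t" by (simp_all add: sle_def)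
    have "K \<subseteq> snd s" "K \<subseteq> snd t" using st U(3) by blast+
    then have "s \<in> U" "t \<in> U" using st sub by blast+
    then show False using consistentD[OF U(2)] le by blast
  qed
  then have "consistent G ?F"
    using N_sep U(1) unfolding consistent_iff by blast
  then obtain Q where Q: "Q \<in> orientations" "?F \<subseteq> Q"
    using orientation_extends[of ?F] U(1) by blast
  have "K \<subseteq> snd s" if s: "s \<in> Q" for s
  proof (rule ccontr)
    assume n: "\<not> K \<subseteq> snd s"
    have sN: "s \<in> N" using orientationD(3)[OF Q(1) s] .
    then have "K \<subseteq> fst s" using K(2) n by blast
    then have "sinv s \<in> ?F" using N_sinv[OF sN] n by simp
    then show False using Q orientationD(5)[OF Q(1) s] by blast
  qed
  then have "K \<subseteq> part_of G Q" using K(1) unfolding part_of_def by blast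
  then show ?thesis using Q by blast
qed

locale injective_system = nested_system +
  assumes part_inj: "inj_on (part_of G) orientations"
begin

abbreviation OT where "OT \<equiv> orientation_tree G N"

lemma OT_simps:
  "pverts OT = part_of G ` orientations"
  "parcs OT = {(part_of G Q, part_of G (flip u Q)) | Q u. Q \<in> orientations \<and> u \<in> maximal_seps Q}"
  by (simp_all add: orientation_tree_def)

lemma part_eqD: "part_of G Q = part_of G Q' \<Longrightarrow> Q \<in> orientations \<Longrightarrow> Q' \<in> orientations \<Longrightarrow> Q = Q'"
  using inj_onD[OF part_inj] by blast

lemma flip_flip:
  assumes "Q \<in> orientations" "u \<in> Q" shows "flip (sinv u) (flip u Q) = Q"
  using orientationD(5)[OF assms] assms(2) by (auto simp: flip_def)

lemma finite_orientations: "finite orientations"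
  by (rule finite_subset[of _ "Pow N"]) (use orientationD(1) finite_N in auto)

lemma OT_arcI: "Q \<in> orientations \<Longrightarrow> u \<in> maximal_seps Q \<Longrightarrow> (part_of G Q, part_of G (flip u Q)) \<in> parcs OT"
  unfolding OT_simps by blast

lemma OT_arcE:
  assumes "e \<in> parcs OT"
  obtains Q u where "Q \<in> orientations" "u \<in> maximal_seps Q" "fst e = part_of G Q" "snd e = part_of G (flip u Q)"
  using assms unfolding OT_simps by force

lemma OT_pair_graph: "pair_graph OT"
proof -
  have sub: "parcs OT \<subseteq> pverts OT \<times> pverts OT"
    unfolding OT_simps using flip_orientation by blast
  have fin: "finite (pverts OT)" using finite_orientations by (simp add: OT_simps)
  have "(y, x) \<in> parcs OT" if xy: "(x, y) \<in> parcs OT" for x y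
  proof -
    obtain Q u where Q: "Q \<in> orientations" "u \<in> maximal_seps Q" "x = part_of G Q" "y = part_of G (flip u Q)"
      using OT_arcE[OF xy] by auto
    then show ?thesis
      using OT_arcI[OF flip_orientation[OF Q(1,2)]] flip_flip[OF Q(1) maximal_in[OF Q(2)]] by simp
  qed
  then have sym: "symmetric (with_proj OT)" unfolding symmetric_def with_proj_simps by (rule symI)
  have loop: "fst e \<noteq> snd e" if e: "e \<in> parcs OT" for e
  proof -
    obtain Q u where Q: "Q \<in> orientations" "u \<in> maximal_seps Q" "fst e = part_of G Q" "snd e = part_of G (flip u Q)"
      using OT_arcE[OF e] .
    have "flip u Q \<noteq> Q"
      using orientationD(5)[OF Q(1) maximal_in[OF Q(2)]] by (auto simp: flip_def)
    then show ?thesis using part_eqD[of Q "flip u Q"] Q flip_orientation(1)[OF Q(1,2)] by auto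
  qed
  show ?thesis
    by unfold_locales (use sub fin sym loop finite_subset[OF sub] in auto)
qed

text \<open>Induction on \<open>|Q - Q'|\<close>: a maximal element of \<open>Q\<close> outside \<open>Q'\<close> can be flipped.\<close>

lemma component_of_agree:
  assumes D: "pair_graph D" "pverts D = pverts OT" and K: "\<And>w. w \<in> K \<Longrightarrow> sinv w \<in> K"
    and arc: "\<And>Q w. Q \<in> orientations \<Longrightarrow> w \<in> maximal_seps Q \<Longrightarrow> w \<notin> K \<Longrightarrow>
      (part_of G Q, part_of G (flip w Q)) \<in> parcs D"
    and Q: "Q \<in> orientations" "Q' \<in> orientations" "Q \<inter> K = Q' \<inter> K"
  shows "part_of G Q' \<in> component_of D (part_of G Q)"
  using Q
proof (induction "card (Q - Q')" arbitrary: Q rule: less_induct)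
  case less
  interpret D: pair_graph D by (rule D)
  show ?case
  proof (cases "Q = Q'")
    case True
    then show ?thesis using D.component_of_refl less.prems by (simp add: D(2) OT_simps)
  next
    case False
    obtain w where w: "w \<in> maximal_seps Q" "w \<notin> Q'"
      using ex_maximal_diff[OF less.prems(1,2) False] by blast
    have wK: "w \<notin> K" "sinv w \<notin> K" using w maximal_in[OF w(1)] less.prems(3) K[of "sinv w"] by auto
    have sw: "sinv w \<in> Q'"
      using orientationD(4)[OF less.prems(2) orientationD(3)[OF less.prems(1) maximal_in[OF w(1)]] w(2)] .
    have "flip w Q - Q' = Q - Q' - {w}" using sw by (auto simp: flip_def)
    moreover have "w \<in> Q - Q'" using w maximal_in by blast
    ultimately have "card (flip w Q - Q') < card (Q - Q')"
      using finite_orientation[OF less.prems(1)] by (metis card_Diff1_less finite_Diff)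
    moreover have "flip w Q \<inter> K = Q' \<inter> K" using less.prems(3) wK by (auto simp: flip_def)
    ultimately have 1: "part_of G Q' \<in> component_of D (part_of G (flip w Q))"
      using less.hyps flip_orientation(1)[OF less.prems(1) w(1)] less.prems(2) by blast
    have "part_of G Q \<in> pverts D" using less.prems(1) by (simp add: D(2) OT_simps)
    then have "part_of G (flip w Q) \<in> component_of D (part_of G Q)"
      using D.component_of_arc[OF D.component_of_refl arc[OF less.prems(1) w(1) wK(1)]] by blast
    then show ?thesis using 1 D.component_of_trans by blast
  qed
qed

text \<open>Only one node has \<open>u\<close> as a maximal element, so the edge \<open>e\<close> is
  the only one that changes the orientation of \<open>u\<close>. Nodes containing \<open>u\<close>
  are connected by flips of other separations, and no remaining arc leaves them.\<close>

lemma OT_component: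
  assumes Q: "Q \<in> orientations" and u: "u \<in> maximal_seps Q" and e: "e = (part_of G Q, part_of G (flip u Q))"
  shows "component_of (delete_edge OT e) (part_of G Q) = part_of G ` {R \<in> orientations. u \<in> R}"
proof
  interpret D: pair_graph "delete_edge OT e" by (rule pair_graph_delete_edge[OF OT_pair_graph])
  note fQ = flip_orientation[OF Q u] and uQ = maximal_in[OF u]
  have uN: "u \<in> N" using orientationD(3)[OF Q uQ] .
  \<comment> \<open>Such an arc changes only the orientation of \<open>w\<close>, whereas
    \<open>e\<close> changes that of \<open>u\<close>.\<close>
  have keep: "(part_of G R, part_of G (flip w R)) \<in> parcs (delete_edge OT e)"
    if R: "R \<in> orientations" "w \<in> maximal_seps R" "w \<notin> {u, sinv u}" for R w
  proof -
    note fR = flip_orientation[OF R(1,2)] and wR = maximal_in[OF R(2)]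
    have wR': "sinv w \<notin> R" using orientationD(5)[OF R(1) wR] .
    have 1: "w \<in> R" "w \<notin> flip w R" using wR wR' by (auto simp: flip_def)
    have 2: "x = w \<or> x = sinv w" if "(x \<in> R) \<noteq> (x \<in> flip w R)" for x
      using that by (auto simp: flip_def)
    have 3: "u \<notin> flip u Q" "u \<in> Q" using uQ orientationD(5)[OF Q uQ] by (auto simp: flip_def)
    have "u \<noteq> w" "u \<noteq> sinv w" using R(3) by auto
    then have "\<not> (R = Q \<and> flip w R = flip u Q)" "\<not> (flip w R = Q \<and> R = flip u Q)"
      using 2[of u] 3 by auto
    then have "\<not> (part_of G R = part_of G Q \<and> part_of G (flip w R) = part_of G (flip u Q))"
      "\<not> (part_of G (flip w R) = part_of G Q \<and> part_of G R = part_of G (flip u Q))"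
      using part_eqD R(1) fR(1) Q fQ(1) by blast+
    then show ?thesis using OT_arcI[OF R(1,2)] e by auto
  qed
  show "part_of G ` {R \<in> orientations. u \<in> R} \<subseteq> component_of (delete_edge OT e) (part_of G Q)"
  proof
    fix x assume "x \<in> part_of G ` {R \<in> orientations. u \<in> R}"
    then obtain R where R: "R \<in> orientations" "u \<in> R" "x = part_of G R" by blast
    have "Q \<inter> {u, sinv u} = R \<inter> {u, sinv u}"
      using R(2) uQ orientationD(5)[OF Q uQ] orientationD(5)[OF R(1,2)] by blast
    then show "x \<in> component_of (delete_edge OT e) (part_of G Q)"
      unfolding R(3)
    proof (rule component_of_agree[rotated -1])
      show "pair_graph (delete_edge OT e)" by (rule pair_graph_delete_edge[OF OT_pair_graph])
      show "sinv w \<in> {u, sinv u}" if "w \<in> {u, sinv u}" for w using that by auto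
    qed (use keep Q R in simp_all)
  qed
  show "component_of (delete_edge OT e) (part_of G Q) \<subseteq> part_of G ` {R \<in> orientations. u \<in> R}"
  proof
    fix x assume "x \<in> component_of (delete_edge OT e) (part_of G Q)"
    then show "x \<in> part_of G ` {R \<in> orientations. u \<in> R}"
    proof (induction rule: D.component_of_induct)
      case base
      then show ?case using Q uQ by blast
    next
      case (step x y)
      then have xy: "(x, y) \<in> parcs OT" "(x, y) \<noteq> e" by auto
      obtain R w where R: "R \<in> orientations" "w \<in> maximal_seps R" "x = part_of G R" "y = part_of G (flip w R)"
        using OT_arcE[OF xy(1)] by auto
      obtain R' where R': "R' \<in> orientations" "u \<in> R'" "x = part_of G R'" using step(3) by blast
      then have uR: "u \<in> R" using part_eqD[of R R'] R by simp
      have "w \<noteq> u"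
      proof
        assume "w = u"
        then have "R = Q" using maximal_unique[OF R(1) Q] R(2) u by blast
        then show False using xy(2) e R \<open>w = u\<close> by blast
      qed
      then have "u \<in> flip w R" using uR by (simp add: flip_def)
      then show ?case using R(4) flip_orientation(1)[OF R(1,2)] by blast
    qed
  qed
qed

lemma OT_bridge:
  assumes Q: "Q \<in> orientations" and u: "u \<in> maximal_seps Q" and e: "e = (part_of G Q, part_of G (flip u Q))"
  shows "beyond OT (prod.swap e) = part_of G ` {R \<in> orientations. u \<in> R}"
    "beyond OT e = part_of G ` {R \<in> orientations. sinv u \<in> R}"
proof -
  show "beyond OT (prod.swap e) = part_of G ` {R \<in> orientations. u \<in> R}"
    using OT_component[OF Q u e] unfolding beyond_def delete_edge_swap by (simp add: e)
  note f = flip_orientation[OF Q u]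
  have "component_of (delete_edge OT (prod.swap e)) (part_of G (flip u Q)) = part_of G ` {R \<in> orientations. sinv u \<in> R}"
    by (rule OT_component[OF f]) (simp add: e flip_flip[OF Q maximal_in[OF u]])
  then show "beyond OT e = part_of G ` {R \<in> orientations. sinv u \<in> R}"
    unfolding beyond_def delete_edge_swap by (simp add: e)
qed

lemma OT_tree: "pair_tree OT"
proof -
  interpret OT: pair_graph OT by (rule OT_pair_graph)
  have "part_of G Q' \<in> component_of OT (part_of G Q)" if "Q \<in> orientations" "Q' \<in> orientations" for Q Q'
    by (rule component_of_agree[where K = "{}"]) (use that OT_arcI OT_pair_graph in auto)
  moreover have "orientations \<noteq> {}" using orientation_extends[of "{}"] by (auto simp: consistent_iff)
  ultimately have con: "connected (with_proj OT)" unfolding OT.connected_iff by (auto simp: OT_simps)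
  have "fst e \<notin> component_of (delete_edge OT e) (snd e)" if e: "e \<in> parcs OT" for e
  proof
    assume "fst e \<in> component_of (delete_edge OT e) (snd e)"
    then have *: "fst e \<in> beyond OT e" by (simp add: beyond_def)
    obtain Q u where Q: "Q \<in> orientations" "u \<in> maximal_seps Q" "fst e = part_of G Q" "snd e = part_of G (flip u Q)"
      using OT_arcE[OF e] .
    have "e = (part_of G Q, part_of G (flip u Q))" using Q by (simp add: prod_eq_iff)
    then obtain R where "R \<in> orientations" "sinv u \<in> R" "part_of G Q = part_of G R"
      using * OT_bridge(2)[OF Q(1,2)] Q(3) by auto
    then show False using part_eqD[of Q R] Q(1) orientationD(5)[OF Q(1) maximal_in[OF Q(2)]] by blast
  qed
  then have "\<not> (\<exists>p. OT.cycle p \<and> length p \<ge> 3)" by (rule OT.no_cycle_if_bridges)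
  then show ?thesis
    unfolding pair_tree_def pair_tree_axioms_def using OT_pair_graph con by blast
qed

lemma OT_union_parts:
  assumes u: "u \<in> N" shows "(\<Union>X\<in>part_of G ` {R \<in> orientations. u \<in> R}. X) = snd u"
proof
  show "(\<Union>X\<in>part_of G ` {R \<in> orientations. u \<in> R}. X) \<subseteq> snd u"
    by (auto simp: part_of_iff)
  show "snd u \<subseteq> (\<Union>X\<in>part_of G ` {R \<in> orientations. u \<in> R}. X)"
  proof
    fix x assume x: "x \<in> snd u"
    have "consistent G {u}" using N_sep[OF u] proper_not_sle_sinv[OF N_proper[OF u]] by (simp add: consistent_iff)
    moreover have xV: "x \<in> pverts G" using x separation_subset(2)[OF N_sep[OF u]] by blast
    moreover have "{x} \<subseteq> fst s \<or> {x} \<subseteq> snd s" if "s \<in> N" for s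
      using separation_Un[OF N_sep[OF that]] xV by blast
    ultimately obtain Q where "Q \<in> orientations" "u \<in> Q" "x \<in> part_of G Q"
      using ex_part_containing[of "{x}" "{u}"] u x by auto
    then show "x \<in> (\<Union>X\<in>part_of G ` {R \<in> orientations. u \<in> R}. X)" by blast
  qed
qed

lemma OT_edge_sep:
  assumes Q: "Q \<in> orientations" and u: "u \<in> maximal_seps Q"
  shows "edge_sep OT (\<lambda>X. X) (part_of G Q, part_of G (flip u Q)) = sinv u"
proof -
  have uN: "u \<in> N" using orientationD(3)[OF Q maximal_in[OF u]] .
  show ?thesis
    unfolding edge_sep_beyond OT_bridge[OF Q u refl] OT_union_parts[OF uN] OT_union_parts[OF N_sinv[OF uN]]
    by (simp add: prod_eq_iff)
qed


theorem OT_td: "td_of_seps G N OT (\<lambda>X. X)"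
proof -
  interpret OT: pair_tree OT by (rule OT_tree)
  have path: "X1 \<inter> X3 \<subseteq> X2" if p: "OT.apath X1 p X3" "X2 \<in> set (pawalk_verts X1 p)" for X1 X2 X3 p
  proof (rule ccontr)
    assume "\<not> X1 \<inter> X3 \<subseteq> X2"
    then obtain x where x: "x \<in> X1" "x \<in> X3" "x \<notin> X2" by blast
    have w: "OT.awalk X1 p X3" using p by (simp add: OT.apath_def)
    have V: "X1 \<in> pverts OT" "X2 \<in> pverts OT" "X3 \<in> pverts OT"
      using p(2) w OT.awalk_hd_in_verts[OF w] OT.awalk_last_in_verts[OF w] by auto
    obtain Q1 Q2 Q3 where Q: "Q1 \<in> orientations" "X1 = part_of G Q1" "Q2 \<in> orientations" "X2 = part_of G Q2"
      "Q3 \<in> orientations" "X3 = part_of G Q3"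
      using V unfolding OT_simps by blast
    \<comment> \<open>\<open>s\<close> belongs to the orientation at \<open>X2\<close> but, because
      of \<open>x\<close>, to neither of those at the ends; so the walk has to flip it before
      \<open>X2\<close> and back afterwards.\<close>
    obtain s where s: "s \<in> Q2" "x \<notin> snd s" using x Q by (auto simp: part_of_iff)
    have n: "s \<notin> Q1" "s \<notin> Q3" using x s Q by (auto simp: part_of_iff)
    let ?in = "\<lambda>X. \<exists>Q\<in>orientations. X = part_of G Q \<and> s \<in> Q"
    have in_iff: "?in (part_of G Q) \<longleftrightarrow> s \<in> Q" if "Q \<in> orientations" for Q
      using that part_eqD by blast
    obtain q r where qr: "p = q @ r" "OT.awalk X1 q X2" "OT.awalk X2 r X3"
      using OT.awalk_decomp[OF w p(2)] by blast
    obtain e where e: "e \<in> set q" "\<not> ?in (fst e)" "?in (snd e)"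
      using OT.awalk_crossing[OF qr(2), of "\<lambda>X. \<not> ?in X"] n(1) s(1) in_iff[OF Q(1)] in_iff[OF Q(3)]
      unfolding Q(2,4) by blast
    obtain f where f: "f \<in> set r" "?in (fst f)" "\<not> ?in (snd f)"
      using OT.awalk_crossing[OF qr(3), of ?in] n(2) s(1) in_iff[OF Q(3)] in_iff[OF Q(5)]
      unfolding Q(4,6) by blast
    have ef: "e \<in> parcs OT" "f \<in> parcs OT" using e(1) f(1) qr(2,3) by (auto simp: OT.awalk_def)
    obtain R u where R: "R \<in> orientations" "u \<in> maximal_seps R" "fst e = part_of G R" "snd e = part_of G (flip u R)"
      using OT_arcE[OF ef(1)] .
    have "s \<notin> R" "s \<in> flip u R"
      using e(2,3) unfolding R(3,4) in_iff[OF R(1)] in_iff[OF flip_orientation(1)[OF R(1,2)]] .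
    then have su: "u = sinv s" by (auto simp: flip_def)
    obtain R' v where R': "R' \<in> orientations" "v \<in> maximal_seps R'" "fst f = part_of G R'" "snd f = part_of G (flip v R')"
      using OT_arcE[OF ef(2)] .
    note fR' = flip_orientation[OF R'(1,2)]
    have "s \<in> R'" "s \<notin> flip v R'"
      using f(2,3) unfolding R'(3,4) in_iff[OF R'(1)] in_iff[OF fR'(1)] .
    then have sv: "v = s" by (auto simp: flip_def)
    \<comment> \<open>Only one edge flips \<open>s\<close>, so the path uses it in both directions
      and visits a node twice.\<close>
    have "R = flip v R'"
      using maximal_unique[OF R(1) fR'(1)] R(2) fR'(2) su sv by blast
    then have eq: "fst e = snd f" using R(3) R'(4) by simp
    have "fst e \<in> set (pawalk_verts X1 q)" using OT.awalk_verts_arc1[OF e(1)] .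
    \<comment> \<open>The tail omits \<open>X2\<close>, which both halves of the path
      contain.\<close>
    moreover have "snd f \<in> set (tl (pawalk_verts X2 r))"
    proof -
      have "pcas X2 r X3" using qr(3) by (simp add: OT.awalk_def)
      moreover have "r \<noteq> []" using f(1) by auto
      ultimately have "tl (pawalk_verts X2 r) = map snd r" using OT.awalk_verts_conv'[of X2 r X3] by simp
      then show ?thesis using f(1) by simp
    qed
    moreover have "last (pawalk_verts X1 q) = X2" using qr(2) by (rule OT.awlast_of_awalk) simp
    then have "set (pawalk_verts X1 q) \<inter> set (tl (pawalk_verts X2 r)) = {}"
      using p(1) unfolding qr(1) OT.apath_append_iff by simp
    ultimately show False using eq by auto
  qed
  have cover: "\<exists>X\<in>pverts OT. K \<subseteq> X" if "K \<subseteq> pverts G" "\<And>s. s \<in> N \<Longrightarrow> K \<subseteq> fst s \<or> K \<subseteq> snd s" for K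
    using ex_part_containing[OF that, of "{}"] unfolding OT_simps by (auto simp: consistent_iff)
  have union: "(\<Union>X\<in>pverts OT. X) = pverts G"
  proof
    show "(\<Union>X\<in>pverts OT. X) \<subseteq> pverts G" unfolding OT_simps by (auto simp: part_of_iff)
    show "pverts G \<subseteq> (\<Union>X\<in>pverts OT. X)"
    proof
      fix x assume x: "x \<in> pverts G"
      have "{x} \<subseteq> fst s \<or> {x} \<subseteq> snd s" if "s \<in> N" for s
        using separation_Un[OF N_sep[OF that]] x by blast
      then show "x \<in> (\<Union>X\<in>pverts OT. X)" using cover[of "{x}"] x by blast
    qed
  qed
  have "\<exists>X\<in>pverts OT. a \<in> X \<and> b \<in> X" if ab: "(a, b) \<in> parcs G" for a b
  proof -
    have V: "a \<in> pverts G" "b \<in> pverts G" using ab in_arcsD1 in_arcsD2 by blast+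
    have "{a, b} \<subseteq> fst s \<or> {a, b} \<subseteq> snd s" if "s \<in> N" for s
      using separation_arc[OF N_sep[OF that] ab] by blast
    then show ?thesis using cover[of "{a, b}"] V by blast
  qed
  then have "\<forall>(a, b)\<in>parcs G. \<exists>X\<in>pverts OT. a \<in> X \<and> b \<in> X" by blast
  moreover have "\<forall>X1 X2 X3 p. OT.apath X1 p X3 \<and> X2 \<in> set (pawalk_verts X1 p) \<longrightarrow> X1 \<inter> X3 \<subseteq> X2"
    using path by blast
  ultimately have "tree_decomposition G OT (\<lambda>X. X)"
    unfolding tree_decomposition_def tree_graph_iff awalk_verts_with_proj_eq
    using OT_tree union by (intro conjI)
  moreover have "edge_sep OT (\<lambda>X. X) ` parcs OT = N"
  proof
    show "edge_sep OT (\<lambda>X. X) ` parcs OT \<subseteq> N"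
    proof
      fix w assume "w \<in> edge_sep OT (\<lambda>X. X) ` parcs OT"
      then obtain Q u where Q: "Q \<in> orientations" "u \<in> maximal_seps Q"
        "w = edge_sep OT (\<lambda>X. X) (part_of G Q, part_of G (flip u Q))"
        unfolding OT_simps by blast
      then show "w \<in> N" using OT_edge_sep[OF Q(1,2)] N_sinv[OF orientationD(3)[OF Q(1) maximal_in[OF Q(2)]]] by simp
    qed
    show "N \<subseteq> edge_sep OT (\<lambda>X. X) ` parcs OT"
    proof
      fix w assume w: "w \<in> N"
      obtain Q where Q: "Q \<in> orientations" "sinv w \<in> maximal_seps Q"
        using ex_maximal_orientation[OF N_sinv[OF w]] by blast
      have "w = edge_sep OT (\<lambda>X. X) (part_of G Q, part_of G (flip (sinv w) Q))"
        using OT_edge_sep[OF Q] by simp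
      then show "w \<in> edge_sep OT (\<lambda>X. X) ` parcs OT" using OT_arcI[OF Q] by (rule image_eqI)
    qed
  qed
  moreover have "inj_on (edge_sep OT (\<lambda>X. X)) (parcs OT)"
  proof (rule inj_onI)
    fix e f assume ef: "e \<in> parcs OT" "f \<in> parcs OT" "edge_sep OT (\<lambda>X. X) e = edge_sep OT (\<lambda>X. X) f"
    obtain Q u where Q: "Q \<in> orientations" "u \<in> maximal_seps Q" "fst e = part_of G Q" "snd e = part_of G (flip u Q)"
      using OT_arcE[OF ef(1)] .
    obtain R v where R: "R \<in> orientations" "v \<in> maximal_seps R" "fst f = part_of G R" "snd f = part_of G (flip v R)"
      using OT_arcE[OF ef(2)] .
    have eq: "e = (part_of G Q, part_of G (flip u Q))" "f = (part_of G R, part_of G (flip v R))"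
      using Q R by (simp_all add: prod_eq_iff)
    then have "sinv u = sinv v"
      using ef(3) unfolding eq OT_edge_sep[OF Q(1,2)] OT_edge_sep[OF R(1,2)] by simp
    then have "u = v" by (metis swap_swap)
    then have "Q = R" using maximal_unique[OF Q(1) R(1) Q(2)] R(2) by simp
    then show "e = f" using \<open>u = v\<close> eq by simp
  qed
  ultimately show ?thesis unfolding td_of_seps_def by simp
qed

end

section \<open>Invariance under isomorphisms\<close>

lemma profile_iff_sjoin:
  "profile K R \<longleftrightarrow> consistent K R \<and> (\<forall>s\<in>R. \<forall>t\<in>R. sinv (sjoin s t) \<notin> R)"
  unfolding profile_def sjoin_def by force

text \<open>Profiles and the recursion are expressed through the preserved data, so they commute
  with any such bijection. All conditions are restricted to separations, because a graph isomorphism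
  is controlled only on the vertices of \<open>G\<close>.\<close>

locale sep_iso = G: pair_graph G + H: pair_graph H
  for G :: "'a pair_pre_digraph" and H :: "'b pair_pre_digraph" +
  fixes f :: "'a sep \<Rightarrow> 'b sep"
  assumes bij: "bij_betw f {s. separation G s} {s. separation H s}"
    and f_sinv: "\<And>s. separation G s \<Longrightarrow> f (sinv s) = sinv (f s)"
    and f_sle: "\<And>s t. separation G s \<Longrightarrow> separation G t \<Longrightarrow> f s \<preceq> f t \<longleftrightarrow> s \<preceq> t"
    and f_sjoin: "\<And>s t. separation G s \<Longrightarrow> separation G t \<Longrightarrow> f (sjoin s t) = sjoin (f s) (f t)"
    and f_sorder: "\<And>s. separation G s \<Longrightarrow> sorder (f s) = sorder s"
    and f_proper: "\<And>s. separation G s \<Longrightarrow> proper_sep (f s) \<longleftrightarrow> proper_sep s"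
begin

abbreviation seps :: "'a sep set" where "seps \<equiv> {s. separation G s}"

lemma inj: "inj_on f seps" and surj: "f ` seps = {s. separation H s}"
  using bij by (simp_all add: bij_betw_def)

lemma f_sep: "separation G s \<Longrightarrow> separation H (f s)"
  using surj by blast

lemma mem: "X \<subseteq> seps \<Longrightarrow> separation G s \<Longrightarrow> f s \<in> f ` X \<longleftrightarrow> s \<in> X"
  using inj_on_image_mem_iff[OF inj] by simp

lemma sinv_mem: "X \<subseteq> seps \<Longrightarrow> separation G s \<Longrightarrow> sinv (f s) \<in> f ` X \<longleftrightarrow> sinv s \<in> X"
  using mem[of X "sinv s"] by (simp add: f_sinv)

lemma image_eq: "X \<subseteq> seps \<Longrightarrow> Y \<subseteq> seps \<Longrightarrow> f ` X = f ` Y \<longleftrightarrow> X = Y"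
  using inj_on_image_eq_iff[OF inj] by simp

lemma f_nested: "separation G s \<Longrightarrow> separation G t \<Longrightarrow> nested_sep (f s) (f t) \<longleftrightarrow> nested_sep s t"
  using f_sle[of s t] f_sle[of t s] f_sle[of s "sinv t"] f_sle[of "sinv t" s]
  by (simp add: nested_sep_def f_sinv)

lemma f_nested_with: "separation G s \<Longrightarrow> X \<subseteq> seps \<Longrightarrow> nested_with (f s) (f ` X) \<longleftrightarrow> nested_with s X"
  using f_nested unfolding nested_with_def by blast

lemma f_consistent:
  assumes X: "X \<subseteq> seps" shows "consistent H (f ` X) \<longleftrightarrow> consistent G X"
proof -
  have "sinv (f t) \<preceq> f s \<longleftrightarrow> sinv t \<preceq> s" if "s \<in> X" "t \<in> X" for s t
  proof -
    have "separation G s" "separation G t" using that X by blast+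
    then show ?thesis using f_sle[of "sinv t" s] by (simp add: f_sinv)
  qed
  moreover have "\<forall>s\<in>f ` X. separation H s" "\<forall>s\<in>X. separation G s" using X f_sep by blast+
  ultimately show ?thesis
    unfolding H.consistent_iff G.consistent_iff by blast
qed

lemma f_antisymmetric: "X \<subseteq> seps \<Longrightarrow> antisymmetric_seps (f ` X) \<longleftrightarrow> antisymmetric_seps X"
  using sinv_mem unfolding antisymmetric_seps_def by blast

lemma f_orients:
  assumes X: "X \<subseteq> seps" "S \<subseteq> seps" shows "orients (f ` X) (f ` S) \<longleftrightarrow> orients X S"
proof -
  have "(f s \<in> f ` X \<or> sinv (f s) \<in> f ` X \<inter> f ` S) \<longleftrightarrow> (s \<in> X \<or> sinv s \<in> X \<inter> S)" if "s \<in> S" for s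
    using mem[OF X(1), of s] sinv_mem[OF X(1), of s] sinv_mem[OF X(2), of s] that X by blast
  then show ?thesis
    unfolding orients_def f_antisymmetric[OF X(1)] by blast
qed

lemma f_orientations:
  assumes N: "N \<subseteq> seps"
  shows "consistent_orientations H (f ` N) = (`) f ` consistent_orientations G N"
proof -
  have *: "f ` Q \<in> consistent_orientations H (f ` N) \<longleftrightarrow> Q \<in> consistent_orientations G N" if "Q \<subseteq> N" for Q
    using that N f_orients[of Q N] f_consistent[of Q] unfolding consistent_orientations_def by blast
  show ?thesis
  proof (intro equalityI subsetI)
    fix Q' assume Q': "Q' \<in> consistent_orientations H (f ` N)"
    then have "Q' \<subseteq> f ` N" by (simp add: consistent_orientations_def)
    then obtain Q where "Q \<subseteq> N" "Q' = f ` Q" by (auto simp: subset_image_iff)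
    then show "Q' \<in> (`) f ` consistent_orientations G N" using * Q' by blast
  next
    fix Q' assume "Q' \<in> (`) f ` consistent_orientations G N"
    then obtain Q where "Q \<in> consistent_orientations G N" "Q' = f ` Q" by blast
    then show "Q' \<in> consistent_orientations H (f ` N)"
      using *[of Q] by (simp add: consistent_orientations_def)
  qed
qed

lemma f_distinguishes:
  assumes "separation G s" "P \<subseteq> seps" "P' \<subseteq> seps"
  shows "distinguishes (f s) (f ` P) (f ` P') \<longleftrightarrow> distinguishes s P P'"
  unfolding distinguishes_def Diff_iff
  using mem[OF assms(2,1)] mem[OF assms(3,1)] sinv_mem[OF assms(2,1)] sinv_mem[OF assms(3,1)] by simp

text \<open>Reduction, splitting and the operations select elements by predicates, so they are
  transported by comparing the predicates elementwise.\<close>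

lemma f_filter:
  assumes "\<And>s. s \<in> S \<Longrightarrow> p (f s) \<longleftrightarrow> q s" shows "{s \<in> f ` S. p s} = f ` {s \<in> S. q s}"
  using assms by blast

lemma f_reduction:
  assumes S: "S \<subseteq> seps" and P: "\<And>P. P \<in> \<P> \<Longrightarrow> P \<subseteq> seps"
  shows "reduction (f ` S) ((`) f ` \<P>) = f ` reduction S \<P>"
  unfolding reduction_def
proof (rule f_filter)
  fix s assume "s \<in> S"
  then have "distinguishes (f s) (f ` P) (f ` P') \<longleftrightarrow> distinguishes s P P'" if "P \<in> \<P>" "P' \<in> \<P>" for P P'
    using f_distinguishes[of s P P'] S P that by blast
  then show "(\<exists>P\<in>(`) f ` \<P>. \<exists>P'\<in>(`) f ` \<P>. distinguishes (f s) P P') \<longleftrightarrow> (\<exists>P\<in>\<P>. \<exists>P'\<in>\<P>. distinguishes s P P')"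
    by blast
qed

lemma f_splitting:
  assumes S: "S \<subseteq> seps" and Q: "Q \<subseteq> seps"
  shows "splitting H (f ` S) (f ` Q) = f ` splitting G S Q"
  unfolding splitting_def
proof (rule f_filter)
  fix s assume "s \<in> S"
  then have s: "separation G s" using S by blast
  have eq: "f ` Q \<union> {f s} = f ` (Q \<union> {s})" "f ` Q \<union> {sinv (f s)} = f ` (Q \<union> {sinv s})"
    using f_sinv[OF s] by auto
  have "Q \<union> {s} \<subseteq> seps" "Q \<union> {sinv s} \<subseteq> seps" using Q s by auto
  then show "splits H (f s) (f ` Q) \<longleftrightarrow> splits G s Q"
    unfolding splits_def eq by (simp only: f_consistent)
qed

lemma f_inducing:
  assumes N: "N \<subseteq> seps" "Q \<subseteq> seps" and P: "\<And>P. P \<in> \<P> \<Longrightarrow> P \<subseteq> seps"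
  shows "inducing ((`) f ` \<P>) (f ` N) (f ` Q) = (`) f ` inducing \<P> N Q"
proof -
  have "f ` P \<inter> f ` N = f ` Q \<longleftrightarrow> P \<inter> N = Q" if "P \<in> \<P>" for P
  proof -
    have "f ` P \<inter> f ` N = f ` (P \<inter> N)"
      using inj_on_image_Int[OF inj P[OF that] N(1)] by simp
    then show ?thesis using image_eq[of "P \<inter> N" Q] N by auto
  qed
  then show ?thesis unfolding inducing_def by blast
qed

lemma f_maximal: "S \<subseteq> seps \<Longrightarrow> maximal_seps (f ` S) = f ` maximal_seps S"
proof -
  assume S: "S \<subseteq> seps"
  show ?thesis
    unfolding maximal_seps_def
  proof (rule f_filter)
    fix s assume s: "s \<in> S"
    have "(f s \<preceq> f t \<longrightarrow> f t = f s) \<longleftrightarrow> (s \<preceq> t \<longrightarrow> t = s)" if "t \<in> S" for t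
      using f_sle[of s t] inj_on_eq_iff[OF inj, of t s] s that S by blast
    then show "(\<forall>t\<in>f ` S. f s \<preceq> t \<longrightarrow> t = f s) \<longleftrightarrow> (\<forall>t\<in>S. s \<preceq> t \<longrightarrow> t = s)"
      by blast
  qed
qed

lemma f_apply_op:
  assumes S: "S \<subseteq> seps" and P: "\<And>P. P \<in> \<P> \<Longrightarrow> P \<subseteq> seps"
  shows "apply_op op (f ` S) ((`) f ` \<P>) = f ` apply_op op S \<P>"
proof -
  have sym: "f ` A \<union> sinv ` f ` A = f ` (A \<union> sinv ` A)" if "A \<subseteq> seps" for A
  proof -
    have "sinv ` f ` A = f ` sinv ` A"
      unfolding image_image using that f_sinv by (intro image_cong) auto
    then show ?thesis by blast
  qed
  have ext: "ext_seps (f ` S) = f ` ext_seps S" if S: "S \<subseteq> seps" for S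
  proof -
    have "(f t \<preceq> f s \<or> sinv (f t) \<preceq> f s) \<longleftrightarrow> (t \<preceq> s \<or> sinv t \<preceq> s)" if "s \<in> S" "t \<in> S" for s t
    proof -
      have "separation G s" "separation G t" using that S by blast+
      then show ?thesis using f_sle[of t s] f_sle[of "sinv t" s] by (simp add: f_sinv)
    qed
    then have "{s \<in> f ` S. \<forall>t\<in>f ` S. t \<preceq> s \<or> sinv t \<preceq> s} = f ` {s \<in> S. \<forall>t\<in>S. t \<preceq> s \<or> sinv t \<preceq> s}"
      by (intro f_filter) blast
    then have "{s. extremal (f ` S) s} = f ` {s. extremal S s}"
      unfolding extremal_def by simp
    moreover have "{s. extremal S s} \<subseteq> seps" using S unfolding extremal_def by blast
    ultimately show ?thesis unfolding ext_seps_def using sym by simp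
  qed
  have loc: "loc_seps (f ` S) ((`) f ` \<P>) = f ` loc_seps S \<P>" if S: "S \<subseteq> seps" for S
  proof -
    have PS: "f ` P \<inter> f ` S = f ` (P \<inter> S)" "maximal_seps (f ` P \<inter> f ` S) = f ` maximal_seps (P \<inter> S)"
      if "P \<in> \<P>" for P
    proof -
      show "f ` P \<inter> f ` S = f ` (P \<inter> S)"
        using inj_on_image_Int[OF inj P[OF that] S] by simp
      then show "maximal_seps (f ` P \<inter> f ` S) = f ` maximal_seps (P \<inter> S)"
        using f_maximal[of "P \<inter> S"] S by auto
    qed
    have ms: "maximal_seps (P \<inter> S) \<subseteq> seps" for P using S unfolding maximal_seps_def by blast
    have ws: "well_separated (f ` S) (f ` P) \<longleftrightarrow> well_separated S P" if "P \<in> \<P>" for P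
    proof -
      have "nested_sep (f s) (f t) \<longleftrightarrow> nested_sep s t"
        if "s \<in> maximal_seps (P \<inter> S)" "t \<in> maximal_seps (P \<inter> S)" for s t
        using f_nested[of s t] ms[of P] that by blast
      then show ?thesis unfolding well_separated_def PS(2)[OF that] nested_set_def by blast
    qed
    have "{s. locally_maximal (f ` S) ((`) f ` \<P>) s} =
        (\<Union>P\<in>{P\<in>\<P>. well_separated (f ` S) (f ` P)}. maximal_seps (f ` P \<inter> f ` S))"
      unfolding locally_maximal_def by blast
    also have "\<dots> = (\<Union>P\<in>{P\<in>\<P>. well_separated S P}. f ` maximal_seps (P \<inter> S))"
      using ws PS(2) by (intro SUP_cong) auto
    also have "\<dots> = f ` {s. locally_maximal S \<P> s}"
      unfolding locally_maximal_def by blast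
    finally have "{s. locally_maximal (f ` S) ((`) f ` \<P>) s} = f ` {s. locally_maximal S \<P> s}" .
    moreover have "{s. locally_maximal S \<P> s} \<subseteq> seps" using ms unfolding locally_maximal_def by blast
    ultimately show ?thesis unfolding loc_seps_def using sym by simp
  qed
  have all: "all_seps (f ` S) = f ` all_seps S" if S: "S \<subseteq> seps" for S
    unfolding all_seps_def
  proof (rule f_filter)
    show "nested_with (f s) (f ` S) \<longleftrightarrow> nested_with s S" if "s \<in> S" for s
      using f_nested_with[of s S] S that by blast
  qed
  have R: "reduction S \<P> \<subseteq> seps" using reduction_subset S by blast
  show ?thesis
    by (cases op) (simp_all add: ext[OF S] loc[OF S] all[OF S] f_reduction[OF assms] ext[OF R] loc[OF R] all[OF R])
qed

lemma feasible_seps: "G.feasible S \<P> \<Longrightarrow> S \<subseteq> seps" "G.feasible S \<P> \<Longrightarrow> P \<in> \<P> \<Longrightarrow> P \<subseteq> seps"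
  using G.feasible_sepD G.feasible_consistent G.consistent_sepD by blast+

text \<open>The equations of \<open>N_strat\<close> on the side of \<open>H\<close> rest on
  termination there, which is proved for feasible tasks.\<close>

lemma f_feasible:
  assumes fe: "G.feasible S \<P>" shows "H.feasible (f ` S) ((`) f ` \<P>)"
proof -
  note S = feasible_seps(1)[OF fe] and P = feasible_seps(2)[OF fe]
  have sepS: "separation G s" if "s \<in> S" for s using that S by blast
  show ?thesis
    unfolding H.feasible_def
  proof (intro conjI ballI impI)
    fix s' assume "s' \<in> f ` S"
    then obtain s where s: "s \<in> S" "s' = f s" by blast
    show "separation H s'" using f_sep[OF sepS[OF s(1)]] s(2) by simp
    show "proper_sep s'" using f_proper[OF sepS[OF s(1)]] G.feasible_properD[OF fe s(1)] s(2) by simp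
    show "sinv s' \<in> f ` S"
      using f_sinv[OF sepS[OF s(1)]] G.feasible_sinv[OF fe s(1)] s(2) by (metis image_eqI)
  next
    fix P' assume "P' \<in> (`) f ` \<P>"
    then obtain Q where Q: "Q \<in> \<P>" "P' = f ` Q" by blast
    show "consistent H P'" using f_consistent[OF P[OF Q(1)]] G.feasible_consistent[OF fe Q(1)] Q(2) by simp
    have "orients Q S" using fe Q(1) by (simp add: G.feasible_def)
    then show "orients P' (f ` S)" using f_orients[OF P[OF Q(1)] S] Q(2) by simp
  next
    fix P1 P2 assume "P1 \<in> (`) f ` \<P>" "P2 \<in> (`) f ` \<P>" "P1 \<noteq> P2"
    then obtain Q1 Q2 where Q: "Q1 \<in> \<P>" "P1 = f ` Q1" "Q2 \<in> \<P>" "P2 = f ` Q2" "Q1 \<noteq> Q2" by blast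
    then obtain s where "s \<in> S" "distinguishes s Q1 Q2"
      using G.feasible_distinguish[OF fe] by blast
    then show "\<exists>s\<in>f ` S. distinguishes s P1 P2"
      using f_distinguishes[OF sepS P[OF Q(1)] P[OF Q(3)]] Q by blast
  next
    fix P1 P2 s' t' assume "P1 \<in> (`) f ` \<P>" "P2 \<in> (`) f ` \<P>" "s' \<in> f ` S" "t' \<in> f ` S"
      and *: "\<not> nested_sep s' t' \<and> s' \<in> P1 \<and> t' \<in> P1 \<and> sinv s' \<in> P2 \<and> sinv t' \<in> P2"
    then obtain Q1 Q2 s t where Q: "Q1 \<in> \<P>" "P1 = f ` Q1" "Q2 \<in> \<P>" "P2 = f ` Q2"
      and st: "s \<in> S" "s' = f s" "t \<in> S" "t' = f t" by blast
    note ss = sepS[OF st(1)] and ts = sepS[OF st(3)]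
    have "\<not> nested_sep s t" "s \<in> Q1" "t \<in> Q1" "sinv s \<in> Q2" "sinv t \<in> Q2"
      using * f_nested[OF ss ts] mem[OF P[OF Q(1)] ss] mem[OF P[OF Q(1)] ts]
        sinv_mem[OF P[OF Q(3)] ss] sinv_mem[OF P[OF Q(3)] ts] unfolding Q st by blast+
    then obtain e where e: "e \<in> Q1 \<inter> S" "s \<preceq> e" "t \<preceq> e"
      using G.feasible_crossing[OF fe Q(1,3) st(1,3)] by blast
    then have "f e \<in> P1 \<inter> f ` S" "s' \<preceq> f e" "t' \<preceq> f e"
      using f_sle[OF ss, of e] f_sle[OF ts, of e] sepS[of e] Q st by blast+
    then show "\<exists>e\<in>P1 \<inter> f ` S. s' \<preceq> e \<and> t' \<preceq> e" by blast
  qed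
qed

theorem f_N_strat:
  assumes "G.feasible S \<P>" "range \<sigma> \<subseteq> reduced_ops"
  shows "N_strat H \<sigma> (f ` S) ((`) f ` \<P>) = f ` N_strat G \<sigma> S \<P>"
  using assms
proof (induction rule: G.feasible_strategy_induct)
  case (empty \<sigma> \<P>)
  then show ?case
    using H.N_strat_empty[OF empty(2)] f_feasible[OF empty(1)] G.N_strat_empty[OF empty(2,1)] by simp
next
  case (reduce \<sigma> S \<P>)
  note sub = feasible_seps(1)[OF reduce(1)] and P = feasible_seps(2)[OF reduce(1)]
  have R: "reduction (f ` S) ((`) f ` \<P>) = f ` reduction S \<P>" by (rule f_reduction[OF sub P])
  have "f ` reduction S \<P> \<noteq> f ` S"
    using image_eq[of "reduction S \<P>" S] sub reduce(4) by blast
  then have "reduction (f ` S) ((`) f ` \<P>) \<subset> f ` S"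
    unfolding R using reduction_subset by blast
  then show ?case
    using H.N_strat_reduce[OF f_feasible[OF reduce(1)] reduce(2)] reduce(3) reduce.IH
      G.N_strat_reduce[OF reduce(1-4)] unfolding R by simp
next
  case (split \<sigma> S \<P>)
  note sub = feasible_seps(1)[OF split(1)] and P = feasible_seps(2)[OF split(1)]
  let ?N = "apply_op (\<sigma> 0) S \<P>"
  have R: "reduction (f ` S) ((`) f ` \<P>) = f ` S" using f_reduction[OF sub P] split(4) by simp
  have ap: "apply_op (\<sigma> 0) (f ` S) ((`) f ` \<P>) = f ` ?N" by (rule f_apply_op[OF sub P])
  have N: "?N \<subseteq> seps"
    using G.apply_op_reduced(1)[OF split(1) _ split(4), of "\<sigma> 0"] split(2) sub unfolding all_seps_def by blast
  have eq: "N_strat H (\<lambda>i. \<sigma> (Suc i)) (splitting H (f ` S) (f ` Q)) (inducing ((`) f ` \<P>) (f ` ?N) (f ` Q)) =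
      f ` N_strat G (\<lambda>i. \<sigma> (Suc i)) (splitting G S Q) (inducing \<P> ?N Q)"
    if Q: "Q \<in> consistent_orientations G ?N" for Q
  proof -
    have "Q \<subseteq> seps" using Q N by (auto simp: consistent_orientations_def)
    then show ?thesis
      using split.IH[OF Q] f_splitting[OF sub] f_inducing[OF N _ P] by simp
  qed
  have "N_strat H \<sigma> (f ` S) ((`) f ` \<P>) = f ` ?N \<union> (\<Union>Q\<in>(`) f ` consistent_orientations G ?N.
      N_strat H (\<lambda>i. \<sigma> (Suc i)) (splitting H (f ` S) Q) (inducing ((`) f ` \<P>) (f ` ?N) Q))"
    using H.N_strat_split[OF f_feasible[OF split(1)] split(2) _ R] split(3)
    unfolding ap f_orientations[OF N] by simp
  also have "\<dots> = f ` ?N \<union> (\<Union>Q\<in>consistent_orientations G ?N.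
      f ` N_strat G (\<lambda>i. \<sigma> (Suc i)) (splitting G S Q) (inducing \<P> ?N Q))"
    using eq by simp
  also have "\<dots> = f ` N_strat G \<sigma> S \<P>"
    unfolding G.N_strat_split[OF split(1-4)] by blast
  finally show ?case .
qed

lemma f_restrict: "P \<subseteq> seps \<Longrightarrow> restrict_profile l (f ` P) = f ` restrict_profile l P"
proof -
  assume P: "P \<subseteq> seps"
  have "sorder (f s) < l \<longleftrightarrow> sorder s < l" if "s \<in> P" for s
    using that P f_sorder[of s] by auto
  then show ?thesis unfolding restrict_profile_def by (rule f_filter)
qed

lemma f_level_seps:
  assumes N: "N \<subseteq> seps" shows "H.level_seps m (f ` N) = f ` G.level_seps m N"
proof -
  have "{s \<in> f ` seps. proper_sep s \<and> sorder s = m \<and> nested_with s (f ` N)} =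
      f ` {s \<in> seps. proper_sep s \<and> sorder s = m \<and> nested_with s N}"
    by (rule f_filter) (use f_proper f_sorder f_nested_with[OF _ N] in simp)
  then show ?thesis unfolding surj by (simp add: H.level_seps_def G.level_seps_def)
qed

lemma f_level:
  assumes e: "G.efficient_system m (restrict_profile m ` \<P>) N"
    and prof: "\<And>P. P \<in> \<P> \<Longrightarrow> k_profile G (Suc m) P" and \<sigma>: "range \<sigma> \<subseteq> reduced_ops"
  shows "f ` N \<union> (\<Union>Q\<in>consistent_orientations H (f ` N).
      N_strat H \<sigma> (splitting H (H.level_seps m (f ` N)) Q) (inducing ((`) f ` \<P>) (f ` N) Q)) =
    f ` (N \<union> (\<Union>Q\<in>consistent_orientations G N.
      N_strat G \<sigma> (splitting G (G.level_seps m N) Q) (inducing \<P> N Q)))"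
proof -
  have N: "N \<subseteq> seps" using G.efficient_systemD(2)[OF e] by blast
  have P: "P \<subseteq> seps" if "P \<in> \<P>" for P
    using G.k_profile_consistent[OF prof[OF that]] G.consistent_sepD by blast
  have L: "G.level_seps m N \<subseteq> seps" by (auto simp: G.level_seps_def)
  have "N_strat H \<sigma> (splitting H (H.level_seps m (f ` N)) (f ` Q)) (inducing ((`) f ` \<P>) (f ` N) (f ` Q)) =
      f ` N_strat G \<sigma> (splitting G (G.level_seps m N) Q) (inducing \<P> N Q)"
    if Q: "Q \<in> consistent_orientations G N" for Q
  proof -
    have "Q \<subseteq> seps" using Q N by (auto simp: consistent_orientations_def)
    then show ?thesis
      using f_N_strat[OF G.level_task_feasible[OF e prof] \<sigma>, of Q]
      by (simp add: f_level_seps[OF N] f_splitting[OF L] f_inducing[OF N _ P])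
  qed
  then show ?thesis
    unfolding f_orientations[OF N] image_Un image_UN by simp
qed

theorem f_N_kstrat:
  assumes "\<Sigma> \<noteq> []" "\<And>\<sigma>. \<sigma> \<in> set \<Sigma> \<Longrightarrow> range \<sigma> \<subseteq> reduced_ops"
    and "\<And>P. P \<in> \<P> \<Longrightarrow> k_profile G (length \<Sigma>) P"
  shows "N_kstrat H \<Sigma> ((`) f ` \<P>) = f ` N_kstrat G \<Sigma> \<P>"
  using assms
proof (induction \<Sigma> arbitrary: \<P> rule: rev_nonempty_induct)
  case (single \<sigma>)
  have e: "G.efficient_system 0 (restrict_profile 0 ` \<P>) {}"
    by (auto simp: G.efficient_system_def nested_set_def restrict_profile_def)
  have "range \<sigma> \<subseteq> reduced_ops" "\<And>P. P \<in> \<P> \<Longrightarrow> k_profile G (Suc 0) P" using single by simp_all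
  from f_level[OF e this(2,1)] show ?case
    unfolding H.N_kstrat_1 G.N_kstrat_1 by simp
next
  case (snoc \<sigma> \<Sigma>)
  let ?l = "length \<Sigma>"
  let ?N = "N_kstrat G \<Sigma> (restrict_profile ?l ` \<P>)"
  have k: "k_profile G (Suc ?l) P" if "P \<in> \<P>" for P
    using snoc.prems(2)[OF that] by simp
  have kr: "k_profile G ?l P" if "P \<in> restrict_profile ?l ` \<P>" for P
    using that G.k_profile_restrict[OF k] by auto
  have \<sigma>: "range \<tau> \<subseteq> reduced_ops" if "\<tau> \<in> set \<Sigma>" for \<tau> using snoc.prems(1) that by simp
  have P: "P \<subseteq> seps" if "P \<in> \<P>" for P
    using G.k_profile_consistent[OF k[OF that]] G.consistent_sepD by blast
  have "restrict_profile ?l ` (`) f ` \<P> = (`) f ` restrict_profile ?l ` \<P>"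
    unfolding image_image using f_restrict[OF P] by simp
  then have N: "f ` ?N = N_kstrat H \<Sigma> (restrict_profile ?l ` (`) f ` \<P>)"
    using snoc.IH[OF \<sigma> kr] by simp
  have e: "G.efficient_system ?l (restrict_profile ?l ` \<P>) ?N"
    by (rule G.N_kstrat_efficient[OF snoc.hyps(1) \<sigma> kr])
  show ?case
    unfolding H.N_kstrat_snoc[OF snoc.hyps(1) N] G.N_kstrat_snoc[OF snoc.hyps(1) refl]
    by (rule f_level[OF e k]) (use snoc.prems(1) in simp_all)
qed

lemma f_k_profile:
  assumes P: "P \<subseteq> seps" shows "k_profile H k (f ` P) \<longleftrightarrow> k_profile G k P"
proof -
  have sepP: "separation G s" if "s \<in> P" for s using that P by blast
  have "profile H (f ` P) \<longleftrightarrow> profile G P"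
  proof -
    have "sinv (sjoin (f s) (f t)) \<in> f ` P \<longleftrightarrow> sinv (sjoin s t) \<in> P" if "s \<in> P" "t \<in> P" for s t
      using sinv_mem[OF P G.separation_sjoin] f_sjoin sepP that by metis
    then show ?thesis
      unfolding profile_iff_sjoin f_consistent[OF P] by blast
  qed
  moreover have "(\<forall>s\<in>f ` P. sorder s < k) \<longleftrightarrow> (\<forall>s\<in>P. sorder s < k)"
    using f_sorder[OF sepP] by simp
  moreover have "(\<forall>s\<in>{s. separation H s}. sorder s < k \<longrightarrow> (s \<in> f ` P) \<noteq> (sinv s \<in> f ` P)) \<longleftrightarrow>
      (\<forall>s\<in>seps. sorder s < k \<longrightarrow> (s \<in> P) \<noteq> (sinv s \<in> P))"
    unfolding surj[symmetric] using f_sorder mem[OF P] sinv_mem[OF P] by simp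
  ultimately show ?thesis unfolding k_profile_def by blast
qed

lemma f_all_k_profiles: "{P. k_profile H k P} = (`) f ` {P. k_profile G k P}"
proof (intro equalityI subsetI)
  fix P' assume "P' \<in> {P. k_profile H k P}"
  then have P': "k_profile H k P'" by simp
  have "P' \<subseteq> f ` seps"
    unfolding surj using H.consistent_sepD[OF H.k_profile_consistent[OF P']] by blast
  then obtain P where "P \<subseteq> seps" "P' = f ` P" by (auto simp: subset_image_iff)
  then show "P' \<in> (`) f ` {P. k_profile G k P}" using f_k_profile[of P] P' by blast
next
  fix P' assume "P' \<in> (`) f ` {P. k_profile G k P}"
  then obtain P where P: "k_profile G k P" "P' = f ` P" by blast
  then have "P \<subseteq> seps" using G.consistent_sepD[OF G.k_profile_consistent] by blast
  then show "P' \<in> {P. k_profile H k P}" using f_k_profile P by simp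
qed

end

section \<open>Graph isomorphisms as maps of separations\<close>

definition map_sep :: "('a \<Rightarrow> 'b) \<Rightarrow> 'a sep \<Rightarrow> 'b sep" where
  "map_sep \<phi> s = (\<phi> ` fst s, \<phi> ` snd s)"

lemma graph_iso_sep_iso:
  assumes "pair_graph G" "pair_graph H" and iso: "graph_iso \<phi> G H"
  shows "sep_iso G H (map_sep \<phi>)"
proof -
  interpret G: pair_graph G by fact
  interpret H: pair_graph H by fact
  have inj: "inj_on \<phi> (pverts G)" and im: "\<phi> ` pverts G = pverts H"
    using iso by (simp_all add: graph_iso_def bij_betw_def)
  have arc: "(\<phi> u, \<phi> v) \<in> parcs H \<longleftrightarrow> (u, v) \<in> parcs G" if "u \<in> pverts G" "v \<in> pverts G" for u v
    using iso that by (simp add: graph_iso_def)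
  have sub: "fst s \<subseteq> pverts G" "snd s \<subseteq> pverts G" if "separation G s" for s
    using G.separation_subset that by blast+
  have incl: "\<phi> ` A \<subseteq> \<phi> ` B \<longleftrightarrow> A \<subseteq> B" if "A \<subseteq> pverts G" "B \<subseteq> pverts G" for A B
    using inj_on_image_mem_iff[OF inj] that by blast
  have sep: "separation H (map_sep \<phi> s) \<longleftrightarrow> separation G s" if s: "fst s \<subseteq> pverts G" "snd s \<subseteq> pverts G" for s
  proof -
    have "\<phi> ` fst s \<union> \<phi> ` snd s = pverts H \<longleftrightarrow> fst s \<union> snd s = pverts G"
      unfolding im[symmetric] image_Un[symmetric] using s by (intro inj_on_image_eq_iff[OF inj]) auto
    moreover have "\<phi> ` fst s \<subseteq> pverts H" "\<phi> ` snd s \<subseteq> pverts H" using s im by blast+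
    moreover have "\<phi> ` fst s - \<phi> ` snd s = \<phi> ` (fst s - snd s)" "\<phi> ` snd s - \<phi> ` fst s = \<phi> ` (snd s - fst s)"
      by (rule inj_on_image_set_diff[OF inj, symmetric]; use s in blast)+
    moreover have "(\<exists>u\<in>fst s - snd s. \<exists>v\<in>snd s - fst s. (\<phi> u, \<phi> v) \<in> parcs H) \<longleftrightarrow>
        (\<exists>u\<in>fst s - snd s. \<exists>v\<in>snd s - fst s. (u, v) \<in> parcs G)"
      using arc s by blast
    ultimately show ?thesis
      using s unfolding separation_def map_sep_def split_beta fst_conv snd_conv by simp
  qed
  show ?thesis
  proof unfold_locales
    show "bij_betw (map_sep \<phi>) {s. separation G s} {s. separation H s}"
      unfolding bij_betw_def
    proof
      show "inj_on (map_sep \<phi>) {s. separation G s}"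
      proof (rule inj_onI)
        fix s t assume st: "s \<in> {s. separation G s}" "t \<in> {s. separation G s}" "map_sep \<phi> s = map_sep \<phi> t"
        then have "\<phi> ` fst s = \<phi> ` fst t" "\<phi> ` snd s = \<phi> ` snd t" by (simp_all add: map_sep_def)
        then show "s = t"
          using inj_on_image_eq_iff[OF inj] sub[of s] sub[of t] st by (simp add: prod_eq_iff)
      qed
      show "map_sep \<phi> ` {s. separation G s} = {s. separation H s}"
      proof (intro equalityI subsetI)
        fix s' assume "s' \<in> map_sep \<phi> ` {s. separation G s}"
        then show "s' \<in> {s. separation H s}" using sep sub by blast
      next
        fix s' assume s': "s' \<in> {s. separation H s}"
        then have "fst s' \<subseteq> \<phi> ` pverts G" "snd s' \<subseteq> \<phi> ` pverts G"
          using H.separation_subset im by blast+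
        then obtain A B where AB: "A \<subseteq> pverts G" "B \<subseteq> pverts G" "fst s' = \<phi> ` A" "snd s' = \<phi> ` B"
          by (auto simp: subset_image_iff)
        have eq: "s' = map_sep \<phi> (A, B)" using AB by (simp add: map_sep_def prod_eq_iff)
        then have "separation G (A, B)" using sep[of "(A, B)"] AB s' by simp
        then show "s' \<in> map_sep \<phi> ` {s. separation G s}" using eq by blast
      qed
    qed
  next
    fix s assume s: "separation G s"
    show "map_sep \<phi> (sinv s) = sinv (map_sep \<phi> s)" by (simp add: map_sep_def)
    have "card (\<phi> ` fst s \<inter> \<phi> ` snd s) = card (fst s \<inter> snd s)"
      unfolding inj_on_image_Int[OF inj sub[OF s], symmetric]
      by (rule card_image, rule inj_on_subset[OF inj]) (use sub[OF s] in blast)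
    then show "sorder (map_sep \<phi> s) = sorder s" by (simp add: sorder_def map_sep_def)
    show "proper_sep (map_sep \<phi> s) \<longleftrightarrow> proper_sep s"
      using incl sub[OF s] by (simp add: proper_sep_def map_sep_def)
    fix t assume t: "separation G t"
    show "map_sep \<phi> s \<preceq> map_sep \<phi> t \<longleftrightarrow> s \<preceq> t"
      using incl sub[OF s] sub[OF t] by (simp add: sle_def map_sep_def)
    show "map_sep \<phi> (sjoin s t) = sjoin (map_sep \<phi> s) (map_sep \<phi> t)"
      using inj_on_image_Int[OF inj sub(2)[OF s] sub(2)[OF t]] by (simp add: map_sep_def sjoin_def image_Un)
  qed
qed

lemma part_of_map_sep:
  assumes "pair_graph G" and iso: "graph_iso \<phi> G H" and Q: "Q \<subseteq> {s. separation G s}"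
  shows "part_of H (map_sep \<phi> ` Q) = \<phi> ` part_of G Q"
proof -
  interpret G: pair_graph G by fact
  have inj: "inj_on \<phi> (pverts G)" and im: "\<phi> ` pverts G = pverts H"
    using iso by (simp_all add: graph_iso_def bij_betw_def)
  have "\<phi> x \<in> \<phi> ` snd s \<longleftrightarrow> x \<in> snd s" if "x \<in> pverts G" "s \<in> Q" for x s
    using inj_on_image_mem_iff[OF inj that(1), of "snd s"] G.separation_subset(2)[of s] Q that(2) by blast
  then have *: "(\<forall>s\<in>map_sep \<phi> ` Q. \<phi> x \<in> snd s) \<longleftrightarrow> (\<forall>s\<in>Q. x \<in> snd s)" if "x \<in> pverts G" for x
    using that by (simp add: map_sep_def)
  show ?thesis
    unfolding part_of_def im[symmetric] using * by blast
qed

text \<open>\<open>\<psi>\<close> sends a node to the one carrying the image orientation. Adjacency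
  and parts are determined by orientations through \<open>arc_iff\<close> and
  \<open>part_eq\<close>, so both are preserved.\<close>

lemma td_iso_image:
  assumes "system_td G N T \<V>" "system_td H (map_sep \<phi> ` N) T' \<V>'" and iso: "graph_iso \<phi> G H"
  shows "td_iso \<phi> T \<V> T' \<V>'"
proof -
  interpret A: system_td G N T \<V> by fact
  interpret B: system_td H "map_sep \<phi> ` N" T' \<V>' by fact
  interpret sep_iso G H "map_sep \<phi>"
    by (rule graph_iso_sep_iso[OF A.pair_graph B.pair_graph iso])
  let ?f = "map_sep \<phi>"
  have N: "N \<subseteq> seps" using A.N_sep by blast
  have nor: "A.nor t \<subseteq> seps" for t using A.nor_subset N by blast
  define \<psi> where "\<psi> t = inv_into (pverts T') B.nor (?f ` A.nor t)" for t
  have B_im: "B.nor ` pverts T' = (`) ?f ` A.nor ` pverts T"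
    using A.nor_bij B.nor_bij unfolding bij_betw_def f_orientations[OF N] by simp
  have \<psi>: "\<psi> t \<in> pverts T'" "B.nor (\<psi> t) = ?f ` A.nor t" if "t \<in> pverts T" for t
  proof -
    have "?f ` A.nor t \<in> B.nor ` pverts T'" using B_im that by blast
    then show "\<psi> t \<in> pverts T'" "B.nor (\<psi> t) = ?f ` A.nor t"
      unfolding \<psi>_def by (rule inv_into_into, rule f_inv_into_f)
  qed
  have "inj_on \<psi> (pverts T)"
  proof (rule inj_onI)
    fix s t assume st: "s \<in> pverts T" "t \<in> pverts T" "\<psi> s = \<psi> t"
    then have "?f ` A.nor s = ?f ` A.nor t" using \<psi>(2)[OF st(1)] \<psi>(2)[OF st(2)] by simp
    then have "A.nor s = A.nor t" using image_eq[OF nor nor] by simp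
    then show "s = t" using inj_onD[OF A.nor_inj] st by blast
  qed
  moreover have "\<psi> ` pverts T = pverts T'"
  proof (intro equalityI subsetI)
    fix t' assume t': "t' \<in> pverts T'"
    then have "B.nor t' \<in> (`) ?f ` A.nor ` pverts T" unfolding B_im[symmetric] by (rule imageI)
    then obtain t where t: "t \<in> pverts T" "B.nor t' = ?f ` A.nor t" by (elim imageE) simp
    have "B.nor t' = B.nor (\<psi> t)" unfolding \<psi>(2)[OF t(1)] by (rule t(2))
    then have "t' = \<psi> t" by (rule inj_onD[OF B.nor_inj _ t' \<psi>(1)[OF t(1)]])
    then show "t' \<in> \<psi> ` pverts T" using t(1) by (rule image_eqI)
  next
    fix t' assume "t' \<in> \<psi> ` pverts T"
    then show "t' \<in> pverts T'" using \<psi>(1) by (elim imageE) simp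
  qed
  moreover have "(s, t) \<in> parcs T \<longleftrightarrow> (\<psi> s, \<psi> t) \<in> parcs T'" if st: "s \<in> pverts T" "t \<in> pverts T" for s t
  proof -
    have "A.nor t = flip u (A.nor s) \<longleftrightarrow> ?f ` A.nor t = flip (?f u) (?f ` A.nor s)" if u: "u \<in> A.nor s" for u
    proof -
      have us: "separation G u" using u nor by blast
      have "?f ` (A.nor s - {u}) = ?f ` A.nor s - ?f ` {u}"
        by (rule inj_on_image_set_diff[OF inj]) (use nor u in blast)+
      then have "flip (?f u) (?f ` A.nor s) = ?f ` flip u (A.nor s)"
        using f_sinv[OF us] by (simp add: flip_def)
      moreover have "flip u (A.nor s) \<subseteq> seps" using nor us by (auto simp: flip_def)
      ultimately show ?thesis using image_eq[OF nor, of "flip u (A.nor s)" t] by simp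
    qed
    then show ?thesis
      unfolding A.arc_iff[OF st] B.arc_iff[OF \<psi>(1)[OF st(1)] \<psi>(1)[OF st(2)]] \<psi>(2)[OF st(1)] \<psi>(2)[OF st(2)]
      by blast
  qed
  ultimately have "graph_iso \<psi> T T'" by (simp add: graph_iso_def bij_betw_def)
  moreover have "\<V>' (\<psi> t) = \<phi> ` \<V> t" if t: "t \<in> pverts T" for t
    using B.part_eq[OF \<psi>(1)[OF t]] A.part_eq[OF t] \<psi>(2)[OF t]
      part_of_map_sep[OF A.pair_graph iso nor] by simp
  ultimately show ?thesis unfolding td_iso_def by blast
qed

section \<open>Blocks and tangles\<close>

lemma block_profile_iff: "s \<in> block_profile G k b \<longleftrightarrow> separation G s \<and> sorder s < k \<and> b \<subseteq> snd s"
  by (cases s) (simp add: block_profile_def)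

context pair_graph
begin

lemma block_k_profile:
  assumes b: "k_block G k b"
  shows "k_profile G k (block_profile G k b)"
proof -
  let ?P = "block_profile G k b"
  note P = block_profile_iff
  have bi: "b \<subseteq> pverts G" "k \<le> card b" "\<And>s. separation G s \<Longrightarrow> sorder s < k \<Longrightarrow> b \<subseteq> fst s \<or> b \<subseteq> snd s"
    using b by (auto simp: k_block_def k_inseparable_def)
  \<comment> \<open>A set of at least \<open>k\<close> vertices does not fit into a separator with
    fewer than \<open>k\<close>.\<close>
  have big: False if s: "separation G s" "sorder s < k" "b \<subseteq> fst s" "b \<subseteq> snd s" for s
  proof -
    have "finite (fst s \<inter> snd s)"
      by (rule finite_subset[OF _ pair_finite_verts]) (use separation_subset(1)[OF s(1)] in blast)
    then have "card b \<le> sorder s" unfolding sorder_def using s by (intro card_mono) auto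
    then show False using s(2) bi(2) by simp
  qed
  have "\<not> sinv t \<preceq> s" if "s \<in> ?P" "t \<in> ?P" for s t
  proof
    assume "sinv t \<preceq> s"
    then have "b \<subseteq> fst s" using that unfolding P sle_def by auto
    then show False using big[of s] that unfolding P by blast
  qed
  then have "consistent G ?P" unfolding consistent_iff using P by blast
  moreover have "sinv (sjoin s t) \<notin> ?P" if "s \<in> ?P" "t \<in> ?P" for s t
  proof
    assume j: "sinv (sjoin s t) \<in> ?P"
    have "b \<subseteq> snd (sjoin s t)" using that unfolding P sjoin_def by auto
    then show False using big[of "sinv (sjoin s t)"] j unfolding P by simp
  qed
  moreover have "(s \<in> ?P) \<noteq> (sinv s \<in> ?P)" if "separation G s" "sorder s < k" for s
    using bi(3)[OF that] big[OF that] that unfolding P by auto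
  ultimately show ?thesis
    unfolding k_profile_def profile_iff_sjoin using P by blast
qed

text \<open>The union of two blocks with the same profile lies on one side of every separation of
  order below \<open>k\<close>, hence is inseparable; maximality of both blocks gives
  equality.\<close>

lemma block_profile_inj:
  assumes b: "k_block G k b" "k_block G k b'" and eq: "block_profile G k b = block_profile G k b'"
  shows "b = b'"
proof -
  have "k_inseparable G k (b \<union> b')"
    unfolding k_inseparable_def
  proof (intro conjI allI impI)
    show "b \<union> b' \<subseteq> pverts G" using b by (simp add: k_block_def k_inseparable_def)
    have "finite (b \<union> b')"
      by (rule finite_subset[OF _ pair_finite_verts]) (use b in \<open>simp add: k_block_def k_inseparable_def\<close>)
    then have "card b \<le> card (b \<union> b')" by (intro card_mono) auto
    moreover have "k \<le> card b" using b by (simp add: k_block_def k_inseparable_def)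
    ultimately show "k \<le> card (b \<union> b')" by simp
    fix A B assume s: "separation G (A, B) \<and> sorder (A, B) < k"
    then have "separation G (B, A) \<and> sorder (B, A) < k"
      using separation_sinv[of "(A, B)"] sorder_sinv[of "(A, B)"] by simp
    then have "(b \<subseteq> B \<longleftrightarrow> b' \<subseteq> B)" "(b \<subseteq> A \<longleftrightarrow> b' \<subseteq> A)"
      using s block_profile_iff[of _ G k b] block_profile_iff[of _ G k b'] unfolding eq by (metis snd_conv)+
    moreover have "b \<subseteq> A \<or> b \<subseteq> B" using b(1) s by (simp add: k_block_def k_inseparable_def)
    ultimately show "b \<union> b' \<subseteq> A \<or> b \<union> b' \<subseteq> B" by blast
  qed
  then have "b \<union> b' = b" "b \<union> b' = b'" using b unfolding k_block_def by blast+
  then show ?thesis by blast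
qed

lemma tangle_not_cover:
  assumes \<theta>: "tangle G k \<theta>" "s \<in> \<theta>" "t \<in> \<theta>" "r \<in> \<theta>"
    and V: "pverts G \<subseteq> fst s \<union> fst t \<union> fst r"
    and E: "\<And>a b. (a, b) \<in> parcs G \<Longrightarrow> (a \<in> fst s \<and> b \<in> fst s) \<or> (a \<in> fst t \<and> b \<in> fst t) \<or> (a \<in> fst r \<and> b \<in> fst r)"
  shows False
proof -
  have sep: "separation G s" "separation G t" "separation G r"
    using \<theta> unfolding tangle_def by blast+
  have "union (union (with_proj G \<restriction> fst s) (with_proj G \<restriction> fst t)) (with_proj G \<restriction> fst r) = with_proj G"
  proof -
    have verts: "fst s \<union> fst t \<union> fst r = pverts G"
      using V separation_subset(1)[OF sep(1)] separation_subset(1)[OF sep(2)] separation_subset(1)[OF sep(3)]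
      by blast
    have "e \<in> {e \<in> parcs G. fst e \<in> fst s \<and> snd e \<in> fst s} \<union> {e \<in> parcs G. fst e \<in> fst t \<and> snd e \<in> fst t} \<union>
        {e \<in> parcs G. fst e \<in> fst r \<and> snd e \<in> fst r}" if "e \<in> parcs G" for e
      using E[of "fst e" "snd e"] that by simp
    then have arcs: "{e \<in> parcs G. fst e \<in> fst s \<and> snd e \<in> fst s} \<union> {e \<in> parcs G. fst e \<in> fst t \<and> snd e \<in> fst t} \<union>
        {e \<in> parcs G. fst e \<in> fst r \<and> snd e \<in> fst r} = parcs G"
      by blast
    show ?thesis
      using verts arcs by (simp add: union_def induce_subgraph_def with_proj_def)
  qed
  moreover have "(fst s, snd s) \<in> \<theta>" "(fst t, snd t) \<in> \<theta>" "(fst r, snd r) \<in> \<theta>"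
    using \<theta>(2-4) by simp_all
  ultimately show False using \<theta>(1) unfolding tangle_def by blast
qed

text \<open>If \<open>sinv t \<preceq> s\<close>, the subgraphs on \<open>fst t\<close> and
  \<open>fst s\<close> cover the graph, the latter being used twice. For the profile condition, a
  vertex or edge in neither of the subgraphs on \<open>fst s\<close> and \<open>fst t\<close> lies
  in both second sides, whose intersection is the first side of the inverse of the join.\<close>

lemma tangle_k_profile:
  assumes \<theta>: "tangle G k \<theta>" shows "k_profile G k \<theta>"
proof -
  have sep: "separation G s" "sorder s < k" if "s \<in> \<theta>" for s
    using \<theta> that unfolding tangle_def by blast+
  have "\<not> sinv t \<preceq> s" if st: "s \<in> \<theta>" "t \<in> \<theta>" for s t
  proof
    assume "sinv t \<preceq> s"
    then have le: "snd t \<subseteq> fst s" by (simp add: sle_def)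
    show False
    proof (rule tangle_not_cover[OF \<theta> st(2,1,1)])
      show "pverts G \<subseteq> fst t \<union> fst s \<union> fst s"
        using separation_Un[OF sep(1)[OF st(2)]] le by blast
    qed (use separation_arc[OF sep(1)[OF st(2)]] le in blast)
  qed
  then have "consistent G \<theta>" unfolding consistent_iff using sep by blast
  moreover have "sinv (sjoin s t) \<notin> \<theta>" if st: "s \<in> \<theta>" "t \<in> \<theta>" for s t
  proof
    assume j: "sinv (sjoin s t) \<in> \<theta>"
    have f: "fst (sinv (sjoin s t)) = snd s \<inter> snd t" by (simp add: sjoin_def)
    show False
    proof (rule tangle_not_cover[OF \<theta> st j])
      show "pverts G \<subseteq> fst s \<union> fst t \<union> fst (sinv (sjoin s t))"
        unfolding f using separation_Un[OF sep(1)[OF st(1)]] separation_Un[OF sep(1)[OF st(2)]] by blast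
      fix a b assume ab: "(a, b) \<in> parcs G"
      show "(a \<in> fst s \<and> b \<in> fst s) \<or> (a \<in> fst t \<and> b \<in> fst t) \<or>
          (a \<in> fst (sinv (sjoin s t)) \<and> b \<in> fst (sinv (sjoin s t)))"
        unfolding f using separation_arc[OF sep(1)[OF st(1)] ab] separation_arc[OF sep(1)[OF st(2)] ab] by blast
    qed
  qed
  moreover have "(s \<in> \<theta>) \<noteq> (sinv s \<in> \<theta>)" if "separation G s" "sorder s < k" for s
    using \<theta> that unfolding tangle_def by blast
  ultimately show ?thesis
    unfolding k_profile_def profile_iff_sjoin using sep by blast
qed

end

section \<open>The tree-decomposition defined by a \<open>k\<close>-strategy\<close>

lemma k_strategy_efficient:
  assumes "pair_graph G" "k \<ge> 1" "k_strategy k \<Sigma>"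
  shows "pair_graph.efficient_system G k {P. k_profile G k P} (N_kstrat G \<Sigma> {P. k_profile G k P})"
proof -
  interpret pair_graph G by fact
  have l: "length \<Sigma> = k" "\<And>\<sigma>. \<sigma> \<in> set \<Sigma> \<Longrightarrow> range \<sigma> \<subseteq> reduced_ops"
    using assms(3) unfolding k_strategy_def by blast+
  then have "\<Sigma> \<noteq> []" using assms(2) by auto
  then show ?thesis
    unfolding l(1)[symmetric] by (rule N_kstrat_efficient[OF _ l(2)]) simp_all
qed

lemma defines_td_ex:
  assumes "pair_graph G" "k \<ge> 1" "k_strategy k \<Sigma>"
  shows "\<exists>(T :: 'a set pair_pre_digraph) \<V>. defines_td \<Sigma> (G :: 'a pair_pre_digraph) T \<V>"
proof -
  interpret pair_graph G by fact
  let ?N = "N_kstrat G \<Sigma> {P. k_profile G k P}"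
  note e = k_strategy_efficient[OF assms]
  interpret nested_system G ?N by (rule efficient_nested_system[OF e])
  have "inj_on (part_of G) orientations"
    by (rule part_of_inj[OF e]) simp
  then interpret injective_system G ?N by unfold_locales
  have "defines_td \<Sigma> G OT (\<lambda>X. X)"
    using OT_td assms(3) by (simp add: defines_td_def k_strategy_def)
  then show ?thesis by blast
qed

lemma defines_td_system:
  assumes "pair_graph G" "k \<ge> 1" "k_strategy k \<Sigma>" "defines_td \<Sigma> G T \<V>"
  shows "system_td G (N_kstrat G \<Sigma> {P. k_profile G k P}) T \<V>"
proof -
  interpret pair_graph G by fact
  let ?N = "N_kstrat G \<Sigma> {P. k_profile G k P}"
  have td: "td_of_seps G ?N T \<V>" using assms(3,4) by (simp add: defines_td_def k_strategy_def)
  then have "pair_tree T" by (simp add: td_of_seps_def tree_decomposition_def tree_graph_iff)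
  then show ?thesis
    using efficient_nested_system[OF k_strategy_efficient[OF assms(1-3)]] td
    by (simp add: system_td_def system_td_axioms_def)
qed

lemma defines_td_adhesion:
  assumes "pair_graph G" "k \<ge> 1" "k_strategy k \<Sigma>" "defines_td \<Sigma> G T \<V>"
  shows "adhesion T \<V> < k"
proof -
  interpret system_td G "N_kstrat G \<Sigma> {P. k_profile G k P}" T \<V> by (rule defines_td_system[OF assms])
  show ?thesis
    by (rule adhesion_less[OF _ assms(2)])
      (use efficient_systemD(2)[OF k_strategy_efficient[OF assms(1-3)]] in blast)
qed

lemma defines_td_distinguishes:
  assumes "pair_graph G" "k \<ge> 1" "k_strategy k \<Sigma>" "defines_td \<Sigma> G T \<V>"
  shows "distinguishes_blocks_and_tangles k G T \<V>"
proof -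
  interpret system_td G "N_kstrat G \<Sigma> {P. k_profile G k P}" T \<V> by (rule defines_td_system[OF assms])
  have *: "\<exists>e\<in>parcs T. distinguishes (edge_sep T \<V> e) P P'"
    if P: "k_profile G k P" "k_profile G k P'" "P \<noteq> P'" for P P'
  proof -
    have "\<exists>u\<in>N_kstrat G \<Sigma> {P. k_profile G k P}. distinguishes u P P'"
      using k_strategy_efficient[OF assms(1-3)] P unfolding efficient_system_def by simp
    then show ?thesis unfolding td_facts(2)[symmetric] by blast
  qed
  show ?thesis
    unfolding distinguishes_blocks_and_tangles_def
  proof (intro conjI allI impI)
    fix P P' assume "P \<noteq> P' \<and>
        ((\<exists>b. k_block G k b \<and> P = block_profile G k b) \<or> tangle G k P) \<and>
        ((\<exists>b. k_block G k b \<and> P' = block_profile G k b) \<or> tangle G k P')"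
    then show "\<exists>e\<in>parcs T. distinguishes (edge_sep T \<V> e) P P'"
      using *[of P P'] block_k_profile tangle_k_profile by blast
  next
    fix b b' assume "b \<noteq> b' \<and> k_block G k b \<and> k_block G k b'"
    then show "\<exists>e\<in>parcs T. distinguishes (edge_sep T \<V> e) (block_profile G k b) (block_profile G k b')"
      using *[of "block_profile G k b" "block_profile G k b'"] block_k_profile block_profile_inj by blast
  qed
qed

text \<open>For the identity of \<open>G\<close> this is uniqueness of the tree-decomposition up to
  renaming nodes; for automorphisms it is canonicity of a single one.\<close>

lemma defines_td_iso:
  assumes G: "pair_graph G" and H: "pair_graph H" and k: "k \<ge> 1" "k_strategy k \<Sigma>" and iso: "graph_iso \<phi> G H"
    and td: "defines_td \<Sigma> G T \<V>" "defines_td \<Sigma> H T' \<V>'"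
  shows "td_iso \<phi> T \<V> T' \<V>'"
proof -
  interpret sep_iso G H "map_sep \<phi>" by (rule graph_iso_sep_iso[OF G H iso])
  have l: "length \<Sigma> = k" "\<And>\<sigma>. \<sigma> \<in> set \<Sigma> \<Longrightarrow> range \<sigma> \<subseteq> reduced_ops"
    using k(2) unfolding k_strategy_def by blast+
  have "N_kstrat H \<Sigma> {P. k_profile H k P} = map_sep \<phi> ` N_kstrat G \<Sigma> {P. k_profile G k P}"
    unfolding f_all_k_profiles by (rule f_N_kstrat) (use l k(1) in auto)
  then show ?thesis
    using td_iso_image[OF defines_td_system[OF G k td(1)] _ iso] defines_td_system[OF H k td(2)] by simp
qed

theorem theorem4p5:
  fixes k :: nat
  assumes "k \<ge> 1"
  shows
    "(\<forall>\<Sigma>. k_strategy k \<Sigma> \<longrightarrow>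
        (\<forall>G :: 'a pair_pre_digraph. pair_graph G \<longrightarrow>
           (\<exists>(T :: 'a set pair_pre_digraph) \<V>. defines_td \<Sigma> G T \<V>)) \<and>
        (\<forall>(G :: 'a pair_pre_digraph) (T :: 'n pair_pre_digraph) \<V>.
           pair_graph G \<and> defines_td \<Sigma> G T \<V> \<longrightarrow>
           adhesion T \<V> < k \<and> distinguishes_blocks_and_tangles k G T \<V>) \<and>
        (\<forall>(G :: 'a pair_pre_digraph) (G' :: 'b pair_pre_digraph) \<phi>
            (T :: 'n pair_pre_digraph) \<V> (T' :: 'm pair_pre_digraph) \<V>'.
           pair_graph G \<and> pair_graph G' \<and> graph_iso \<phi> G G' \<and>
           defines_td \<Sigma> G T \<V> \<and> defines_td \<Sigma> G' T' \<V>' \<longrightarrow> td_iso \<phi> T \<V> T' \<V>')) \<and>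
     (\<forall>G :: 'a pair_pre_digraph. pair_graph G \<longrightarrow>
        (\<exists>(T :: 'a set pair_pre_digraph) \<V>.
           tree_decomposition G T \<V> \<and> adhesion T \<V> < k \<and>
           distinguishes_blocks_and_tangles k G T \<V> \<and>
           (\<forall>\<phi>. graph_iso \<phi> G G \<longrightarrow> td_iso \<phi> T \<V> T \<V>)))"
proof (rule conjI; intro allI impI)
  fix \<Sigma> assume \<Sigma>: "k_strategy k \<Sigma>"
  show "(\<forall>G :: 'a pair_pre_digraph. pair_graph G \<longrightarrow>
           (\<exists>(T :: 'a set pair_pre_digraph) \<V>. defines_td \<Sigma> G T \<V>)) \<and>
        (\<forall>(G :: 'a pair_pre_digraph) (T :: 'n pair_pre_digraph) \<V>.
           pair_graph G \<and> defines_td \<Sigma> G T \<V> \<longrightarrow>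
           adhesion T \<V> < k \<and> distinguishes_blocks_and_tangles k G T \<V>) \<and>
        (\<forall>(G :: 'a pair_pre_digraph) (G' :: 'b pair_pre_digraph) \<phi>
            (T :: 'n pair_pre_digraph) \<V> (T' :: 'm pair_pre_digraph) \<V>'.
           pair_graph G \<and> pair_graph G' \<and> graph_iso \<phi> G G' \<and>
           defines_td \<Sigma> G T \<V> \<and> defines_td \<Sigma> G' T' \<V>' \<longrightarrow> td_iso \<phi> T \<V> T' \<V>')"
    using defines_td_ex[OF _ assms \<Sigma>] defines_td_adhesion[OF _ assms \<Sigma>]
      defines_td_distinguishes[OF _ assms \<Sigma>] defines_td_iso[OF _ _ assms \<Sigma>]
    by (intro conjI allI impI) blast+
next
  fix G :: "'a pair_pre_digraph" assume G: "pair_graph G"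
  \<comment> \<open>The existence statement names no strategy, so one has to be supplied: repeating
    \<open>AllR\<close> forever, at every order, uses a reduced operation at infinitely many
    places.\<close>
  have "k_strategy k (replicate k (\<lambda>_. AllR))"
    by (auto simp: k_strategy_def strategy_def reduced_ops_def)
  note S = G assms this
  obtain T :: "'a set pair_pre_digraph" and \<V> where td: "defines_td (replicate k (\<lambda>_. AllR)) G T \<V>"
    using defines_td_ex[OF S] by blast
  have "tree_decomposition G T \<V>" using td by (simp add: defines_td_def td_of_seps_def)
  then show "\<exists>(T :: 'a set pair_pre_digraph) \<V>.
           tree_decomposition G T \<V> \<and> adhesion T \<V> < k \<and>
           distinguishes_blocks_and_tangles k G T \<V> \<and>
           (\<forall>\<phi>. graph_iso \<phi> G G \<longrightarrow> td_iso \<phi> T \<V> T \<V>)"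
    using defines_td_adhesion[OF S td] defines_td_distinguishes[OF S td] defines_td_iso[OF G S _ td td]
    by blast
qed

end
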